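(* An integral FCP extension $R\subset S$ of commutative rings is u-integral if and only if $R\subset S$ is locally an epimorphism, in which case $R\subset S$ is unramified.
   Context: All rings are commutative and unital; $\subset$ denotes proper inclusion. $[R,S]$ is the set of all $R$-subalgebras of $S$, ordered by inclusion; $R\subseteq S$ has FCP if each chain in $[R,S]$ is finite. An extension $A\subseteq B$ is u-elementary if $B=A[b]$ for some $b\in B$ with $b^2-b\in A$ and $b^3-b^2\in A$; it is cu-elementary if it is a tower of finitely many u-elementary extensions. $R\subseteq S$ is u-integral if there is a directed family $\{S_i\}_{i\in I}\subseteq[R,S]$ such that each $R\subseteq S_i$ is cu-elementary and $S=\bigcup_{i\in I}S_i$. A ring morphism $f:A\to B$ is locally an epimorphism if $A_{f^{-1}(Q)}\to B_Q$ is an epimorphism of commutative rings for every $Q\in\mathrm{Spec}(B)$. A ring morphism $R\to S$ is unramified if $S$ is of finite type as an $R$-algebra and $\Omega_R(S)=I/I^2=0$, where $I=\ker(S\otimes_RS\to S)$. *)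

theory Defs
  imports "HOL-Algebra.Algebra"
begin

text \<open>An extension \<open>R \<subseteq> S\<close> is given by a commutative ring \<open>S\<close> and a subring \<open>R\<close> of it; the
  ring \<open>R\<close> itself is \<open>S\<lparr>carrier := R\<rparr>\<close> and its structure morphism is the identity function.\<close>

section \<open>Chains of intermediate rings, integrality, u-integrality\<close>

definition subalgebras :: "('a, 'm) ring_scheme \<Rightarrow> 'a set \<Rightarrow> 'a set set"
  where "subalgebras S R = {T. subring T S \<and> R \<subseteq> T}"

definition FCP :: "('a, 'm) ring_scheme \<Rightarrow> 'a set \<Rightarrow> bool"
  where "FCP S R \<longleftrightarrow> (\<forall>\<C>. subset.chain (subalgebras S R) \<C> \<longrightarrow> finite \<C>)"

text \<open>Polynomials are coefficient lists with the leading coefficient first, so the lists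
  \<open>\<one> # p\<close> with \<open>set p \<subseteq> R\<close> are exactly the monic polynomials over \<open>R\<close>.\<close>

definition integral_extension :: "('a, 'm) ring_scheme \<Rightarrow> 'a set \<Rightarrow> bool"
  where "integral_extension S R \<longleftrightarrow>
    (\<forall>x \<in> carrier S. \<exists>p. set p \<subseteq> R \<and> ring.eval S (\<one>\<^bsub>S\<^esub> # p) x = \<zero>\<^bsub>S\<^esub>)"

definition u_elementary :: "('a, 'm) ring_scheme \<Rightarrow> 'a set \<Rightarrow> 'a set \<Rightarrow> bool"
  where "u_elementary S A B \<longleftrightarrow> subring A S \<and> subring B S \<and>
    (\<exists>b \<in> B. b [^]\<^bsub>S\<^esub> (2::nat) \<ominus>\<^bsub>S\<^esub> b \<in> A \<and> b [^]\<^bsub>S\<^esub> (3::nat) \<ominus>\<^bsub>S\<^esub> b [^]\<^bsub>S\<^esub> (2::nat) \<in> A \<and>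
       B = ring.simple_extension S A b)"

definition cu_elementary :: "('a, 'm) ring_scheme \<Rightarrow> 'a set \<Rightarrow> 'a set \<Rightarrow> bool"
  where "cu_elementary S = (u_elementary S)\<^sup>*\<^sup>*"

definition u_integral :: "('a, 'm) ring_scheme \<Rightarrow> 'a set \<Rightarrow> bool"
  where "u_integral S R \<longleftrightarrow> (\<exists>\<F> \<subseteq> subalgebras S R.
    \<F> \<noteq> {} \<and> (\<forall>T \<in> \<F>. \<forall>U \<in> \<F>. \<exists>V \<in> \<F>. T \<subseteq> V \<and> U \<subseteq> V) \<and>
    (\<forall>T \<in> \<F>. cu_elementary S R T) \<and> carrier S = \<Union>\<F>)"


section \<open>Epimorphisms of commutative rings\<close>

text \<open>A quantifier cannot range over rings of all types, so the test rings \<open>C\<close> are taken over one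
  type which is large enough: the subring of a test ring generated by the images of two morphisms
  \<open>g, h\<close> on \<open>B\<close> consists of finite sums of products \<open>g x \<otimes> h y\<close>.  The lemma
  \<open>cring_epi_cancel\<close> below shows that nothing is lost.\<close>

definition cring_epi ::
    "('a, 'm) ring_scheme \<Rightarrow> ('b, 'n) ring_scheme \<Rightarrow> ('a \<Rightarrow> 'b) \<Rightarrow> bool"
  where "cring_epi A B f \<longleftrightarrow> f \<in> ring_hom A B \<and>
    (\<forall>C :: ('b \<times> 'b) list ring. cring C \<longrightarrow>
      (\<forall>g \<in> ring_hom B C. \<forall>h \<in> ring_hom B C.
        (\<forall>a \<in> carrier A. g (f a) = h (f a)) \<longrightarrow> (\<forall>b \<in> carrier B. g b = h b)))"

fun pair_sum :: "('c, 'k) ring_scheme \<Rightarrow> ('b \<Rightarrow> 'c) \<Rightarrow> ('b \<Rightarrow> 'c) \<Rightarrow> ('b \<times> 'b) list \<Rightarrow> 'c"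
  where
    "pair_sum C g h [] = \<zero>\<^bsub>C\<^esub>"
  | "pair_sum C g h (z # zs) = g (fst z) \<otimes>\<^bsub>C\<^esub> h (snd z) \<oplus>\<^bsub>C\<^esub> pair_sum C g h zs"

lemma generate_images_subset_pair_sums:
  fixes B :: "('b, 'n) ring_scheme" and C :: "('c, 'k) ring_scheme"
  assumes B: "cring B" and C: "cring C" and g: "g \<in> ring_hom B C" and h: "h \<in> ring_hom B C"
  shows "generate_ring C (g ` carrier B \<union> h ` carrier B)
    \<subseteq> pair_sum C g h ` {zs. set zs \<subseteq> carrier B \<times> carrier B}" (is "_ \<subseteq> ?E ` ?L")
proof
  interpret B: cring B by (rule B)
  interpret C: cring C by (rule C)
  note [simp] = ring_hom_closed[OF g] ring_hom_closed[OF h] ring_hom_mult[OF g] ring_hom_mult[OF h]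
    ring_hom_one[OF g] ring_hom_one[OF h]
  have closed [simp]: "?E zs \<in> carrier C" if "zs \<in> ?L" for zs
    using that by (induction zs) auto
  have app: "?E (zs @ ws) = ?E zs \<oplus>\<^bsub>C\<^esub> ?E ws" if "zs \<in> ?L" "ws \<in> ?L" for zs ws
    using that(1) by (induction zs) (use that(2) in \<open>auto simp: C.a_assoc\<close>)
  have scale: "\<exists>vs \<in> ?L. ?E vs = (g x \<otimes>\<^bsub>C\<^esub> h y) \<otimes>\<^bsub>C\<^esub> ?E ws"
    if "ws \<in> ?L" "x \<in> carrier B" "y \<in> carrier B" for ws x y
  proof
    show "?E (map (\<lambda>w. (x \<otimes>\<^bsub>B\<^esub> fst w, y \<otimes>\<^bsub>B\<^esub> snd w)) ws) = (g x \<otimes>\<^bsub>C\<^esub> h y) \<otimes>\<^bsub>C\<^esub> ?E ws"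
      using that(1) by (induction ws) (use that(2,3) in \<open>auto simp: C.r_distr C.m_ac\<close>)
    show "map (\<lambda>w. (x \<otimes>\<^bsub>B\<^esub> fst w, y \<otimes>\<^bsub>B\<^esub> snd w)) ws \<in> ?L"
      using that by auto
  qed
  have mult: "\<exists>vs \<in> ?L. ?E vs = ?E zs \<otimes>\<^bsub>C\<^esub> ?E ws" if zs: "zs \<in> ?L" and ws: "ws \<in> ?L" for zs ws
    using zs
  proof (induction zs)
    case Nil
    then show ?case using ws by (intro bexI[of _ "[]"]) auto
  next
    case (Cons z zs)
    obtain x y where z: "z = (x, y)" "x \<in> carrier B" "y \<in> carrier B"
      using Cons.prems by auto
    obtain vs where vs: "vs \<in> ?L" "?E vs = ?E zs \<otimes>\<^bsub>C\<^esub> ?E ws"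
      using Cons by auto
    obtain us where us: "us \<in> ?L" "?E us = (g x \<otimes>\<^bsub>C\<^esub> h y) \<otimes>\<^bsub>C\<^esub> ?E ws"
      using scale[OF ws z(2,3)] by auto
    have "?E (us @ vs) = ?E (z # zs) \<otimes>\<^bsub>C\<^esub> ?E ws"
      using Cons.prems ws us vs z by (simp add: app C.l_distr)
    then show ?case using us(1) vs(1) by (intro bexI[of _ "us @ vs"]) auto
  qed
  have in_E: "c \<in> ?E ` ?L" if "\<exists>vs \<in> ?L. ?E vs = c" for c
    using that by blast
  fix c assume "c \<in> generate_ring C (g ` carrier B \<union> h ` carrier B)"
  then show "c \<in> ?E ` ?L"
  proof (induction rule: generate_ring.induct)
    case one
    show ?case by (rule in_E, intro bexI[of _ "[(\<one>\<^bsub>B\<^esub>, \<one>\<^bsub>B\<^esub>)]"]) auto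
  next
    case (incl c)
    then consider x where "x \<in> carrier B" "c = g x" | x where "x \<in> carrier B" "c = h x" by auto
    then show ?case
    proof cases
      case 1
      then show ?thesis by (intro in_E bexI[of _ "[(x, \<one>\<^bsub>B\<^esub>)]"]) auto
    next
      case 2
      then show ?thesis by (intro in_E bexI[of _ "[(\<one>\<^bsub>B\<^esub>, x)]"]) auto
    qed
  next
    case (a_inv c)
    then obtain zs where zs: "zs \<in> ?L" "c = ?E zs" by auto
    have neg: "g (\<ominus>\<^bsub>B\<^esub> \<one>\<^bsub>B\<^esub>) = \<ominus>\<^bsub>C\<^esub> \<one>\<^bsub>C\<^esub>"
      using ring_hom_cring.hom_a_inv[OF UnivPoly.ring_hom_cringI[OF B C g], of "\<one>\<^bsub>B\<^esub>"] by simp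
    have "\<exists>vs \<in> ?L. ?E vs = (g (\<ominus>\<^bsub>B\<^esub> \<one>\<^bsub>B\<^esub>) \<otimes>\<^bsub>C\<^esub> h \<one>\<^bsub>B\<^esub>) \<otimes>\<^bsub>C\<^esub> ?E zs"
      using zs(1) by (intro scale) auto
    then show ?case using zs neg by (intro in_E) (auto simp: C.l_minus)
  next
    case (eng_add c d)
    then obtain zs ws where "zs \<in> ?L" "c = ?E zs" "ws \<in> ?L" "d = ?E ws" by auto
    then show ?case by (intro in_E bexI[of _ "zs @ ws"]) (auto simp: app)
  next
    case (eng_mult c d)
    then obtain zs ws where "zs \<in> ?L" "c = ?E zs" "ws \<in> ?L" "d = ?E ws" by auto
    then show ?case using mult[of zs ws] by (intro in_E) auto
  qed
qed

lemma cring_epi_cancel: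
  fixes B :: "('b, 'n) ring_scheme" and C :: "('c, 'k) ring_scheme"
  assumes epi: "cring_epi A B f" and B: "cring B" and C: "cring C"
    and g: "g \<in> ring_hom B C" and h: "h \<in> ring_hom B C"
    and eq: "\<And>a. a \<in> carrier A \<Longrightarrow> g (f a) = h (f a)" and b: "b \<in> carrier B"
  shows "g b = h b"
proof -
  interpret C: cring C by (rule C)
  define G where "G = g ` carrier B \<union> h ` carrier B"
  define D where "D = generate_ring C G"
  define k where "k = inv_into ({zs. set zs \<subseteq> carrier B \<times> carrier B}) (pair_sum C g h)"
  have G: "G \<subseteq> carrier C"
    using g h by (auto simp: G_def ring_hom_def)
  have sub: "subring D C"
    unfolding D_def by (rule C.generate_ring_is_subring[OF G])
  interpret D: cring "C\<lparr>carrier := D\<rparr>"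
    using C.subcringI'[OF sub] C.subcring_iff[OF subringE(1)[OF sub]] by blast
  have inj: "inj_on k D"
    unfolding k_def D_def G_def
    using generate_images_subset_pair_sums[OF B C g h] by (rule inj_on_inv_into)
  let ?I = "image_ring k (C\<lparr>carrier := D\<rparr>) :: ('b \<times> 'b) list ring"
  have iso: "k \<in> ring_iso (C\<lparr>carrier := D\<rparr>) ?I"
    using inj by (intro inj_imp_image_ring_iso) simp
  then have hom: "k \<in> ring_hom (C\<lparr>carrier := D\<rparr>) ?I"
    by (simp add: ring_iso_def)
  have I: "cring ?I"
    using D.ring_iso_imp_img_cring[OF iso]
    by (simp add: image_ring_def image_group_def monoid.defs)
  have GD: "g x \<in> D" "h x \<in> D" if "x \<in> carrier B" for x
    using that unfolding D_def G_def by (auto intro: generate_ring.incl)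
  have "g \<in> ring_hom B (C\<lparr>carrier := D\<rparr>)" "h \<in> ring_hom B (C\<lparr>carrier := D\<rparr>)"
    using g h GD by (auto simp: ring_hom_def)
  then have kg: "k \<circ> g \<in> ring_hom B ?I" and kh: "k \<circ> h \<in> ring_hom B ?I"
    using hom ring_hom_trans by blast+
  have test: "\<forall>C :: ('b \<times> 'b) list ring. cring C \<longrightarrow>
      (\<forall>g \<in> ring_hom B C. \<forall>h \<in> ring_hom B C.
        (\<forall>a \<in> carrier A. g (f a) = h (f a)) \<longrightarrow> (\<forall>b \<in> carrier B. g b = h b))"
    using epi by (simp add: cring_epi_def)
  have "\<forall>a \<in> carrier A. (k \<circ> g) (f a) = (k \<circ> h) (f a)"
    using eq by simp
  then have "(k \<circ> g) b = (k \<circ> h) b"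
    using test[THEN spec, THEN mp, OF I, THEN bspec, OF kg, THEN bspec, OF kh] b by blast
  then show ?thesis
    using inj GD[OF b] by (auto dest: inj_onD)
qed


section \<open>Localization at a prime ideal\<close>

definition fraction :: "('a, 'm) ring_scheme \<Rightarrow> 'a set \<Rightarrow> 'a \<Rightarrow> 'a \<Rightarrow> ('a \<times> 'a) set"
  where "fraction A P a s = {(b, t). b \<in> carrier A \<and> t \<in> carrier A - P \<and>
    (\<exists>u \<in> carrier A - P. u \<otimes>\<^bsub>A\<^esub> (a \<otimes>\<^bsub>A\<^esub> t \<ominus>\<^bsub>A\<^esub> b \<otimes>\<^bsub>A\<^esub> s) = \<zero>\<^bsub>A\<^esub>)}"

text \<open>In the operations, and in the induced map below, all members of the unions coincide.\<close>

definition localization :: "('a, 'm) ring_scheme \<Rightarrow> 'a set \<Rightarrow> ('a \<times> 'a) set ring"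
  where "localization A P =
    \<lparr>carrier = {fraction A P a s | a s. a \<in> carrier A \<and> s \<in> carrier A - P},
     monoid.mult = (\<lambda>U V. \<Union>(a, s) \<in> U. \<Union>(b, t) \<in> V. fraction A P (a \<otimes>\<^bsub>A\<^esub> b) (s \<otimes>\<^bsub>A\<^esub> t)),
     monoid.one = fraction A P \<one>\<^bsub>A\<^esub> \<one>\<^bsub>A\<^esub>,
     ring.zero = fraction A P \<zero>\<^bsub>A\<^esub> \<one>\<^bsub>A\<^esub>,
     ring.add = (\<lambda>U V. \<Union>(a, s) \<in> U. \<Union>(b, t) \<in> V.
       fraction A P (a \<otimes>\<^bsub>A\<^esub> t \<oplus>\<^bsub>A\<^esub> b \<otimes>\<^bsub>A\<^esub> s) (s \<otimes>\<^bsub>A\<^esub> t))\<rparr>"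

definition localization_map ::
    "('b, 'n) ring_scheme \<Rightarrow> 'b set \<Rightarrow> ('a \<Rightarrow> 'b) \<Rightarrow> ('a \<times> 'a) set \<Rightarrow> ('b \<times> 'b) set"
  where "localization_map B Q f U = (\<Union>(a, s) \<in> U. fraction B Q (f a) (f s))"

context
  fixes A :: "('a, 'm) ring_scheme" (structure) and P
  assumes A: "cring A" and P: "primeideal P A"
begin

interpretation cring A by (rule A)

lemma denominator_mult: 
  "s \<in> carrier A - P \<Longrightarrow> t \<in> carrier A - P \<Longrightarrow> s \<otimes> t \<in> carrier A - P"
  using primeideal.I_prime[OF P] by auto

lemma denominator_one: "\<one> \<in> carrier A - P"
  using primeideal.I_notcarr[OF P] ideal.one_imp_carrier[OF primeideal.axioms(1)[OF P]] by auto

lemma fraction_trans: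
  assumes c: "a \<in> carrier A" "s \<in> carrier A - P" "b \<in> carrier A" "t \<in> carrier A - P"
      "c \<in> carrier A" "w \<in> carrier A - P"
    and 1: "u \<in> carrier A - P" "u \<otimes> (a \<otimes> t \<ominus> b \<otimes> s) = \<zero>"
    and 2: "v \<in> carrier A - P" "v \<otimes> (b \<otimes> w \<ominus> c \<otimes> t) = \<zero>"
  shows "\<exists>u \<in> carrier A - P. u \<otimes> (a \<otimes> w \<ominus> c \<otimes> s) = \<zero>"
proof
  have el [simp]: "s \<in> carrier A" "t \<in> carrier A" "w \<in> carrier A" "u \<in> carrier A" "v \<in> carrier A"
    "a \<in> carrier A" "b \<in> carrier A" "c \<in> carrier A"
    using c 1(1) 2(1) by auto
  have "(u \<otimes> v \<otimes> t) \<otimes> (a \<otimes> w \<ominus> c \<otimes> s) =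
      (v \<otimes> w) \<otimes> (u \<otimes> (a \<otimes> t \<ominus> b \<otimes> s)) \<oplus> (u \<otimes> s) \<otimes> (v \<otimes> (b \<otimes> w \<ominus> c \<otimes> t))"
    using el by algebra
  also have "\<dots> = \<zero>" using 1(2) 2(2) by simp
  finally show "(u \<otimes> v \<otimes> t) \<otimes> (a \<otimes> w \<ominus> c \<otimes> s) = \<zero>" .
  show "u \<otimes> v \<otimes> t \<in> carrier A - P"
    using c 1(1) 2(1) by (intro denominator_mult)
qed

lemma fraction_sym:
  assumes "a \<in> carrier A" "s \<in> carrier A - P" "b \<in> carrier A" "t \<in> carrier A - P"
    "u \<in> carrier A - P" "u \<otimes> (a \<otimes> t \<ominus> b \<otimes> s) = \<zero>"
  shows "u \<otimes> (b \<otimes> s \<ominus> a \<otimes> t) = \<zero>"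
proof -
  have "u \<otimes> (b \<otimes> s \<ominus> a \<otimes> t) = \<ominus> (u \<otimes> (a \<otimes> t \<ominus> b \<otimes> s))"
    using assms(1,3) assms(2,4,5)[THEN DiffD1] by algebra
  then show ?thesis using assms(6) by simp
qed

lemma mem_fraction_iff:
  "(b, t) \<in> fraction A P a s \<longleftrightarrow> b \<in> carrier A \<and> t \<in> carrier A - P \<and>
    (\<exists>u \<in> carrier A - P. u \<otimes> (a \<otimes> t \<ominus> b \<otimes> s) = \<zero>)"
  by (simp add: fraction_def)

lemma fraction_refl:
  assumes "a \<in> carrier A" "s \<in> carrier A - P"
  shows "(a, s) \<in> fraction A P a s"
  unfolding mem_fraction_iff
  using assms denominator_one by (auto intro!: bexI[of _ \<one>] simp: a_minus_def r_neg)

lemma fraction_eq_iff: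
  assumes "a \<in> carrier A" "s \<in> carrier A - P" "b \<in> carrier A" "t \<in> carrier A - P"
  shows "fraction A P a s = fraction A P b t \<longleftrightarrow>
    (\<exists>u \<in> carrier A - P. u \<otimes> (a \<otimes> t \<ominus> b \<otimes> s) = \<zero>)"
proof
  assume "fraction A P a s = fraction A P b t"
  then have "(b, t) \<in> fraction A P a s" using fraction_refl assms by simp
  then show "\<exists>u \<in> carrier A - P. u \<otimes> (a \<otimes> t \<ominus> b \<otimes> s) = \<zero>"
    by (simp add: mem_fraction_iff)
next
  assume "\<exists>u \<in> carrier A - P. u \<otimes> (a \<otimes> t \<ominus> b \<otimes> s) = \<zero>"
  then obtain u where u: "u \<in> carrier A - P" "u \<otimes> (a \<otimes> t \<ominus> b \<otimes> s) = \<zero>" by blast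
  have "(c, w) \<in> fraction A P a s \<longleftrightarrow> (c, w) \<in> fraction A P b t" for c w
  proof
    assume "(c, w) \<in> fraction A P b t"
    then obtain v where "c \<in> carrier A" "w \<in> carrier A - P" "v \<in> carrier A - P"
      "v \<otimes> (b \<otimes> w \<ominus> c \<otimes> t) = \<zero>"
      unfolding mem_fraction_iff by blast
    then show "(c, w) \<in> fraction A P a s"
      using fraction_trans[OF assms _ _ u] by (simp add: mem_fraction_iff)
  next
    assume "(c, w) \<in> fraction A P a s"
    then obtain v where "c \<in> carrier A" "w \<in> carrier A - P" "v \<in> carrier A - P"
      "v \<otimes> (a \<otimes> w \<ominus> c \<otimes> s) = \<zero>"
      unfolding mem_fraction_iff by blast
    then show "(c, w) \<in> fraction A P b t"
      using fraction_trans[OF assms(3,4,1,2) _ _ u(1) fraction_sym[OF assms u]]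
      by (simp add: mem_fraction_iff)
  qed
  then show "fraction A P a s = fraction A P b t" by auto
qed

lemma fraction_eqI:
  assumes "a \<in> carrier A" "s \<in> carrier A - P" "b \<in> carrier A" "t \<in> carrier A - P"
    "a \<otimes> t = b \<otimes> s"
  shows "fraction A P a s = fraction A P b t"
  using assms denominator_one
  by (subst fraction_eq_iff) (auto intro!: bexI[of _ \<one>] simp: a_minus_def r_neg)

lemma mem_fractionD:
  assumes "(b, t) \<in> fraction A P a s" "a \<in> carrier A" "s \<in> carrier A - P"
  shows "b \<in> carrier A" "t \<in> carrier A - P" "fraction A P b t = fraction A P a s"
  using assms fraction_eq_iff[of a s b t] by (auto simp: mem_fraction_iff)

lemma UN_fraction_const:
  assumes "a \<in> carrier A" "s \<in> carrier A - P"
    and "\<And>b t. b \<in> carrier A \<Longrightarrow> t \<in> carrier A - P \<Longrightarrow> fraction A P b t = fraction A P a s \<Longrightarrow>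
      F b t = F a s"
  shows "(\<Union>(b, t) \<in> fraction A P a s. F b t) = F a s"
proof -
  have "F b t = F a s" if "(b, t) \<in> fraction A P a s" for b t
    using mem_fractionD[OF that assms(1,2)] assms(3) by blast
  then show ?thesis using fraction_refl[OF assms(1,2)] by fast
qed

lemma fraction_mult_cong:
  assumes c: "a \<in> carrier A" "s \<in> carrier A - P" "b \<in> carrier A" "t \<in> carrier A - P"
    "a' \<in> carrier A" "s' \<in> carrier A - P" "b' \<in> carrier A" "t' \<in> carrier A - P"
    and "fraction A P a s = fraction A P a' s'" "fraction A P b t = fraction A P b' t'"
  shows "fraction A P (a \<otimes> b) (s \<otimes> t) = fraction A P (a' \<otimes> b') (s' \<otimes> t')"
proof -
  obtain u v where u: "u \<in> carrier A - P" "u \<otimes> (a \<otimes> s' \<ominus> a' \<otimes> s) = \<zero>"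
    and v: "v \<in> carrier A - P" "v \<otimes> (b \<otimes> t' \<ominus> b' \<otimes> t) = \<zero>"
    using assms(9,10) c by (auto simp: fraction_eq_iff)
  have el [simp]: "s \<in> carrier A" "t \<in> carrier A" "s' \<in> carrier A" "t' \<in> carrier A" "u \<in> carrier A"
    "v \<in> carrier A" "a \<in> carrier A" "b \<in> carrier A" "a' \<in> carrier A" "b' \<in> carrier A"
    using c u(1) v(1) by auto
  have "(u \<otimes> v) \<otimes> ((a \<otimes> b) \<otimes> (s' \<otimes> t') \<ominus> (a' \<otimes> b') \<otimes> (s \<otimes> t)) =
      (v \<otimes> b \<otimes> t') \<otimes> (u \<otimes> (a \<otimes> s' \<ominus> a' \<otimes> s)) \<oplus> (u \<otimes> a' \<otimes> s) \<otimes> (v \<otimes> (b \<otimes> t' \<ominus> b' \<otimes> t))"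
    using el by algebra
  also have "\<dots> = \<zero>" using u(2) v(2) by simp
  finally show ?thesis
    using c u(1) v(1) by (subst fraction_eq_iff) (auto intro!: denominator_mult bexI[of _ "u \<otimes> v"] simp del: Diff_iff)
qed

lemma fraction_add_cong:
  assumes c: "a \<in> carrier A" "s \<in> carrier A - P" "b \<in> carrier A" "t \<in> carrier A - P"
    "a' \<in> carrier A" "s' \<in> carrier A - P" "b' \<in> carrier A" "t' \<in> carrier A - P"
    and "fraction A P a s = fraction A P a' s'" "fraction A P b t = fraction A P b' t'"
  shows "fraction A P (a \<otimes> t \<oplus> b \<otimes> s) (s \<otimes> t) = fraction A P (a' \<otimes> t' \<oplus> b' \<otimes> s') (s' \<otimes> t')"
proof -
  obtain u v where u: "u \<in> carrier A - P" "u \<otimes> (a \<otimes> s' \<ominus> a' \<otimes> s) = \<zero>"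
    and v: "v \<in> carrier A - P" "v \<otimes> (b \<otimes> t' \<ominus> b' \<otimes> t) = \<zero>"
    using assms(9,10) c by (auto simp: fraction_eq_iff)
  have el [simp]: "s \<in> carrier A" "t \<in> carrier A" "s' \<in> carrier A" "t' \<in> carrier A" "u \<in> carrier A"
    "v \<in> carrier A" "a \<in> carrier A" "b \<in> carrier A" "a' \<in> carrier A" "b' \<in> carrier A"
    using c u(1) v(1) by auto
  have "(u \<otimes> v) \<otimes> ((a \<otimes> t \<oplus> b \<otimes> s) \<otimes> (s' \<otimes> t') \<ominus> (a' \<otimes> t' \<oplus> b' \<otimes> s') \<otimes> (s \<otimes> t)) =
      (v \<otimes> t \<otimes> t') \<otimes> (u \<otimes> (a \<otimes> s' \<ominus> a' \<otimes> s)) \<oplus> (u \<otimes> s \<otimes> s') \<otimes> (v \<otimes> (b \<otimes> t' \<ominus> b' \<otimes> t))"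
    using el by algebra
  also have "\<dots> = \<zero>" using u(2) v(2) by simp
  finally show ?thesis
    using c u(1) v(1) by (subst fraction_eq_iff) (auto intro!: denominator_mult bexI[of _ "u \<otimes> v"] simp del: Diff_iff)
qed

lemma localization_mult:
  assumes "a \<in> carrier A" "s \<in> carrier A - P" "b \<in> carrier A" "t \<in> carrier A - P"
  shows "fraction A P a s \<otimes>\<^bsub>localization A P\<^esub> fraction A P b t = fraction A P (a \<otimes> b) (s \<otimes> t)"
proof -
  have inner: "(\<Union>(b', t') \<in> fraction A P b t. fraction A P (a' \<otimes> b') (s' \<otimes> t')) =
      fraction A P (a' \<otimes> b) (s' \<otimes> t)" if "a' \<in> carrier A" "s' \<in> carrier A - P" for a' s'
    by (intro UN_fraction_const fraction_mult_cong refl) (use assms that in simp_all)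
  have outer: "fraction A P (a' \<otimes> b) (s' \<otimes> t) = fraction A P (a \<otimes> b) (s \<otimes> t)"
    if "a' \<in> carrier A" "s' \<in> carrier A - P" "fraction A P a' s' = fraction A P a s" for a' s'
    by (intro fraction_mult_cong refl) (use assms that in simp_all)
  have "(\<Union>(a', s') \<in> fraction A P a s. \<Union>(b', t') \<in> fraction A P b t.
        fraction A P (a' \<otimes> b') (s' \<otimes> t')) = (\<Union>(b', t') \<in> fraction A P b t. fraction A P (a \<otimes> b') (s \<otimes> t'))"
  proof (rule UN_fraction_const[OF assms(1,2)])
    fix a' s' assume eq: "a' \<in> carrier A" "s' \<in> carrier A - P" "fraction A P a' s' = fraction A P a s"
    show "(\<Union>(b', t') \<in> fraction A P b t. fraction A P (a' \<otimes> b') (s' \<otimes> t')) =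
        (\<Union>(b', t') \<in> fraction A P b t. fraction A P (a \<otimes> b') (s \<otimes> t'))"
      unfolding inner[OF eq(1,2)] inner[OF assms(1,2)] by (rule outer[OF eq])
  qed
  then show ?thesis
    using inner[OF assms(1,2)] by (simp add: localization_def)
qed

lemma localization_add:
  assumes "a \<in> carrier A" "s \<in> carrier A - P" "b \<in> carrier A" "t \<in> carrier A - P"
  shows "fraction A P a s \<oplus>\<^bsub>localization A P\<^esub> fraction A P b t =
    fraction A P (a \<otimes> t \<oplus> b \<otimes> s) (s \<otimes> t)"
proof -
  have inner: "(\<Union>(b', t') \<in> fraction A P b t. fraction A P (a' \<otimes> t' \<oplus> b' \<otimes> s') (s' \<otimes> t')) =
      fraction A P (a' \<otimes> t \<oplus> b \<otimes> s') (s' \<otimes> t)" if "a' \<in> carrier A" "s' \<in> carrier A - P" for a' s'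
    by (intro UN_fraction_const fraction_add_cong refl) (use assms that in simp_all)
  have outer: "fraction A P (a' \<otimes> t \<oplus> b \<otimes> s') (s' \<otimes> t) = fraction A P (a \<otimes> t \<oplus> b \<otimes> s) (s \<otimes> t)"
    if "a' \<in> carrier A" "s' \<in> carrier A - P" "fraction A P a' s' = fraction A P a s" for a' s'
    by (intro fraction_add_cong refl) (use assms that in simp_all)
  have "(\<Union>(a', s') \<in> fraction A P a s. \<Union>(b', t') \<in> fraction A P b t.
        fraction A P (a' \<otimes> t' \<oplus> b' \<otimes> s') (s' \<otimes> t')) = (\<Union>(b', t') \<in> fraction A P b t. fraction A P (a \<otimes> t' \<oplus> b' \<otimes> s) (s \<otimes> t'))"
  proof (rule UN_fraction_const[OF assms(1,2)])
    fix a' s' assume eq: "a' \<in> carrier A" "s' \<in> carrier A - P" "fraction A P a' s' = fraction A P a s"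
    show "(\<Union>(b', t') \<in> fraction A P b t. fraction A P (a' \<otimes> t' \<oplus> b' \<otimes> s') (s' \<otimes> t')) =
        (\<Union>(b', t') \<in> fraction A P b t. fraction A P (a \<otimes> t' \<oplus> b' \<otimes> s) (s \<otimes> t'))"
      unfolding inner[OF eq(1,2)] inner[OF assms(1,2)] by (rule outer[OF eq])
  qed
  then show ?thesis
    using inner[OF assms(1,2)] by (simp add: localization_def)
qed

lemma localization_carrierI:
  "a \<in> carrier A \<Longrightarrow> s \<in> carrier A - P \<Longrightarrow> fraction A P a s \<in> carrier (localization A P)"
  by (auto simp: localization_def)

lemma localization_carrierE:
  assumes "x \<in> carrier (localization A P)"
  obtains a s where "x = fraction A P a s" "a \<in> carrier A" "s \<in> carrier A - P"
  using assms by (auto simp: localization_def)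

lemma localization_zero: "\<zero>\<^bsub>localization A P\<^esub> = fraction A P \<zero> \<one>"
  and localization_one: "\<one>\<^bsub>localization A P\<^esub> = fraction A P \<one> \<one>"
  by (simp_all add: localization_def)

lemma localization_cring: "cring (localization A P)"
proof (rule cringI)
  note simps = localization_mult localization_add localization_zero localization_one
  note cl = denominator_mult denominator_one
  have sub: "s \<in> carrier A - P \<Longrightarrow> s \<in> carrier A" for s by simp
  show "abelian_group (localization A P)"
  proof (rule abelian_groupI)
    fix x y z assume "x \<in> carrier (localization A P)" "y \<in> carrier (localization A P)"
      "z \<in> carrier (localization A P)"
    then obtain a s b t c w where xyz: "x = fraction A P a s" "y = fraction A P b t"
        "z = fraction A P c w"
      and c: "a \<in> carrier A" "s \<in> carrier A - P" "b \<in> carrier A" "t \<in> carrier A - P"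
        "c \<in> carrier A" "w \<in> carrier A - P"
      by (metis localization_carrierE)
    note el [simp] = c(1,3,5) c(2,4,6)[THEN sub]
    show "x \<oplus>\<^bsub>localization A P\<^esub> y \<oplus>\<^bsub>localization A P\<^esub> z =
        x \<oplus>\<^bsub>localization A P\<^esub> (y \<oplus>\<^bsub>localization A P\<^esub> z)"
      unfolding xyz using c by (simp add: simps cl del: Diff_iff) (intro fraction_eqI; (simp add: cl del: Diff_iff | (use el in algebra)))
  next
    fix x y assume "x \<in> carrier (localization A P)" "y \<in> carrier (localization A P)"
    then obtain a s b t where xyz: "x = fraction A P a s" "y = fraction A P b t"
      and c: "a \<in> carrier A" "s \<in> carrier A - P" "b \<in> carrier A" "t \<in> carrier A - P"
      by (metis localization_carrierE)
    note el [simp] = c(1,3) c(2,4)[THEN sub]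
    show "x \<oplus>\<^bsub>localization A P\<^esub> y \<in> carrier (localization A P)"
      unfolding xyz using c by (simp add: simps cl localization_carrierI del: Diff_iff)
    show "x \<oplus>\<^bsub>localization A P\<^esub> y = y \<oplus>\<^bsub>localization A P\<^esub> x"
      unfolding xyz using c by (simp add: simps cl del: Diff_iff) (intro fraction_eqI; (simp add: cl del: Diff_iff | (use el in algebra)))
  next
    show "\<zero>\<^bsub>localization A P\<^esub> \<in> carrier (localization A P)"
      unfolding simps using cl by (intro localization_carrierI) auto
  next
    fix x assume "x \<in> carrier (localization A P)"
    then obtain a s where xyz: "x = fraction A P a s"
      and c: "a \<in> carrier A" "s \<in> carrier A - P"
      by (metis localization_carrierE)
    note el [simp] = c(1) c(2)[THEN sub]
    show "\<zero>\<^bsub>localization A P\<^esub> \<oplus>\<^bsub>localization A P\<^esub> x = x"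
      unfolding xyz using c by (simp add: simps cl del: Diff_iff)
    show "\<exists>y \<in> carrier (localization A P). y \<oplus>\<^bsub>localization A P\<^esub> x = \<zero>\<^bsub>localization A P\<^esub>"
    proof
      show "fraction A P (\<ominus> a) s \<oplus>\<^bsub>localization A P\<^esub> x = \<zero>\<^bsub>localization A P\<^esub>"
        unfolding xyz using c by (simp add: simps cl del: Diff_iff) (intro fraction_eqI; (simp add: cl l_minus l_neg del: Diff_iff | (use el in algebra)))
      show "fraction A P (\<ominus> a) s \<in> carrier (localization A P)"
        using c by (intro localization_carrierI) auto
    qed
  qed
  show "comm_monoid (localization A P)"
  proof (rule comm_monoidI)
    fix x y z assume "x \<in> carrier (localization A P)" "y \<in> carrier (localization A P)"
      "z \<in> carrier (localization A P)"
    then obtain a s b t c w where xyz: "x = fraction A P a s" "y = fraction A P b t"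
        "z = fraction A P c w"
      and c: "a \<in> carrier A" "s \<in> carrier A - P" "b \<in> carrier A" "t \<in> carrier A - P"
        "c \<in> carrier A" "w \<in> carrier A - P"
      by (metis localization_carrierE)
    note el [simp] = c(1,3,5) c(2,4,6)[THEN sub]
    show "x \<otimes>\<^bsub>localization A P\<^esub> y \<otimes>\<^bsub>localization A P\<^esub> z =
        x \<otimes>\<^bsub>localization A P\<^esub> (y \<otimes>\<^bsub>localization A P\<^esub> z)"
      unfolding xyz using c by (simp add: simps cl m_assoc del: Diff_iff)
  next
    fix x y assume "x \<in> carrier (localization A P)" "y \<in> carrier (localization A P)"
    then obtain a s b t where xyz: "x = fraction A P a s" "y = fraction A P b t"
      and c: "a \<in> carrier A" "s \<in> carrier A - P" "b \<in> carrier A" "t \<in> carrier A - P"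
      by (metis localization_carrierE)
    note el [simp] = c(1,3) c(2,4)[THEN sub]
    show "x \<otimes>\<^bsub>localization A P\<^esub> y \<in> carrier (localization A P)"
      unfolding xyz using c by (simp add: simps cl localization_carrierI del: Diff_iff)
    show "x \<otimes>\<^bsub>localization A P\<^esub> y = y \<otimes>\<^bsub>localization A P\<^esub> x"
      unfolding xyz using c by (simp add: simps cl m_comm del: Diff_iff)
  next
    show "\<one>\<^bsub>localization A P\<^esub> \<in> carrier (localization A P)"
      unfolding simps using cl by (intro localization_carrierI) auto
  next
    fix x assume "x \<in> carrier (localization A P)"
    then obtain a s where xyz: "x = fraction A P a s"
      and c: "a \<in> carrier A" "s \<in> carrier A - P"
      by (metis localization_carrierE)
    note el [simp] = c(1) c(2)[THEN sub]
    show "\<one>\<^bsub>localization A P\<^esub> \<otimes>\<^bsub>localization A P\<^esub> x = x"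
      unfolding xyz using c by (simp add: simps cl del: Diff_iff)
  qed
  fix x y z assume "x \<in> carrier (localization A P)" "y \<in> carrier (localization A P)"
    "z \<in> carrier (localization A P)"
  then obtain a s b t c w where xyz: "x = fraction A P a s" "y = fraction A P b t"
      "z = fraction A P c w"
    and c: "a \<in> carrier A" "s \<in> carrier A - P" "b \<in> carrier A" "t \<in> carrier A - P"
      "c \<in> carrier A" "w \<in> carrier A - P"
    by (metis localization_carrierE)
  note el [simp] = c(1,3,5) c(2,4,6)[THEN sub]
  show "(x \<oplus>\<^bsub>localization A P\<^esub> y) \<otimes>\<^bsub>localization A P\<^esub> z =
      x \<otimes>\<^bsub>localization A P\<^esub> z \<oplus>\<^bsub>localization A P\<^esub> y \<otimes>\<^bsub>localization A P\<^esub> z"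
    unfolding xyz using c by (simp add: simps cl del: Diff_iff) (intro fraction_eqI; (simp add: cl del: Diff_iff | (use el in algebra)))
qed

end

lemma localization_map_fraction:
  assumes "cring A" "cring B" "f \<in> ring_hom A B" "primeideal Q B"
    and P: "P = {a \<in> carrier A. f a \<in> Q}"
    and "a \<in> carrier A" "s \<in> carrier A - P"
  shows "localization_map B Q f (fraction A P a s) = fraction B Q (f a) (f s)"
proof -
  interpret f: ring_hom_cring A B f
    using assms by (intro UnivPoly.ring_hom_cringI)
  have prime: "primeideal P A"
    unfolding P
    using ring_hom_ring.primeideal_vimage[OF ring_hom_ringI2 assms(1,4)] assms(1-3)
    by (simp add: cring.axioms)
  show ?thesis
    unfolding localization_map_def
  proof (rule UN_fraction_const[OF assms(1) prime])
    fix b t assume b: "b \<in> carrier A" "t \<in> carrier A - P" "fraction A P b t = fraction A P a s"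
    then obtain u where u: "u \<in> carrier A - P" "u \<otimes>\<^bsub>A\<^esub> (b \<otimes>\<^bsub>A\<^esub> s \<ominus>\<^bsub>A\<^esub> a \<otimes>\<^bsub>A\<^esub> t) = \<zero>\<^bsub>A\<^esub>"
      using fraction_eq_iff[OF assms(1) prime] assms(6,7) by metis
    have "f u \<otimes>\<^bsub>B\<^esub> (f b \<otimes>\<^bsub>B\<^esub> f s \<ominus>\<^bsub>B\<^esub> f a \<otimes>\<^bsub>B\<^esub> f t) = f (u \<otimes>\<^bsub>A\<^esub> (b \<otimes>\<^bsub>A\<^esub> s \<ominus>\<^bsub>A\<^esub> a \<otimes>\<^bsub>A\<^esub> t))"
      using u(1) b(1,2) assms(6,7) by (simp add: a_minus_def)
    then show "fraction B Q (f b) (f t) = fraction B Q (f a) (f s)"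
      using u b(1,2) assms(6,7) unfolding P
      by (subst fraction_eq_iff[OF assms(2,4)]) (auto intro!: bexI[of _ "f u"])
  qed (use assms in auto)
qed


lemma localization_map_hom:
  assumes A: "cring A" and B: "cring B" and f: "f \<in> ring_hom A B" and Q: "primeideal Q B"
    and P: "P = {a \<in> carrier A. f a \<in> Q}"
  shows "localization_map B Q f \<in> ring_hom (localization A P) (localization B Q)"
proof -
  interpret f: ring_hom_cring A B f
    using assms by (intro UnivPoly.ring_hom_cringI)
  have prime: "primeideal P A"
    unfolding P
    using ring_hom_ring.primeideal_vimage[OF ring_hom_ringI2 assms(1,4)] assms(1-3)
    by (simp add: cring.axioms)
  have fQ: "f s \<in> carrier B - Q" if "s \<in> carrier A - P" for s
    using that unfolding P by auto
  note map = localization_map_fraction[OF assms]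
  note simps = map localization_mult[OF A prime] localization_mult[OF B Q]
    localization_add[OF A prime] localization_add[OF B Q] fQ denominator_mult[OF A prime]
  show ?thesis
  proof (rule ring_hom_memI)
    fix x assume "x \<in> carrier (localization A P)"
    then obtain a s where x: "x = fraction A P a s" "a \<in> carrier A" "s \<in> carrier A - P"
      by (metis localization_carrierE[OF A prime])
    then have "localization_map B Q f x = fraction B Q (f a) (f s)"
      by (simp add: map del: Diff_iff)
    then show "localization_map B Q f x \<in> carrier (localization B Q)"
      using x fQ localization_carrierI[OF B Q] by simp
  next
    fix x y assume "x \<in> carrier (localization A P)" "y \<in> carrier (localization A P)"
    then obtain a s b t where xy: "x = fraction A P a s" "y = fraction A P b t"
      and c: "a \<in> carrier A" "s \<in> carrier A - P" "b \<in> carrier A" "t \<in> carrier A - P"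
      by (metis localization_carrierE[OF A prime])
    have [simp]: "s \<in> carrier A" "t \<in> carrier A" using c by auto
    show "localization_map B Q f (x \<otimes>\<^bsub>localization A P\<^esub> y) =
        localization_map B Q f x \<otimes>\<^bsub>localization B Q\<^esub> localization_map B Q f y"
      unfolding xy using c by (simp add: simps del: Diff_iff)
    show "localization_map B Q f (x \<oplus>\<^bsub>localization A P\<^esub> y) =
        localization_map B Q f x \<oplus>\<^bsub>localization B Q\<^esub> localization_map B Q f y"
      unfolding xy using c by (simp add: simps del: Diff_iff)
  next
    show "localization_map B Q f \<one>\<^bsub>localization A P\<^esub> = \<one>\<^bsub>localization B Q\<^esub>"
      using denominator_one[OF A prime]
      by (simp add: map localization_one[OF A prime] localization_one[OF B Q] del: Diff_iff)
  qed
qed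

definition locally_epi ::
    "('a, 'm) ring_scheme \<Rightarrow> ('b, 'n) ring_scheme \<Rightarrow> ('a \<Rightarrow> 'b) \<Rightarrow> bool"
  where "locally_epi A B f \<longleftrightarrow> f \<in> ring_hom A B \<and>
    (\<forall>Q. primeideal Q B \<longrightarrow>
      cring_epi (localization A {a \<in> carrier A. f a \<in> Q}) (localization B Q)
        (localization_map B Q f))"


section \<open>Differentials and unramified morphisms\<close>

text \<open>\<open>B \<otimes>\<^sub>A B\<close> is the ring \<open>\<int>[B \<times> B]\<close> of the multiplicative monoid \<open>B \<times> B\<close> modulo the
  bilinearity relations.\<close>

definition pair_ring :: "('b, 'n) ring_scheme \<Rightarrow> ('b \<times> 'b \<Rightarrow>\<^sub>0 int) ring"
  where "pair_ring B =
    \<lparr>carrier = carrier (free_Abelian_group (carrier B \<times> carrier B)),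
     monoid.mult = (\<lambda>p q. frag_extend (\<lambda>(x, y). frag_extend (\<lambda>(x', y').
       frag_of (x \<otimes>\<^bsub>B\<^esub> x', y \<otimes>\<^bsub>B\<^esub> y')) q) p),
     monoid.one = frag_of (\<one>\<^bsub>B\<^esub>, \<one>\<^bsub>B\<^esub>),
     ring.zero = 0,
     ring.add = (+)\<rparr>"

definition bilinear_relations ::
    "('a, 'm) ring_scheme \<Rightarrow> ('b, 'n) ring_scheme \<Rightarrow> ('a \<Rightarrow> 'b) \<Rightarrow> ('b \<times> 'b \<Rightarrow>\<^sub>0 int) set"
  where "bilinear_relations A B f =
    {frag_of (x \<oplus>\<^bsub>B\<^esub> x', y) - frag_of (x, y) - frag_of (x', y) | x x' y.
       x \<in> carrier B \<and> x' \<in> carrier B \<and> y \<in> carrier B} \<union>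
    {frag_of (x, y \<oplus>\<^bsub>B\<^esub> y') - frag_of (x, y) - frag_of (x, y') | x y y'.
       x \<in> carrier B \<and> y \<in> carrier B \<and> y' \<in> carrier B} \<union>
    {frag_of (f a \<otimes>\<^bsub>B\<^esub> x, y) - frag_of (x, f a \<otimes>\<^bsub>B\<^esub> y) | a x y.
       a \<in> carrier A \<and> x \<in> carrier B \<and> y \<in> carrier B}"

definition tensor_ideal ::
    "('a, 'm) ring_scheme \<Rightarrow> ('b, 'n) ring_scheme \<Rightarrow> ('a \<Rightarrow> 'b) \<Rightarrow> ('b \<times> 'b \<Rightarrow>\<^sub>0 int) set"
  where "tensor_ideal A B f = Idl\<^bsub>pair_ring B\<^esub> (bilinear_relations A B f)"

definition tensor_square ::
    "('a, 'm) ring_scheme \<Rightarrow> ('b, 'n) ring_scheme \<Rightarrow> ('a \<Rightarrow> 'b) \<Rightarrow> ('b \<times> 'b \<Rightarrow>\<^sub>0 int) set ring"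
  where "tensor_square A B f = pair_ring B Quot tensor_ideal A B f"

definition pair_mult :: "('b, 'n) ring_scheme \<Rightarrow> ('b \<times> 'b \<Rightarrow>\<^sub>0 int) \<Rightarrow> 'b"
  where "pair_mult B p = (\<Oplus>\<^bsub>B\<^esub>z \<in> Poly_Mapping.keys p.
    [Poly_Mapping.lookup p z] \<cdot>\<^bsub>B\<^esub> (fst z \<otimes>\<^bsub>B\<^esub> snd z))"

definition tensor_mult :: "('b, 'n) ring_scheme \<Rightarrow> ('b \<times> 'b \<Rightarrow>\<^sub>0 int) set \<Rightarrow> 'b"
  where "tensor_mult B U = the_elem (pair_mult B ` U)"

lemma pair_ring_carrier: "p \<in> carrier (pair_ring B) \<longleftrightarrow> Poly_Mapping.keys p \<subseteq> carrier B \<times> carrier B"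
  and pair_ring_zero: "\<zero>\<^bsub>pair_ring B\<^esub> = 0"
  and pair_ring_one: "\<one>\<^bsub>pair_ring B\<^esub> = frag_of (\<one>\<^bsub>B\<^esub>, \<one>\<^bsub>B\<^esub>)"
  and pair_ring_add: "p \<oplus>\<^bsub>pair_ring B\<^esub> q = p + q"
  by (simp_all add: pair_ring_def)

lemma pair_ring_mult_of:
  "frag_of (x, y) \<otimes>\<^bsub>pair_ring B\<^esub> frag_of (x', y') = frag_of (x \<otimes>\<^bsub>B\<^esub> x', y \<otimes>\<^bsub>B\<^esub> y')"
  by (simp add: pair_ring_def)

lemma frag_extend_fun_diff:
  "frag_extend (\<lambda>z. F z - G z) p = frag_extend F p - frag_extend G p"
  using subset_UNIV by (induction p rule: frag_induction) (auto simp: frag_extend_diff)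

lemma pair_ring_mult_0:
  "0 \<otimes>\<^bsub>pair_ring B\<^esub> q = 0" "p \<otimes>\<^bsub>pair_ring B\<^esub> 0 = 0"
  by (simp_all add: pair_ring_def frag_extend_eq_0 split_beta)

lemma pair_ring_mult_diff:
  "(p - p') \<otimes>\<^bsub>pair_ring B\<^esub> q = p \<otimes>\<^bsub>pair_ring B\<^esub> q - p' \<otimes>\<^bsub>pair_ring B\<^esub> q"
  "p \<otimes>\<^bsub>pair_ring B\<^esub> (q - q') = p \<otimes>\<^bsub>pair_ring B\<^esub> q - p \<otimes>\<^bsub>pair_ring B\<^esub> q'"
  by (simp_all add: pair_ring_def frag_extend_diff case_prod_unfold frag_extend_fun_diff)

lemma pair_ring_mult_closed:
  assumes "cring B" "p \<in> carrier (pair_ring B)" "q \<in> carrier (pair_ring B)"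
  shows "p \<otimes>\<^bsub>pair_ring B\<^esub> q \<in> carrier (pair_ring B)"
proof -
  interpret cring B by fact
  have "Poly_Mapping.keys (p \<otimes>\<^bsub>pair_ring B\<^esub> q) \<subseteq>
      (\<Union>z \<in> Poly_Mapping.keys p. \<Union>w \<in> Poly_Mapping.keys q. {(fst z \<otimes>\<^bsub>B\<^esub> fst w, snd z \<otimes>\<^bsub>B\<^esub> snd w)})"
    unfolding pair_ring_def
    by (auto simp: split_beta dest!: subsetD[OF keys_frag_extend]) force
  also have "\<dots> \<subseteq> carrier B \<times> carrier B"
    using assms(2,3) by (force simp: pair_ring_carrier)
  finally show ?thesis by (simp add: pair_ring_carrier)
qed

lemma pair_ring_cring:
  assumes "cring B"
  shows "cring (pair_ring B)"
proof -
  interpret cring B by fact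
  let ?S = "carrier B \<times> carrier B"
  note diff = pair_ring_mult_diff
  have comm: "p \<otimes>\<^bsub>pair_ring B\<^esub> q = q \<otimes>\<^bsub>pair_ring B\<^esub> p"
    if p: "Poly_Mapping.keys p \<subseteq> ?S" and q: "Poly_Mapping.keys q \<subseteq> ?S" for p q
    using p
  proof (induction p rule: frag_induction)
    case (one z)
    then obtain x y where z: "z = (x, y)" "x \<in> carrier B" "y \<in> carrier B" by auto
    show ?case using q
      by (induction q rule: frag_induction)
        (use z in \<open>auto simp: pair_ring_mult_0 pair_ring_mult_of diff m_comm\<close>)
  qed (simp_all add: pair_ring_mult_0 diff)
  have assoc: "(p \<otimes>\<^bsub>pair_ring B\<^esub> q) \<otimes>\<^bsub>pair_ring B\<^esub> r = p \<otimes>\<^bsub>pair_ring B\<^esub> (q \<otimes>\<^bsub>pair_ring B\<^esub> r)"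
    if p: "Poly_Mapping.keys p \<subseteq> ?S" and q: "Poly_Mapping.keys q \<subseteq> ?S"
      and r: "Poly_Mapping.keys r \<subseteq> ?S" for p q r
    using p
  proof (induction p rule: frag_induction)
    case p: (one z)
    show ?case using q
    proof (induction q rule: frag_induction)
      case q: (one w)
      show ?case using r
        by (induction r rule: frag_induction)
          (use p q in \<open>auto simp: pair_ring_mult_0 pair_ring_mult_of diff m_assoc\<close>)
    qed (simp_all add: pair_ring_mult_0 diff)
  qed (simp_all add: pair_ring_mult_0 diff)
  have unit: "\<one>\<^bsub>pair_ring B\<^esub> \<otimes>\<^bsub>pair_ring B\<^esub> p = p" if "Poly_Mapping.keys p \<subseteq> ?S" for p
    using that by (induction p rule: frag_induction)
      (auto simp: pair_ring_one pair_ring_mult_0 pair_ring_mult_of diff)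
  have distr: "(p + q) \<otimes>\<^bsub>pair_ring B\<^esub> r = p \<otimes>\<^bsub>pair_ring B\<^esub> r + q \<otimes>\<^bsub>pair_ring B\<^esub> r" for p q r
    by (simp add: pair_ring_def frag_extend_add)
  show ?thesis
  proof (rule cringI)
    show "abelian_group (pair_ring B)"
    proof (rule abelian_groupI)
      fix p assume "p \<in> carrier (pair_ring B)"
      then show "\<exists>q \<in> carrier (pair_ring B). q \<oplus>\<^bsub>pair_ring B\<^esub> p = \<zero>\<^bsub>pair_ring B\<^esub>"
        by (intro bexI[of _ "- p"]) (auto simp: pair_ring_carrier pair_ring_add pair_ring_zero)
    qed (auto simp: pair_ring_carrier pair_ring_add pair_ring_zero add_ac dest!: subsetD[OF keys_add])
    show "comm_monoid (pair_ring B)"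
      by (rule comm_monoidI)
        (use pair_ring_mult_closed[OF assms] assoc comm unit in
          \<open>auto simp: pair_ring_carrier pair_ring_one\<close>)
  qed (auto simp: pair_ring_carrier pair_ring_add distr)
qed

lemma tensor_ideal_ideal:
  assumes "cring A" "cring B" "f \<in> ring_hom A B"
  shows "ideal (tensor_ideal A B f) (pair_ring B)"
proof -
  interpret B: cring B by fact
  interpret cring "pair_ring B" by (rule pair_ring_cring[OF assms(2)])
  have "bilinear_relations A B f \<subseteq> carrier (pair_ring B)"
    using ring_hom_closed[OF assms(3)]
    by (auto simp: bilinear_relations_def pair_ring_carrier dest!: subsetD[OF keys_diff])
  then show ?thesis
    unfolding tensor_ideal_def by (rule genideal_ideal)
qed

lemma tensor_square_cring:
  assumes "cring A" "cring B" "f \<in> ring_hom A B"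
  shows "cring (tensor_square A B f)"
  unfolding tensor_square_def
  by (rule ideal.quotient_is_cring[OF tensor_ideal_ideal[OF assms] pair_ring_cring[OF assms(2)]])

lemma pair_mult_of:
  assumes "cring B" "x \<in> carrier B" "y \<in> carrier B"
  shows "pair_mult B (frag_of (x, y)) = x \<otimes>\<^bsub>B\<^esub> y"
proof -
  interpret cring B by fact
  show ?thesis using assms(2,3) by (simp add: pair_mult_def)
qed

lemma pair_mult_eq_finsum:
  assumes "cring B" "finite K" "Poly_Mapping.keys p \<subseteq> K" "K \<subseteq> carrier B \<times> carrier B"
  shows "pair_mult B p = (\<Oplus>\<^bsub>B\<^esub>z \<in> K. [Poly_Mapping.lookup p z] \<cdot>\<^bsub>B\<^esub> (fst z \<otimes>\<^bsub>B\<^esub> snd z))"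
proof -
  interpret cring B by fact
  have [simp]: "add_pow B (0::int) x = \<zero>\<^bsub>B\<^esub>" for x
    by (simp add: add_pow_def)
  show ?thesis
    unfolding pair_mult_def
    by (rule add.finprod_mono_neutral_cong_left)
      (use assms in \<open>auto simp: in_keys_iff subset_iff intro!: add.int_pow_closed\<close>)
qed

lemma pair_mult_add:
  assumes "cring B" "p \<in> carrier (pair_ring B)" "q \<in> carrier (pair_ring B)"
  shows "pair_mult B p \<in> carrier B" "pair_mult B (p + q) = pair_mult B p \<oplus>\<^bsub>B\<^esub> pair_mult B q"
proof -
  interpret cring B by fact
  let ?K = "Poly_Mapping.keys p \<union> Poly_Mapping.keys q"
  have K: "?K \<subseteq> carrier B \<times> carrier B" "finite ?K"
    using assms(2,3) by (auto simp: pair_ring_carrier)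
  have cl: "[k] \<cdot>\<^bsub>B\<^esub> (fst z \<otimes>\<^bsub>B\<^esub> snd z) \<in> carrier B" if "z \<in> ?K" for z and k :: int
    using K(1) that by (intro add.int_pow_closed) auto
  have eq: "pair_mult B r = (\<Oplus>\<^bsub>B\<^esub>z \<in> ?K. [Poly_Mapping.lookup r z] \<cdot>\<^bsub>B\<^esub> (fst z \<otimes>\<^bsub>B\<^esub> snd z))"
    if "Poly_Mapping.keys r \<subseteq> ?K" for r
    using pair_mult_eq_finsum[OF assms(1) K(2) that K(1)] .
  show "pair_mult B p \<in> carrier B"
    using cl by (subst eq) (auto intro!: finsum_closed)
  have "pair_mult B (p + q) = (\<Oplus>\<^bsub>B\<^esub>z \<in> ?K. [Poly_Mapping.lookup p z] \<cdot>\<^bsub>B\<^esub> (fst z \<otimes>\<^bsub>B\<^esub> snd z) \<oplus>\<^bsub>B\<^esub>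
      [Poly_Mapping.lookup q z] \<cdot>\<^bsub>B\<^esub> (fst z \<otimes>\<^bsub>B\<^esub> snd z))"
    unfolding eq[OF keys_add] lookup_add
    by (rule finsum_cong') (use K(1) cl in \<open>auto intro!: add.int_pow_mult\<close>)
  also have "\<dots> = pair_mult B p \<oplus>\<^bsub>B\<^esub> pair_mult B q"
    using cl by (subst (1 2) eq) (auto intro!: finsum_addf)
  finally show "pair_mult B (p + q) = pair_mult B p \<oplus>\<^bsub>B\<^esub> pair_mult B q" .
qed

lemma pair_mult_diff:
  assumes "cring B" "p \<in> carrier (pair_ring B)" "q \<in> carrier (pair_ring B)"
  shows "pair_mult B (p - q) = pair_mult B p \<ominus>\<^bsub>B\<^esub> pair_mult B q"
proof -
  interpret cring B by fact
  have pq: "p - q \<in> carrier (pair_ring B)"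
    using assms(2,3) keys_diff[of p q] by (auto simp: pair_ring_carrier)
  have "pair_mult B p = pair_mult B (p - q) \<oplus>\<^bsub>B\<^esub> pair_mult B q"
    using pair_mult_add(2)[OF assms(1) pq assms(3)] by simp
  then show ?thesis
    using pair_mult_add(1)[OF assms(1)] pq assms(2,3)
    by (simp add: a_minus_def a_assoc r_neg)
qed

lemma pair_mult_hom:
  assumes "cring B"
  shows "pair_mult B \<in> ring_hom (pair_ring B) B"
proof -
  interpret cring B by fact
  let ?S = "carrier B \<times> carrier B"
  interpret P: cring "pair_ring B" by (rule pair_ring_cring[OF assms])
  have cl: "pair_mult B p \<in> carrier B" if "Poly_Mapping.keys p \<subseteq> ?S" for p
    using pair_mult_add(1)[OF assms, of p p] that by (simp add: pair_ring_carrier)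
  have pm_diff: "pair_mult B (p - q) = pair_mult B p \<ominus>\<^bsub>B\<^esub> pair_mult B q"
    if "Poly_Mapping.keys p \<subseteq> ?S" "Poly_Mapping.keys q \<subseteq> ?S" for p q
    using pair_mult_diff[OF assms] that by (simp add: pair_ring_carrier)
  have mcl: "Poly_Mapping.keys (p \<otimes>\<^bsub>pair_ring B\<^esub> q) \<subseteq> ?S"
    if "Poly_Mapping.keys p \<subseteq> ?S" "Poly_Mapping.keys q \<subseteq> ?S" for p q
    using pair_ring_mult_closed[OF assms] that by (simp add: pair_ring_carrier)
  have pm0: "pair_mult B 0 = \<zero>\<^bsub>B\<^esub>" by (simp add: pair_mult_def)
  have mult: "pair_mult B (p \<otimes>\<^bsub>pair_ring B\<^esub> q) = pair_mult B p \<otimes>\<^bsub>B\<^esub> pair_mult B q"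
    if p: "Poly_Mapping.keys p \<subseteq> ?S" and q: "Poly_Mapping.keys q \<subseteq> ?S" for p q
    using p
  proof (induction p rule: free_Abelian_group_induct[consumes 1, case_names zero diff of])
    case zero
    then show ?case by (simp add: pair_ring_mult_0 pm0 cl q)
  next
    case (diff p p')
    then show ?case
      by (simp add: pair_ring_mult_diff pm_diff cl mcl q a_minus_def l_distr l_minus)
  next
    case (of z)
    show ?case using q
    proof (induction q rule: free_Abelian_group_induct[consumes 1, case_names zero diff of])
      case zero
      then show ?case using of by (simp add: pair_ring_mult_0 pm0 cl)
    next
      case (diff q q')
      then show ?case using of
        by (simp add: pair_ring_mult_diff pm_diff cl mcl a_minus_def r_distr r_minus)
    next
      case (of w)
      with \<open>z \<in> ?S\<close> show ?case
        by (auto simp: pair_ring_mult_of pair_mult_of[OF assms] m_ac)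
    qed
  qed
  show ?thesis
    by (rule ring_hom_memI)
      (use cl mult pair_mult_add(2)[OF assms] in
        \<open>simp_all add: pair_ring_carrier pair_ring_add pair_ring_one pair_mult_of[OF assms]\<close>)
qed

lemma bilinear_relations_kernel:
  assumes "cring B" "f \<in> ring_hom A B"
  shows "bilinear_relations A B f \<subseteq> a_kernel (pair_ring B) B (pair_mult B)"
proof -
  interpret B: cring B by fact
  note fcl = ring_hom_closed[OF assms(2)]
  have of_cl: "frag_of (x, y) \<in> carrier (pair_ring B)" if "x \<in> carrier B" "y \<in> carrier B" for x y
    using that by (simp add: pair_ring_carrier)
  have sub_cl: "q - r \<in> carrier (pair_ring B)"
    if "q \<in> carrier (pair_ring B)" "r \<in> carrier (pair_ring B)" for q r
    using that keys_diff[of q r] by (auto simp: pair_ring_carrier)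
  note simps = pair_mult_diff[OF assms(1)] pair_mult_of[OF assms(1)] of_cl sub_cl
  have add1: "frag_of (x \<oplus>\<^bsub>B\<^esub> x', y) - frag_of (x, y) - frag_of (x', y)
      \<in> a_kernel (pair_ring B) B (pair_mult B)"
    if "x \<in> carrier B" "x' \<in> carrier B" "y \<in> carrier B" for x x' y
  proof -
    have "(x \<oplus>\<^bsub>B\<^esub> x') \<otimes>\<^bsub>B\<^esub> y \<ominus>\<^bsub>B\<^esub> x \<otimes>\<^bsub>B\<^esub> y \<ominus>\<^bsub>B\<^esub> x' \<otimes>\<^bsub>B\<^esub> y = \<zero>\<^bsub>B\<^esub>"
      using that by algebra
    then show ?thesis using that by (simp add: a_kernel_def' simps)
  qed
  have add2: "frag_of (x, y \<oplus>\<^bsub>B\<^esub> y') - frag_of (x, y) - frag_of (x, y')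
      \<in> a_kernel (pair_ring B) B (pair_mult B)"
    if "x \<in> carrier B" "y \<in> carrier B" "y' \<in> carrier B" for x y y'
  proof -
    have "x \<otimes>\<^bsub>B\<^esub> (y \<oplus>\<^bsub>B\<^esub> y') \<ominus>\<^bsub>B\<^esub> x \<otimes>\<^bsub>B\<^esub> y \<ominus>\<^bsub>B\<^esub> x \<otimes>\<^bsub>B\<^esub> y' = \<zero>\<^bsub>B\<^esub>"
      using that by algebra
    then show ?thesis using that by (simp add: a_kernel_def' simps)
  qed
  have bal: "frag_of (c \<otimes>\<^bsub>B\<^esub> x, y) - frag_of (x, c \<otimes>\<^bsub>B\<^esub> y)
      \<in> a_kernel (pair_ring B) B (pair_mult B)"
    if "c \<in> carrier B" "x \<in> carrier B" "y \<in> carrier B" for c x y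
  proof -
    have "c \<otimes>\<^bsub>B\<^esub> x \<otimes>\<^bsub>B\<^esub> y \<ominus>\<^bsub>B\<^esub> x \<otimes>\<^bsub>B\<^esub> (c \<otimes>\<^bsub>B\<^esub> y) = \<zero>\<^bsub>B\<^esub>"
      using that by algebra
    then show ?thesis using that by (simp add: a_kernel_def' simps)
  qed
  show "bilinear_relations A B f \<subseteq> a_kernel (pair_ring B) B (pair_mult B)"
    unfolding bilinear_relations_def
    by (intro Un_least subsetI; elim CollectE exE conjE; simp add: add1 add2 bal fcl)
qed

lemma tensor_mult_coset:
  assumes "cring A" "cring B" "f \<in> ring_hom A B" "p \<in> carrier (pair_ring B)"
  shows "tensor_mult B (tensor_ideal A B f +>\<^bsub>pair_ring B\<^esub> p) = pair_mult B p"
proof -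
  interpret B: cring B by fact
  interpret P: cring "pair_ring B" by (rule pair_ring_cring[OF assms(2)])
  note rel = bilinear_relations_kernel[OF assms(2,3)]
  have sub: "tensor_ideal A B f \<subseteq> a_kernel (pair_ring B) B (pair_mult B)"
    unfolding tensor_ideal_def
    by (intro P.genideal_minimal ring_hom_ring.kernel_is_ideal ring_hom_ringI2)
      (use rel in \<open>auto intro: P.ring_axioms B.ring_axioms pair_mult_hom[OF assms(2)]\<close>)
  interpret J: ideal "tensor_ideal A B f" "pair_ring B"
    by (rule tensor_ideal_ideal[OF assms(1-3)])
  have "pair_mult B q = pair_mult B p" if q: "q \<in> tensor_ideal A B f +>\<^bsub>pair_ring B\<^esub> p" for q
  proof -
    obtain j where "j \<in> tensor_ideal A B f" "q = j \<oplus>\<^bsub>pair_ring B\<^esub> p"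
      using q unfolding a_r_coset_def' by blast
    moreover from this have "j \<in> carrier (pair_ring B)" "pair_mult B j = \<zero>\<^bsub>B\<^esub>"
      using sub by (auto simp: a_kernel_def')
    ultimately show ?thesis
      using assms(4) ring_hom_add[OF pair_mult_hom[OF assms(2)]]
        ring_hom_closed[OF pair_mult_hom[OF assms(2)]] by simp
  qed
  moreover have "p \<in> tensor_ideal A B f +>\<^bsub>pair_ring B\<^esub> p"
    using J.a_rcos_self[OF assms(4)] .
  ultimately have "pair_mult B ` (tensor_ideal A B f +>\<^bsub>pair_ring B\<^esub> p) = {pair_mult B p}"
    by blast
  then show ?thesis
    by (simp add: tensor_mult_def)
qed

definition diagonal_ideal ::
    "('a, 'm) ring_scheme \<Rightarrow> ('b, 'n) ring_scheme \<Rightarrow> ('a \<Rightarrow> 'b) \<Rightarrow> ('b \<times> 'b \<Rightarrow>\<^sub>0 int) set set"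
  where "diagonal_ideal A B f = a_kernel (tensor_square A B f) B (tensor_mult B)"

definition differentials ::
    "('a, 'm) ring_scheme \<Rightarrow> ('b, 'n) ring_scheme \<Rightarrow> ('a \<Rightarrow> 'b) \<Rightarrow> ('b \<times> 'b \<Rightarrow>\<^sub>0 int) set set monoid"
  where "differentials A B f =
    (add_monoid (tensor_square A B f)) \<lparr>carrier := diagonal_ideal A B f\<rparr> Mod
      (diagonal_ideal A B f \<cdot>\<^bsub>tensor_square A B f\<^esub> diagonal_ideal A B f)"

definition finite_type ::
    "('a, 'm) ring_scheme \<Rightarrow> ('b, 'n) ring_scheme \<Rightarrow> ('a \<Rightarrow> 'b) \<Rightarrow> bool"
  where "finite_type A B f \<longleftrightarrow>
    (\<exists>U \<subseteq> carrier B. finite U \<and> carrier B = generate_ring B (f ` carrier A \<union> U))"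

definition unramified ::
    "('a, 'm) ring_scheme \<Rightarrow> ('b, 'n) ring_scheme \<Rightarrow> ('a \<Rightarrow> 'b) \<Rightarrow> bool"
  where "unramified A B f \<longleftrightarrow> f \<in> ring_hom A B \<and> finite_type A B f \<and>
    carrier (differentials A B f) = {\<one>\<^bsub>differentials A B f\<^esub>}"

end

theory Submission
  imports Defs
begin

text \<open>Under FCP a directed union of subalgebras is attained, so u-integral means cu-elementary.

  If \<open>x\<close> and \<open>y\<close> are the images of \<open>b\<close> under two morphisms which agree on \<open>b\<^sup>2 - b\<close> and
  \<open>b\<^sup>3 - b\<^sup>2\<close>, then \<open>d = x - y\<close> satisfies \<open>d (x + y) = d\<close> and \<open>d x y = 0\<close>. In a local ring \<open>b\<close>
  or \<open>1 - b\<close> is a unit, which forces \<open>d = 0\<close>: cu-elementary extensions are locally epimorphisms.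
  Moreover \<open>d = d\<^sup>3\<close>, so that \<open>b \<otimes> 1 - 1 \<otimes> b\<close> lies in \<open>I\<^sup>2\<close>: they are unramified.

  Conversely, let \<open>T\<close> be a maximal cu-elementary subextension and suppose \<open>T \<noteq> S\<close>. The chains
  \<open>T + x\<^sup>n S\<close> stabilise and \<open>S\<close> is a finite \<open>T\<close>-module, so by Nakayama every element of \<open>S\<close> is
  strongly pi-regular modulo the conductor \<open>C\<close> of \<open>T\<close> in \<open>S\<close>. Let \<open>Q\<close> be a maximal ideal of \<open>S\<close>
  containing \<open>C\<close> and \<open>M = Q \<inter> T\<close>. Again by Nakayama \<open>T + MS \<noteq> S\<close>. If \<open>S/MS\<close> were local, then the
  field \<open>T/M\<close> would have a proper epimorphic extension \<open>S/MS\<close>, which is impossible. Hence some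
  \<open>s \<notin> Q\<close> lies in another prime \<open>Q'\<close> over \<open>M\<close>. The idempotent \<open>b\<close> modulo \<open>C\<close> generated by \<open>s\<close>
  lies in \<open>Q'\<close> but not in \<open>Q\<close>, hence not in \<open>T\<close>, and \<open>T \<subset> T[b]\<close> is u-elementary.\<close>

section \<open>Finite modules over a subring and chains of intermediate rings\<close>

text \<open>The new element has to come from S modulo \<open>conductor T\<close>: this is an ideal
  of S inside T, so an idempotent b modulo it satisfies b^2 - b in T and b^3 - b^2 = b (b^2 - b) in
  T at once. No Artinian property of the quotient is established. Strong pi-regularity is what
  stability and Nakayama give directly, and it serves twice: it makes T/M a field, and it turns any
  s into a multiple of s that is idempotent modulo the conductor.

  That a proper extension of the field T/M is not epimorphic is linear algebra. If x is outside T +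
  MS, then x \<otimes> 1 and 1 \<otimes> x differ in (S/MS) \<otimes> (S/MS), and a functional with
  value 0 at 1 and value 1 at x, applied to the first factor, detects this. If everything outside Q
  were invertible modulo MS, both maps from S would extend to S_Q. They agree on T, hence on the
  image of the localization of R, against the hypothesis. So R can be used directly, without a
  localization of T.\<close>

lemma FCP_ex_maximal:
  assumes "FCP S R" "\<A> \<subseteq> subalgebras S R" "\<A> \<noteq> {}"
  shows "\<exists>M \<in> \<A>. \<forall>V \<in> \<A>. M \<subseteq> V \<longrightarrow> V = M"
proof -
  \<comment> \<open>By FCP a chain is finite, so its union is one of its members.\<close>
  have "\<Union>\<C> \<in> \<A>" if \<C>: "\<C> \<noteq> {}" "subset.chain \<A> \<C>" for \<C>
  proof -
    have "subset.chain (subalgebras S R) \<C>"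
      using \<C>(2) assms(2) by (auto simp: subset.chain_def)
    then have "finite \<C>"
      using assms(1) by (simp add: FCP_def)
    then have "\<Union>\<C> \<in> \<C>"
      using \<C> by (intro Union_in_chain)
    then show ?thesis
      using \<C>(2) by (auto simp: subset.chain_def)
  qed
  then show ?thesis
    using subset_Zorn_nonempty[OF assms(3)] by blast
qed

text \<open>For a subring \<open>T\<close> this is the largest ideal of the whole ring inside
  \<open>T\<close>. Congruences modulo it survive multiplication by any ring element and still give
  membership in \<open>T\<close>.\<close>

definition (in ring) conductor :: "'a set \<Rightarrow> 'a set"
  where "conductor T = {c \<in> carrier R. \<forall>s \<in> carrier R. c \<otimes> s \<in> T}"

context cring
begin

declare Span.simps [simp del]

section \<open>Spans with coefficients in an additive subgroup\<close>

lemma Span_Nil [simp]: "Span K [] = {\<zero>}"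
  by (simp add: Span.simps)

lemma Span_Cons_iff: "u \<in> Span K (g # gs) \<longleftrightarrow> (\<exists>k \<in> K. \<exists>v \<in> Span K gs. u = k \<otimes> g \<oplus> v)"
  by (simp add: Span.simps line_extension_mem_iff)

text \<open>Stands in for linearity: \<open>E\<close> is typically the set of all u whose multiple
  by a fixed element lies in a given additive subgroup, so that a claim about a module is checked on
  generators.\<close>

lemma Span_least:
  assumes "\<zero> \<in> E" "\<And>u v. u \<in> E \<Longrightarrow> v \<in> E \<Longrightarrow> u \<oplus> v \<in> E"
    and "\<And>k g. k \<in> K \<Longrightarrow> g \<in> set gs \<Longrightarrow> k \<otimes> g \<in> E"
  shows "Span K gs \<subseteq> E"
  using assms(3)
proof (induction gs)
  case Nil
  then show ?case using assms(1) by simp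
next
  case (Cons g gs)
  then have "Span K gs \<subseteq> E" "\<And>k. k \<in> K \<Longrightarrow> k \<otimes> g \<in> E" by auto
  then show ?case using assms(2) by (force simp: Span_Cons_iff)
qed

context
  fixes K assumes K: "subgroup K (add_monoid R)"
begin

lemma add_subgroup_props:
  "K \<subseteq> carrier R" "\<zero> \<in> K" "\<And>u v. u \<in> K \<Longrightarrow> v \<in> K \<Longrightarrow> u \<oplus> v \<in> K"
  using subgroup.subset[OF K] subgroup.one_closed[OF K] subgroup.m_closed[OF K] by auto

lemma Span_subset_carrier: "set gs \<subseteq> carrier R \<Longrightarrow> Span K gs \<subseteq> carrier R"
  by (rule Span_least) (use add_subgroup_props in auto)

lemma zero_in_Span: "set gs \<subseteq> carrier R \<Longrightarrow> \<zero> \<in> Span K gs"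
proof (induction gs)
  case (Cons g gs)
  then show ?case
    using add_subgroup_props(2) by (auto simp: Span_Cons_iff intro!: bexI[of _ \<zero>])
qed simp

lemma Span_add_closed:
  assumes "set gs \<subseteq> carrier R" "u \<in> Span K gs" "v \<in> Span K gs"
  shows "u \<oplus> v \<in> Span K gs"
  using assms
proof (induction gs arbitrary: u v)
  case (Cons g gs)
  obtain k w l z where u: "u = k \<otimes> g \<oplus> w" "k \<in> K" "w \<in> Span K gs"
    and v: "v = l \<otimes> g \<oplus> z" "l \<in> K" "z \<in> Span K gs"
    using Cons.prems by (auto simp: Span_Cons_iff)
  have cl: "k \<in> carrier R" "l \<in> carrier R" "w \<in> carrier R" "z \<in> carrier R" "g \<in> carrier R"
    using u v Span_subset_carrier[of gs] Cons.prems(1) add_subgroup_props(1) by auto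
  have "u \<oplus> v = (k \<oplus> l) \<otimes> g \<oplus> (w \<oplus> z)"
    unfolding u v using cl by algebra
  moreover have "k \<oplus> l \<in> K" "w \<oplus> z \<in> Span K gs"
    using u v Cons add_subgroup_props(3) by auto
  ultimately show ?case
    unfolding Span_Cons_iff by blast
qed simp

lemma Span_mult_mem:
  assumes "set gs \<subseteq> carrier R" "k \<in> K" "g \<in> set gs"
  shows "k \<otimes> g \<in> Span K gs"
  using assms
proof (induction gs)
  case (Cons h gs)
  have cl: "k \<in> carrier R" "g \<in> carrier R" "h \<in> carrier R"
    using Cons.prems add_subgroup_props(1) by auto
  show ?case
  proof (cases "g = h")
    case True
    then show ?thesis
      using cl Cons.prems zero_in_Span[of gs] unfolding Span_Cons_iff
      by (intro bexI[of _ k] bexI[of _ \<zero>]) auto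
  next
    case False
    then have "k \<otimes> g \<in> Span K gs" using Cons by auto
    then show ?thesis
      using cl add_subgroup_props(2) unfolding Span_Cons_iff
      by (intro bexI[of _ \<zero>] bexI[of _ "k \<otimes> g"]) auto
  qed
qed simp

text \<open>Coefficients range over additive subgroups because ideals of a subring \<open>T\<close>
  occur besides \<open>T\<close> itself. With \<open>L\<close> = \<open>T\<close> and
  \<open>K\<close> an ideal of \<open>T\<close>, an element of the ideal carries the module over
  \<open>T\<close> into the module over the ideal.\<close>

lemma Span_smult:
  assumes "set gs \<subseteq> carrier R" "t \<in> carrier R" "L \<subseteq> carrier R" "\<And>l. l \<in> L \<Longrightarrow> t \<otimes> l \<in> K"
    and "u \<in> Span L gs"
  shows "t \<otimes> u \<in> Span K gs"
proof -
  have "Span L gs \<subseteq> {u \<in> carrier R. t \<otimes> u \<in> Span K gs}"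
  proof (rule Span_least)
    fix l g assume lg: "l \<in> L" "g \<in> set gs"
    then have "l \<in> carrier R" "g \<in> carrier R" using assms by auto
    then show "l \<otimes> g \<in> {u \<in> carrier R. t \<otimes> u \<in> Span K gs}"
      using Span_mult_mem[OF assms(1) assms(4)[OF lg(1)] lg(2)] assms(2) by (simp add: m_assoc)
  qed (use assms zero_in_Span Span_add_closed in \<open>auto simp: r_distr\<close>)
  then show ?thesis using assms(5) by auto
qed

end

lemma subring_add_subgroup: "subring T R \<Longrightarrow> subgroup T (add_monoid R)"
  by (rule subring.axioms(1))

lemma subring_minus_closed:
  assumes "subring T R" "a \<in> T" "b \<in> T"
  shows "a \<ominus> b \<in> T"
  using subringE[OF assms(1)] assms(2,3) by (simp add: a_minus_def)

lemma add_subgroup_closed: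
  assumes "subgroup J (add_monoid R)" "a \<in> J" "b \<in> J"
  shows "a \<oplus> b \<in> J" "a \<ominus> b \<in> J" "\<ominus> a \<in> J"
  using subgroup.m_closed[OF assms] subgroup.m_inv_closed[OF assms(1)] assms(2,3)
    subgroup.m_closed[OF assms(1,2)]
  by (auto simp: a_minus_def a_inv_def)

text \<open>Nakayama's lemma for the module \<open>(Span T gs + T) / T\<close>, by eliminating one generator at a
  time.  The factor \<open>c\<close> makes the induction go through.\<close>

lemma nakayama_modulo_subring:
  assumes T: "subring T R" and J: "subgroup J (add_monoid R)" "J \<subseteq> T"
    and JT: "\<And>t j. t \<in> T \<Longrightarrow> j \<in> J \<Longrightarrow> t \<otimes> j \<in> J"
    and "set gs \<subseteq> carrier R" "c \<in> T" "c \<ominus> \<one> \<in> J"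
    and "\<And>g. g \<in> set gs \<Longrightarrow> \<exists>a \<in> T. \<exists>e \<in> Span J gs. c \<otimes> g = a \<oplus> e"
  shows "\<exists>d \<in> T. d \<ominus> \<one> \<in> J \<and> (\<forall>g \<in> set gs. d \<otimes> g \<in> T)"
  using assms(5-)
proof (induction gs arbitrary: c)
  case Nil
  then show ?case by auto
next
  case (Cons g hs)
  note TD = subringE[OF T]
  have hs: "set hs \<subseteq> carrier R" and g: "g \<in> carrier R" using Cons.prems by auto
  have JC: "J \<subseteq> carrier R" using J TD by auto
  have SC: "Span J hs \<subseteq> carrier R" using Span_subset_carrier[OF J(1) hs] .
  obtain a j e where a: "a \<in> T" "j \<in> J" "e \<in> Span J hs" "c \<otimes> g = a \<oplus> (j \<otimes> g \<oplus> e)"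
    using Cons.prems(4)[of g] by (auto simp: Span_Cons_iff)
  have cl: "a \<in> carrier R" "j \<in> carrier R" "e \<in> carrier R" "c \<in> carrier R"
    using a Cons.prems(2) JC SC TD(1) by auto
  \<comment> \<open>The multiple of \<open>g\<close> on the right of its own equation goes to the
    left. This leaves \<open>c' \<otimes> g\<close> free of \<open>g\<close> and keeps the
    coefficient congruent to 1 modulo \<open>J\<close>.\<close>
  define c' where "c' = c \<ominus> j"
  have c'T: "c' \<in> T"
    unfolding c'_def using a(2) J(2) Cons.prems(2) by (intro subring_minus_closed[OF T]) auto
  have c'C: "c' \<in> carrier R" using c'T TD by auto
  have "c' \<ominus> \<one> = (c \<ominus> \<one>) \<ominus> j" unfolding c'_def using cl by algebra
  then have c'J: "c' \<ominus> \<one> \<in> J" using add_subgroup_closed(2)[OF J(1)] Cons.prems(3) a(2) by simp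
  have c'g: "c' \<otimes> g = a \<oplus> e"
  proof -
    have "c' \<otimes> g = c \<otimes> g \<ominus> j \<otimes> g" unfolding c'_def using cl g by algebra
    also have "\<dots> = a \<oplus> e" unfolding a(4) using cl g by algebra
    finally show ?thesis .
  qed
  \<comment> \<open>The equation of each remaining h is multiplied by \<open>c'\<close>, so that its
    summand \<open>j2 \<otimes> g\<close> becomes a multiple of \<open>c' \<otimes> g\<close> and
    \<open>g\<close> disappears. Hence the new common factor is
    \<open>c \<otimes> c'\<close>.\<close>
  have "\<exists>d \<in> T. d \<ominus> \<one> \<in> J \<and> (\<forall>h \<in> set hs. d \<otimes> h \<in> T)"
  proof (rule Cons.IH[OF hs])
    show "c \<otimes> c' \<in> T" using c'T Cons.prems(2) TD by auto
    have "c \<otimes> c' \<ominus> \<one> = c \<otimes> (c' \<ominus> \<one>) \<oplus> (c \<ominus> \<one>)" using cl c'C by algebra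
    then show "c \<otimes> c' \<ominus> \<one> \<in> J"
      using JT[OF Cons.prems(2) c'J] Cons.prems(3) add_subgroup_closed(1)[OF J(1)] by simp
    fix h assume h: "h \<in> set hs"
    then obtain a2 j2 e2 where a2: "a2 \<in> T" "j2 \<in> J" "e2 \<in> Span J hs"
      "c \<otimes> h = a2 \<oplus> (j2 \<otimes> g \<oplus> e2)"
      using Cons.prems(4)[of h] by (auto simp: Span_Cons_iff)
    have cl2: "a2 \<in> carrier R" "j2 \<in> carrier R" "e2 \<in> carrier R" "h \<in> carrier R"
      using a2 h hs JC SC TD(1) by auto
    have "(c \<otimes> c') \<otimes> h = c' \<otimes> (c \<otimes> h)" using cl cl2 c'C by algebra
    also have "\<dots> = c' \<otimes> a2 \<oplus> j2 \<otimes> (c' \<otimes> g) \<oplus> c' \<otimes> e2"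
      unfolding a2(4) using cl2 c'C g by algebra
    also have "\<dots> = (c' \<otimes> a2 \<oplus> j2 \<otimes> a) \<oplus> (j2 \<otimes> e \<oplus> c' \<otimes> e2)"
      unfolding c'g using cl2 c'C cl by algebra
    finally have eq: "(c \<otimes> c') \<otimes> h = (c' \<otimes> a2 \<oplus> j2 \<otimes> a) \<oplus> (j2 \<otimes> e \<oplus> c' \<otimes> e2)" .
    have "c' \<otimes> a2 \<oplus> j2 \<otimes> a \<in> T" using a a2 c'T J(2) TD by auto
    moreover have "j2 \<otimes> e \<oplus> c' \<otimes> e2 \<in> Span J hs"
      by (intro Span_add_closed[OF J(1) hs] Span_smult[OF J(1) hs _ JC] JT)
        (use a a2 c'T c'C cl2 J(2) in auto)
    ultimately show "\<exists>a \<in> T. \<exists>e \<in> Span J hs. (c \<otimes> c') \<otimes> h = a \<oplus> e"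
      using eq by blast
  qed
  then obtain d where d: "d \<in> T" "d \<ominus> \<one> \<in> J" "\<And>h. h \<in> set hs \<Longrightarrow> d \<otimes> h \<in> T" by blast
  have dC: "d \<in> carrier R" using d TD by auto
  \<comment> \<open>Back to \<open>g\<close>: since \<open>d\<close> moves the remaining generators
    into \<open>T\<close>, it moves \<open>e\<close> there as well, and d c' g = d a + d e.\<close>
  have "Span J hs \<subseteq> {u \<in> carrier R. d \<otimes> u \<in> T}"
  proof (rule Span_least)
    fix k h assume kh: "k \<in> J" "h \<in> set hs"
    then have "k \<in> carrier R" "h \<in> carrier R" using JC hs by auto
    moreover from this have "d \<otimes> (k \<otimes> h) = k \<otimes> (d \<otimes> h)" using dC by algebra
    ultimately show "k \<otimes> h \<in> {u \<in> carrier R. d \<otimes> u \<in> T}"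
      using d(3)[OF kh(2)] kh(1) J(2) TD(6) by auto
  qed (use TD dC in \<open>auto simp: r_distr\<close>)
  then have de: "d \<otimes> e \<in> T" using a(3) by auto
  have "d \<otimes> c' \<otimes> g = d \<otimes> a \<oplus> d \<otimes> e"
    using c'g dC c'C g cl by (simp add: m_assoc r_distr)
  then have dg: "d \<otimes> c' \<otimes> g \<in> T" using de d(1) a(1) TD by auto
  have dh: "d \<otimes> c' \<otimes> h \<in> T" if "h \<in> set hs" for h
  proof -
    have "h \<in> carrier R" using that hs by auto
    then have "d \<otimes> c' \<otimes> h = c' \<otimes> (d \<otimes> h)" using dC c'C by algebra
    then show ?thesis using d(3)[OF that] c'T TD by auto
  qed
  have "d \<otimes> c' \<ominus> \<one> = d \<otimes> (c' \<ominus> \<one>) \<oplus> (d \<ominus> \<one>)" using dC c'C by algebra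
  then have "d \<otimes> c' \<ominus> \<one> \<in> J"
    using JT[OF d(1) c'J] d(2) add_subgroup_closed(1)[OF J(1)] by simp
  then show ?case using dg dh d(1) c'T TD by (intro bexI[of _ "d \<otimes> c'"]) auto
qed

section \<open>Finite generation over an intermediate ring\<close>

lemma simple_extension_subring:
  assumes K: "subring K R" and x: "x \<in> carrier R"
  shows "subring (simple_extension K x) R"
proof (rule subringI)
  note KD = subringE[OF K]
  have C: "simple_extension K x \<subseteq> carrier R"
    using simple_extension_in_carrier[OF KD(1) x] .
  show "simple_extension K x \<subseteq> carrier R" by (rule C)
  show "\<one> \<in> simple_extension K x" using simple_extension_incl[OF KD(1) x] KD(3) by auto
  have add: "u \<oplus> v \<in> simple_extension K x"
    if "u \<in> simple_extension K x" "v \<in> simple_extension K x" for u v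
    using that
  proof (induction arbitrary: v rule: simple_extension.induct)
    case zero
    then show ?case using C by auto
  next
    case (lin k1 k2)
    from lin.prems show ?case
    proof cases
      case zero
      then show ?thesis using lin C KD(1) x simple_extension.lin[OF lin(1,2)] by (auto simp: subset_iff)
    next
      case (lin l1 l2)
      have cl: "k1 \<in> carrier R" "k2 \<in> carrier R" "l1 \<in> carrier R" "l2 \<in> carrier R"
        using lin \<open>k1 \<in> _\<close> \<open>k2 \<in> _\<close> C KD(1) by auto
      have "k1 \<otimes> x \<oplus> k2 \<oplus> v = (k1 \<oplus> l1) \<otimes> x \<oplus> (k2 \<oplus> l2)"
        unfolding lin(1) using cl x by algebra
      then show ?thesis
        using simple_extension.lin[OF \<open>\<And>v. v \<in> _ \<Longrightarrow> k1 \<oplus> v \<in> _\<close>[OF lin(2)] KD(7)[OF \<open>k2 \<in> K\<close> lin(3)]]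
        by simp
    qed
  qed
  then show "\<And>u v. u \<in> simple_extension K x \<Longrightarrow> v \<in> simple_extension K x \<Longrightarrow>
    u \<oplus> v \<in> simple_extension K x" .
  have smult: "k \<otimes> u \<in> simple_extension K x" if k: "k \<in> K" and "u \<in> simple_extension K x" for k u
    using that(2)
  proof (induction rule: simple_extension.induct)
    case zero
    then show ?case using k KD(1) by auto
  next
    case (lin k1 k2)
    have cl: "k \<in> carrier R" "k1 \<in> carrier R" "k2 \<in> carrier R" using lin k C KD(1) by auto
    have "k \<otimes> (k1 \<otimes> x \<oplus> k2) = (k \<otimes> k1) \<otimes> x \<oplus> k \<otimes> k2" using cl x by algebra
    then show ?case using simple_extension.lin[OF lin(3) KD(6)[OF k lin(2)]] by simp
  qed
  show "u \<otimes> v \<in> simple_extension K x"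
    if "u \<in> simple_extension K x" and v: "v \<in> simple_extension K x" for u v
    using that(1)
  proof (induction rule: simple_extension.induct)
    case zero
    then show ?case using v C by auto
  next
    case (lin k1 k2)
    have cl: "v \<in> carrier R" "k1 \<in> carrier R" "k2 \<in> carrier R" using lin v C KD(1) by auto
    have "(k1 \<otimes> x \<oplus> k2) \<otimes> v = ((k1 \<otimes> v) \<otimes> x \<oplus> \<zero>) \<oplus> k2 \<otimes> v" using cl x by algebra
    then show ?case
      using add[OF simple_extension.lin[OF lin(3) KD(2)] smult[OF lin(2) v]] by simp
  qed
  show "\<ominus> u \<in> simple_extension K x" if u: "u \<in> simple_extension K x" for u
  proof -
    have "\<ominus> u = (\<ominus> \<one>) \<otimes> u" using u C by (auto simp: l_minus)
    then show ?thesis using smult[OF KD(5)[OF KD(3)] u] by simp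
  qed
qed

lemma eval_in_Span_powers:
  assumes "subring K R" "set p \<subseteq> K" "x \<in> carrier R" "length p \<le> n"
  shows "eval p x \<in> Span K (map (\<lambda>i. x [^] i) [0..<n])"
  using assms(2,4)
proof (induction p)
  case Nil
  then show ?case using assms(3) by (auto intro!: zero_in_Span[OF subring_add_subgroup[OF assms(1)]])
next
  case (Cons a p)
  then show ?case
    using assms(3)
    by (auto intro!: Span_add_closed[OF subring_add_subgroup[OF assms(1)]]
        Span_mult_mem[OF subring_add_subgroup[OF assms(1)]])
qed

text \<open>The monic equation expresses x^d, with d = \<open>length p\<close>, by lower powers, so
  the span of these is stable under multiplication by x. The assumption \<open>p \<noteq> []\<close>
  puts x^0 = 1 among the generators.\<close>

lemma simple_extension_subset_Span:
  assumes K: "subring K R" and x: "x \<in> carrier R" and p: "set p \<subseteq> K" "eval (\<one> # p) x = \<zero>"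
    and "p \<noteq> []"
  shows "simple_extension K x \<subseteq> Span K (map (\<lambda>i. x [^] i) [0..<length p])"
proof
  note KG = subring_add_subgroup[OF K] and KD = subringE[OF K]
  let ?W = "Span K (map (\<lambda>i. x [^] i) [0..<length p])"
  have pows: "set (map (\<lambda>i. x [^] i) [0..<length p]) \<subseteq> carrier R" using x by auto
  have WC: "?W \<subseteq> carrier R" by (rule Span_subset_carrier[OF KG pows])
  have pC: "eval p x \<in> carrier R"
    using eval_in_Span_powers[OF K p(1) x order_refl] WC by auto
  have "x [^] length p = \<ominus> eval p x"
    using p(2) x pC by (simp add: sum_zero_eq_neg)
  then have xd: "x [^] length p = (\<ominus> \<one>) \<otimes> eval p x" using pC by (simp add: l_minus)
  have mult: "?W \<subseteq> {u \<in> carrier R. u \<otimes> x \<in> ?W}"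
  proof (rule Span_least)
    fix k g assume k: "k \<in> K" and "g \<in> set (map (\<lambda>i. x [^] i) [0..<length p])"
    then obtain i where i: "g = x [^] i" "i < length p" by auto
    have kC: "k \<in> carrier R" using k KD by auto
    have eq: "k \<otimes> g \<otimes> x = k \<otimes> x [^] Suc i" using i kC x by (simp add: m_assoc)
    have "k \<otimes> x [^] Suc i \<in> ?W"
    proof (cases "Suc i < length p")
      case True
      then have "x [^] Suc i \<in> set (map (\<lambda>i. x [^] i) [0..<length p])"
        unfolding set_map by (intro imageI) simp
      then show ?thesis using k by (intro Span_mult_mem[OF KG pows])
    next
      case False
      then have "Suc i = length p" using i by simp
      then have "k \<otimes> x [^] Suc i = (k \<otimes> (\<ominus> \<one>)) \<otimes> eval p x"
        using xd kC pC by (simp add: m_assoc del: nat_pow_Suc)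
      moreover have "\<dots> \<in> ?W"
        using eval_in_Span_powers[OF K p(1) x order_refl] k KD kC
        by (intro Span_smult[OF KG pows, where L = K]) auto
      ultimately show ?thesis by simp
    qed
    then show "k \<otimes> g \<in> {u \<in> carrier R. u \<otimes> x \<in> ?W}"
      using eq kC i x by simp
  qed (use zero_in_Span[OF KG pows] Span_add_closed[OF KG pows] x in \<open>auto simp: l_distr\<close>)
  have base: "k \<in> ?W" if "k \<in> K" for k
  proof -
    have "x [^] (0::nat) \<in> set (map (\<lambda>i. x [^] i) [0..<length p])"
      unfolding set_map using assms(5) by (intro imageI) simp
    then have "k \<otimes> x [^] (0::nat) \<in> ?W" using that by (intro Span_mult_mem[OF KG pows])
    then show ?thesis using that KD by auto
  qed
  fix u assume "u \<in> simple_extension K x"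
  then show "u \<in> ?W"
  proof (induction rule: simple_extension.induct)
    case zero
    show ?case by (rule zero_in_Span[OF KG pows])
  next
    case (lin k1 k2)
    then show ?case using Span_add_closed[OF KG pows _ base[OF lin(2)], of "k1 \<otimes> x"] mult by auto
  qed
qed

text \<open>Products of generators generate: the module form of transitivity of finite
  extensions.\<close>

lemma Span_trans:
  assumes T: "subgroup T (add_monoid R)" and gs: "set gs \<subseteq> carrier R" "set hs \<subseteq> carrier R"
    and K: "K \<subseteq> Span T gs"
  shows "Span K hs \<subseteq> Span T [g \<otimes> h. g \<leftarrow> gs, h \<leftarrow> hs]"
proof (rule Span_least)
  let ?L = "[g \<otimes> h. g \<leftarrow> gs, h \<leftarrow> hs]"
  have L: "set ?L \<subseteq> carrier R" using gs by auto
  show "\<zero> \<in> Span T ?L" by (rule zero_in_Span[OF T L])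
  show "\<And>u v. u \<in> Span T ?L \<Longrightarrow> v \<in> Span T ?L \<Longrightarrow> u \<oplus> v \<in> Span T ?L"
    by (rule Span_add_closed[OF T L])
  fix k h assume kh: "k \<in> K" "h \<in> set hs"
  have h: "h \<in> carrier R" using kh gs by auto
  have "Span T gs \<subseteq> {u \<in> carrier R. u \<otimes> h \<in> Span T ?L}"
  proof (rule Span_least)
    fix t g assume tg: "t \<in> T" "g \<in> set gs"
    then have cl: "t \<in> carrier R" "g \<in> carrier R" using add_subgroup_props(1)[OF T] gs by auto
    have "t \<otimes> (g \<otimes> h) \<in> Span T ?L"
      using tg kh by (intro Span_mult_mem[OF T L]) auto
    then show "t \<otimes> g \<in> {u \<in> carrier R. u \<otimes> h \<in> Span T ?L}" using cl h by (simp add: m_assoc)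
  qed (use zero_in_Span[OF T L] Span_add_closed[OF T L] h in \<open>auto simp: l_distr\<close>)
  then show "k \<otimes> h \<in> Span T ?L" using K kh by auto
qed

text \<open>Adjoining an integral element keeps a ring inside some finitely generated
  \<open>T\<close>-module. So an intermediate ring that is maximal with this property, which FCP
  provides, is everything.\<close>

lemma integral_FCP_module_finite:
  assumes A: "subring A R" and int: "integral_extension R A" and fcp: "FCP R A"
    and T: "T \<in> subalgebras R A"
  shows "\<exists>gs. set gs \<subseteq> carrier R \<and> carrier R = Span T gs"
\<comment> \<open>In the zero ring an integral equation can have degree 0, which
  \<open>simple_extension_subset_Span\<close> excludes.\<close>
proof (cases "\<one> = \<zero>")
  case True
  then have "carrier R = {\<zero>}" by (rule one_zeroD)
  then show ?thesis by (intro exI[of _ "[]"]) auto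
next
  case False
  have Ts: "subring T R" "A \<subseteq> T" using T by (auto simp: subalgebras_def)
  note TG = subring_add_subgroup[OF Ts(1)] and TD = subringE[OF Ts(1)]
  \<comment> \<open>Containment in a span is enough; it becomes an equality once V is the whole
    ring.\<close>
  let ?A = "{V \<in> subalgebras R A. T \<subseteq> V \<and> (\<exists>gs. set gs \<subseteq> carrier R \<and> V \<subseteq> Span T gs)}"
  have "T \<subseteq> Span T [\<one>]"
    using TD(1) by (force simp: Span_Cons_iff)
  then have "T \<in> ?A" using T by (auto intro!: exI[of _ "[\<one>]"])
  then have "?A \<subseteq> subalgebras R A" "?A \<noteq> {}" by blast+
  from FCP_ex_maximal[OF fcp this]
  obtain V where V: "V \<in> ?A" and max: "\<forall>W \<in> ?A. V \<subseteq> W \<longrightarrow> W = V" ..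
  from V obtain gs where gs: "set gs \<subseteq> carrier R" "V \<subseteq> Span T gs" and Vs: "subring V R" "A \<subseteq> V" "T \<subseteq> V"
    by (auto simp: subalgebras_def)
  have "x \<in> V" if x: "x \<in> carrier R" for x
  proof -
    obtain p where p: "set p \<subseteq> A" "eval (\<one> # p) x = \<zero>"
      using int x by (auto simp: integral_extension_def)
    have "p \<noteq> []" using p(2) False by auto
    then have "simple_extension V x \<subseteq> Span V (map (\<lambda>i. x [^] i) [0..<length p])"
      using p Vs(2) by (intro simple_extension_subset_Span[OF Vs(1) x]) auto
    also have "\<dots> \<subseteq> Span T [g \<otimes> h. g \<leftarrow> gs, h \<leftarrow> map (\<lambda>i. x [^] i) [0..<length p]]"
      using x by (intro Span_trans[OF TG gs(1) _ gs(2)]) auto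
    finally have "simple_extension V x \<subseteq> Span T [g \<otimes> h. g \<leftarrow> gs, h \<leftarrow> map (\<lambda>i. x [^] i) [0..<length p]]" .
    moreover have "set [g \<otimes> h. g \<leftarrow> gs, h \<leftarrow> map (\<lambda>i. x [^] i) [0..<length p]] \<subseteq> carrier R"
      using gs x by auto
    ultimately have "\<exists>hs. set hs \<subseteq> carrier R \<and> simple_extension V x \<subseteq> Span T hs" by blast
    moreover have inc: "V \<subseteq> simple_extension V x"
      using simple_extension_incl[OF subringE(1)[OF Vs(1)] x] .
    ultimately have "simple_extension V x \<in> ?A"
      using simple_extension_subring[OF Vs(1) x] Vs by (auto simp: subalgebras_def)
    from max[THEN bspec, OF this] inc show ?thesis using simple_extension_mem[OF Vs(1) x] by simp
  qed
  then show ?thesis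
    using gs Span_subset_carrier[OF TG gs(1)] by (intro exI[of _ gs]) auto
qed

section \<open>The conductor and pi-regularity modulo it\<close>

lemma ideal_conductor:
  assumes "subring T R"
  shows "ideal (conductor T) R"
proof (rule idealI)
  note TD = subringE[OF assms]
  show "subgroup (conductor T) (add_monoid R)"
    by (rule add.subgroupI)
      (use TD in \<open>auto simp: conductor_def l_distr l_minus a_inv_def[symmetric] intro!: exI[of _ \<zero>]\<close>)
  show 1: "c \<otimes> x \<in> conductor T" if "c \<in> conductor T" "x \<in> carrier R" for c x
    using that by (simp add: conductor_def m_assoc)
  then show "x \<otimes> c \<in> conductor T" if "c \<in> conductor T" "x \<in> carrier R" for c x
    using that 1[OF that] by (auto simp: conductor_def m_comm)
qed (rule ring_axioms)

lemma conductor_subset: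
  assumes "subring T R"
  shows "conductor T \<subseteq> T"
proof
  fix c assume "c \<in> conductor T"
  then have "c \<in> carrier R" "c \<otimes> \<one> \<in> T" unfolding conductor_def by blast+
  then show "c \<in> T" by simp
qed

text \<open>Each T + x^(n+1) R is a ring because x^(n+1) R is an ideal. These rings descend, and a
  finite chain forces two of them to coincide, hence also two consecutive ones.\<close>

lemma FCP_power_chain_stable:
  assumes fcp: "FCP R A" and T: "T \<in> subalgebras R A" and x: "x \<in> carrier R"
  obtains n where "\<And>s. s \<in> carrier R \<Longrightarrow>
    \<exists>a \<in> T. \<exists>s' \<in> carrier R. x [^] Suc n \<otimes> s = a \<oplus> x [^] Suc (Suc n) \<otimes> s'"
proof -
  have Ts: "subring T R" "A \<subseteq> T" using T by (auto simp: subalgebras_def)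
  note TD = subringE[OF Ts(1)]
  define F where "F n = {u. \<exists>a \<in> T. \<exists>s \<in> carrier R. u = a \<oplus> x [^] Suc n \<otimes> s}" for n
  have TC: "a \<in> carrier R" if "a \<in> T" for a using that TD by auto
  have TF: "T \<subseteq> F n" for n
  proof
    fix a assume "a \<in> T"
    moreover from this have "a = a \<oplus> x [^] Suc n \<otimes> \<zero>" using TC x by auto
    ultimately show "a \<in> F n" unfolding F_def using zero_closed by blast
  qed
  have sub: "subring (F n) R" for n
  proof (rule subringI)
    obtain p where pdef: "x [^] Suc n = p" and p: "p \<in> carrier R" using x by blast
    have FI: "a \<oplus> p \<otimes> s \<in> F n" if "a \<in> T" "s \<in> carrier R" for a s
      unfolding F_def pdef using that by blast
    show "F n \<subseteq> carrier R" using TC p unfolding F_def pdef by auto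
    show "\<one> \<in> F n" using TF TD by auto
    fix h assume "h \<in> F n"
    then obtain a s where h: "h = a \<oplus> p \<otimes> s" "a \<in> T" "s \<in> carrier R"
      by (unfold F_def pdef) blast
    have "\<ominus> h = (\<ominus> a) \<oplus> p \<otimes> (\<ominus> s)" unfolding h using TC[OF h(2)] h(3) p by algebra
    then show "\<ominus> h \<in> F n" using FI h(2,3) TD(5) by simp
    fix k assume "k \<in> F n"
    then obtain b r where k: "k = b \<oplus> p \<otimes> r" "b \<in> T" "r \<in> carrier R"
      by (unfold F_def pdef) blast
    have "h \<oplus> k = (a \<oplus> b) \<oplus> p \<otimes> (s \<oplus> r)"
      unfolding h k using TC[OF h(2)] TC[OF k(2)] h(3) k(3) p by algebra
    then show "h \<oplus> k \<in> F n" using FI h(2,3) k(2,3) TD(7) by simp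
    have "h \<otimes> k = (a \<otimes> b) \<oplus> p \<otimes> (a \<otimes> r \<oplus> s \<otimes> b \<oplus> p \<otimes> s \<otimes> r)"
      unfolding h k using TC[OF h(2)] TC[OF k(2)] h(3) k(3) p
      by (simp add: l_distr r_distr m_ac a_ac)
    moreover have "a \<otimes> r \<oplus> s \<otimes> b \<oplus> p \<otimes> s \<otimes> r \<in> carrier R"
      using TC[OF h(2)] TC[OF k(2)] h(3) k(3) p by auto
    ultimately show "h \<otimes> k \<in> F n" using FI h(2) k(2) TD(6) by simp
  qed
  have dec: "F (Suc n) \<subseteq> F n" for n
  proof
    fix u assume "u \<in> F (Suc n)"
    then obtain a s where u: "u = a \<oplus> x [^] Suc (Suc n) \<otimes> s" "a \<in> T" "s \<in> carrier R"
      by (auto simp: F_def)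
    then have "u = a \<oplus> x [^] Suc n \<otimes> (x \<otimes> s)" using x by (simp add: m_assoc)
    then show "u \<in> F n" unfolding F_def using u x by blast
  qed
  then have anti: "F j \<subseteq> F i" if "i \<le> j" for i j
    using that by (rule lift_Suc_antimono_le)
  have "F n \<in> subalgebras R A" for n
    using sub[of n] Ts(2) TF[of n] by (auto simp: subalgebras_def)
  moreover have "F i \<subseteq> F j \<or> F j \<subseteq> F i" for i j
    using anti[of i j] anti[of j i] nat_le_linear by blast
  ultimately have "subset.chain (subalgebras R A) (range F)"
    by (auto simp: subset_chain_def)
  then have "finite (range F)" using fcp by (simp add: FCP_def)
  then have "\<not> inj F" using finite_imageD infinite_UNIV_nat by blast
  then obtain i j where "F i = F j" "i < j"
    by (metis injI linorder_neqE_nat)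
  then have "F i \<subseteq> F (Suc i)" using anti[of "Suc i" j] by simp
  moreover have "x [^] Suc i \<otimes> s \<in> F i" if "s \<in> carrier R" for s
  proof -
    have "x [^] Suc i \<otimes> s = \<zero> \<oplus> x [^] Suc i \<otimes> s" using that x by auto
    then show ?thesis unfolding F_def using that TD(2) by blast
  qed
  ultimately show ?thesis using that[of i] unfolding F_def by blast
qed

text \<open>Put q = t^(n+1). Stability gives q R \<subseteq> T + t q R, and q R is generated over
  \<open>T\<close> by the products q g with g in \<open>gs\<close>. So Nakayama for the ideal t T
  yields d in 1 + t T with d q R \<subseteq> T, which puts q d into the conductor.\<close>

lemma power_regular_modulo_conductor_base:
  assumes A: "subring A R" and int: "integral_extension R A" and fcp: "FCP R A"
    and T: "T \<in> subalgebras R A" and t: "t \<in> T"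
  obtains v m where "v \<in> T" "t [^] (m::nat) \<otimes> (\<one> \<ominus> t \<otimes> v) \<in> conductor T"
proof -
  have Ts: "subring T R" "A \<subseteq> T" using T by (auto simp: subalgebras_def)
  note TG = subring_add_subgroup[OF Ts(1)] and TD = subringE[OF Ts(1)]
  have tC: "t \<in> carrier R" using t TD by auto
  obtain gs where gs: "set gs \<subseteq> carrier R" "carrier R = Span T gs"
    using integral_FCP_module_finite[OF A int fcp T] by blast
  obtain n where n: "\<And>s. s \<in> carrier R \<Longrightarrow>
      \<exists>a \<in> T. \<exists>s' \<in> carrier R. t [^] Suc n \<otimes> s = a \<oplus> t [^] Suc (Suc n) \<otimes> s'"
    using FCP_power_chain_stable[OF fcp T tC] by blast
  define q where "q = t [^] Suc n"
  have q: "q \<in> carrier R" unfolding q_def using tC by blast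
  have n': "\<exists>a \<in> T. \<exists>s' \<in> carrier R. q \<otimes> s = a \<oplus> t \<otimes> (q \<otimes> s')" if "s \<in> carrier R" for s
    using n[OF that] tC unfolding q_def by (simp add: m_ac)
  define hs where "hs = map (\<lambda>g. q \<otimes> g) gs"
  have hs: "set hs \<subseteq> carrier R" using gs(1) q by (auto simp: hs_def)
  \<comment> \<open>This is where t \<in> T enters: \<open>J\<close> must be an ideal of
    \<open>T\<close>. Other elements of the ring are reduced to this case in
    \<open>ex_idempotent_modulo_conductor\<close>.\<close>
  define J where "J = (\<lambda>v. t \<otimes> v) ` T"
  have JT: "J \<subseteq> T" using t TD by (auto simp: J_def)
  have J: "subgroup J (add_monoid R)"
  proof (rule add.subgroupI)
    show "J \<subseteq> carrier R" using JT TD by auto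
    show "J \<noteq> {}" using TD by (auto simp: J_def)
    fix a assume "a \<in> J"
    then obtain v where v: "a = t \<otimes> v" "v \<in> T" by (auto simp: J_def)
    have "\<ominus> a = t \<otimes> (\<ominus> v)" using v tC TD by (auto simp: r_minus)
    then show "\<ominus> a \<in> J" using v TD by (auto simp: J_def)
    fix b assume "b \<in> J"
    then obtain w where w: "b = t \<otimes> w" "w \<in> T" by (auto simp: J_def)
    have "a \<oplus> b = t \<otimes> (v \<oplus> w)" using v w tC TD(1) by (simp add: r_distr subset_iff)
    then show "a \<oplus> b \<in> J" using v w TD by (auto simp: J_def)
  qed
  have "\<exists>d \<in> T. d \<ominus> \<one> \<in> J \<and> (\<forall>h \<in> set hs. d \<otimes> h \<in> T)"
  proof (rule nakayama_modulo_subring[OF Ts(1) J JT _ hs TD(3)])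
    show "w \<otimes> j \<in> J" if w: "w \<in> T" and "j \<in> J" for w j
    proof -
      obtain v where v: "j = t \<otimes> v" "v \<in> T" using \<open>j \<in> J\<close> by (auto simp: J_def)
      have "w \<otimes> j = t \<otimes> (w \<otimes> v)" using v w tC TD(1) by (simp add: m_lcomm subset_iff)
      then show ?thesis using v w TD by (auto simp: J_def)
    qed
    have "\<one> \<ominus> \<one> = t \<otimes> \<zero>" using tC by (simp add: a_minus_def r_neg)
    then show "\<one> \<ominus> \<one> \<in> J" using TD by (auto simp: J_def)
    fix h assume "h \<in> set hs"
    then obtain g where g: "h = q \<otimes> g" "g \<in> carrier R" using gs by (auto simp: hs_def)
    obtain a s where a: "a \<in> T" "s \<in> carrier R" "h = a \<oplus> t \<otimes> (q \<otimes> s)"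
      using n'[OF g(2)] g(1) by auto
    have "Span T gs \<subseteq> {u \<in> carrier R. q \<otimes> u \<in> Span T hs}"
    proof (rule Span_least)
      fix k g assume kg: "k \<in> T" "g \<in> set gs"
      have "k \<otimes> (q \<otimes> g) \<in> Span T hs"
        using kg by (intro Span_mult_mem[OF TG hs]) (auto simp: hs_def)
      moreover have "k \<in> carrier R" "g \<in> carrier R" using kg TD gs(1) by auto
      ultimately show "k \<otimes> g \<in> {u \<in> carrier R. q \<otimes> u \<in> Span T hs}"
        using q by (simp add: m_lcomm)
    qed (use zero_in_Span[OF TG hs] Span_add_closed[OF TG hs] q in \<open>auto simp: r_distr\<close>)
    then have "q \<otimes> s \<in> Span T hs" using a(2) gs(2) by auto
    then have "t \<otimes> (q \<otimes> s) \<in> Span J hs"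
      by (intro Span_smult[OF J hs tC TD(1)]) (auto simp: J_def)
    moreover have "\<one> \<otimes> h = a \<oplus> t \<otimes> (q \<otimes> s)" 
      unfolding a(3)[symmetric] using g q by (simp only: l_one m_closed)
    ultimately show "\<exists>a \<in> T. \<exists>e \<in> Span J hs. \<one> \<otimes> h = a \<oplus> e"
      using a(1) by blast
  qed
  then obtain d v where d: "d \<in> T" "v \<in> T" "d \<ominus> \<one> = t \<otimes> v" "\<And>h. h \<in> set hs \<Longrightarrow> d \<otimes> h \<in> T"
    by (auto simp: J_def)
  have cl: "d \<in> carrier R" "v \<in> carrier R" using d TD by auto
  have "d = (d \<ominus> \<one>) \<oplus> \<one>" using cl by algebra
  also have "\<dots> = \<one> \<ominus> t \<otimes> (\<ominus> v)" unfolding d(3) using cl tC by algebra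
  finally have d': "d = \<one> \<ominus> t \<otimes> (\<ominus> v)" .
  have "Span T gs \<subseteq> {u \<in> carrier R. q \<otimes> d \<otimes> u \<in> T}"
  proof (rule Span_least)
    fix k g assume kg: "k \<in> T" "g \<in> set gs"
    then have kgc: "k \<in> carrier R" "g \<in> carrier R" using TD gs(1) by auto
    have "k \<otimes> (d \<otimes> (q \<otimes> g)) \<in> T" using d(4)[of "q \<otimes> g"] kg TD(6) by (simp add: hs_def)
    moreover have "k \<otimes> (d \<otimes> (q \<otimes> g)) = q \<otimes> d \<otimes> (k \<otimes> g)" using kgc cl q by algebra
    ultimately show "k \<otimes> g \<in> {u \<in> carrier R. q \<otimes> d \<otimes> u \<in> T}" using kgc by simp
  qed (use TD(2,7) q cl in \<open>auto simp: r_distr\<close>)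
  then have "q \<otimes> d \<in> conductor T"
    unfolding gs(2)[symmetric] conductor_def using q cl by blast
  then have "q \<otimes> (\<one> \<ominus> t \<otimes> (\<ominus> v)) \<in> conductor T" unfolding d' .
  then show ?thesis using that[OF TD(5)[OF d(2)], of "Suc n"] unfolding q_def by blast
qed

lemma one_minus_mult_mult:
  assumes "x \<in> carrier R" "a \<in> carrier R" "b \<in> carrier R"
  shows "(\<one> \<ominus> x \<otimes> a) \<otimes> (\<one> \<ominus> x \<otimes> b) = \<one> \<ominus> x \<otimes> (a \<oplus> b \<ominus> x \<otimes> a \<otimes> b)"
  using assms by algebra

text \<open>The elements 1 - x r are closed under multiplication, so powers keep this form.\<close>

lemma one_minus_mult_power:
  assumes "x \<in> carrier R" "a \<in> carrier R"
  shows "\<exists>b \<in> carrier R. (\<one> \<ominus> x \<otimes> a) [^] (n::nat) = \<one> \<ominus> x \<otimes> b"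
proof (induction n)
  case 0
  show ?case using assms by (intro bexI[of _ \<zero>]) (auto simp: a_minus_def)
next
  case (Suc n)
  then obtain b where b: "b \<in> carrier R" "(\<one> \<ominus> x \<otimes> a) [^] n = \<one> \<ominus> x \<otimes> b" by blast
  then show ?case
    using one_minus_mult_mult[OF assms(1) b(1) assms(2)] assms
    by (intro bexI[of _ "b \<oplus> a \<ominus> x \<otimes> b \<otimes> a"]) auto
qed

text \<open>The cofactor is the geometric sum 1 + z + ... + z^(n-1).\<close>

lemma one_minus_power_dvd:
  assumes "z \<in> carrier R"
  shows "\<exists>w \<in> carrier R. \<one> \<ominus> z [^] (n::nat) = (\<one> \<ominus> z) \<otimes> w"
proof (induction n)
  case 0
  show ?case using assms by (intro bexI[of _ \<zero>]) (auto simp: a_minus_def r_neg)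
next
  case (Suc n)
  then obtain w where w: "w \<in> carrier R" "\<one> \<ominus> z [^] n = (\<one> \<ominus> z) \<otimes> w" by blast
  obtain p where p: "z [^] n = p" "p \<in> carrier R" using assms by blast
  have "\<one> \<ominus> z [^] Suc n = (\<one> \<ominus> p) \<oplus> (\<one> \<ominus> z) \<otimes> p"
    unfolding nat_pow_Suc p(1) using p(2) assms by algebra
  also have "\<dots> = (\<one> \<ominus> z) \<otimes> (w \<oplus> p)"
    unfolding w(2)[unfolded p(1)] using p(2) assms w(1) by algebra
  finally show ?case using w p by blast
qed

text \<open>Stability of \<open>T + x\<^sup>n S\<close> gives \<open>x\<^sup>n (1 - x s) \<in> T\<close>, which reduces pi-regularity of \<open>x\<close> to that
  of an element of \<open>T\<close>.\<close>

lemma ex_idempotent_modulo_conductor: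
  assumes A: "subring A R" and int: "integral_extension R A" and fcp: "FCP R A"
    and T: "T \<in> subalgebras R A" and x: "x \<in> carrier R"
  obtains y n where "y \<in> carrier R" "x [^] (n::nat) \<otimes> (\<one> \<ominus> x \<otimes> y) \<in> conductor T"
    "(x \<otimes> y) \<otimes> (x \<otimes> y) \<ominus> x \<otimes> y \<in> conductor T"
proof -
  have Ts: "subring T R" "A \<subseteq> T" using T by (auto simp: subalgebras_def)
  note TD = subringE[OF Ts(1)]
  interpret C: ideal "conductor T" R by (rule ideal_conductor[OF Ts(1)])
  obtain n where n: "\<And>s. s \<in> carrier R \<Longrightarrow>
      \<exists>a \<in> T. \<exists>s' \<in> carrier R. x [^] Suc n \<otimes> s = a \<oplus> x [^] Suc (Suc n) \<otimes> s'"
    using FCP_power_chain_stable[OF fcp T x] by blast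
  obtain p where p: "x [^] n = p" "p \<in> carrier R" using x by blast
  \<comment> \<open>Stability applied to 1 makes t = x^(n+1) (1 - x s) an element of
    \<open>T\<close>.\<close>
  obtain t s where t: "t \<in> T" "s \<in> carrier R" "x [^] Suc n \<otimes> \<one> = t \<oplus> x [^] Suc (Suc n) \<otimes> s"
    using n[OF one_closed] by blast
  have tC: "t \<in> carrier R" using t TD by auto
  have "t = x [^] Suc n \<otimes> \<one> \<ominus> x [^] Suc (Suc n) \<otimes> s"
    unfolding t(3) using tC x t(2) by (simp add: a_minus_def a_assoc r_neg)
  also have "\<dots> = x \<otimes> p \<otimes> (\<one> \<ominus> x \<otimes> s)"
    unfolding nat_pow_Suc p(1) using tC x t(2) p(2) by algebra
  finally have teq: "t = x \<otimes> p \<otimes> (\<one> \<ominus> x \<otimes> s)" .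
  \<comment> \<open>In t^m (1 - t v) both 1 - t v and the m-th power of 1 - x s have the form 1 - x
    r. Collecting them leaves a power of x times one such factor.\<close>
  obtain v m where v: "v \<in> T" "t [^] (m::nat) \<otimes> (\<one> \<ominus> t \<otimes> v) \<in> conductor T"
    by (rule power_regular_modulo_conductor_base[OF A int fcp T t(1)])
  have vC: "v \<in> carrier R" using v TD by auto
  obtain z where z: "z \<in> carrier R" "(\<one> \<ominus> x \<otimes> s) [^] m = \<one> \<ominus> x \<otimes> z"
    using one_minus_mult_power[OF x t(2)] by blast
  define u where "u = p \<otimes> (\<one> \<ominus> x \<otimes> s) \<otimes> v"
  have u: "u \<in> carrier R" "t \<otimes> v = x \<otimes> u"
    unfolding u_def teq using p(2) x t(2) vC by (simp, algebra)
  define y where "y = z \<oplus> u \<ominus> x \<otimes> z \<otimes> u"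
  have y: "y \<in> carrier R" using z u x by (simp add: y_def)
  have xp: "x \<otimes> p = x [^] Suc n" using p x by (simp add: m_comm)
  have "t [^] m = (x [^] Suc n) [^] m \<otimes> (\<one> \<ominus> x \<otimes> z)"
    unfolding teq xp using x t(2) z(2) by (subst nat_pow_distrib) auto
  then have "t [^] m \<otimes> (\<one> \<ominus> t \<otimes> v) = x [^] (Suc n * m) \<otimes> ((\<one> \<ominus> x \<otimes> z) \<otimes> (\<one> \<ominus> x \<otimes> u))"
    unfolding u(2) nat_pow_pow[OF x] using x z u by (simp add: m_assoc del: nat_pow_Suc)
  then have reg: "x [^] (Suc n * m) \<otimes> (\<one> \<ominus> x \<otimes> y) \<in> conductor T"
    using v(2) unfolding one_minus_mult_mult[OF x z(1) u(1)] y_def by simp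
  \<comment> \<open>The exponent must be positive even for m = 0, since the power \<open>b\<close>
    has to be a multiple of x. It is idempotent modulo the conductor because 1 - x y divides 1 - b
    while x^N divides b.\<close>
  define N where "N = Suc (Suc n * m)"
  define b where "b = (x \<otimes> y) [^] N"
  obtain e where e: "x [^] (Suc n * m) = e" "e \<in> carrier R" using x by blast
  obtain w where w: "w \<in> carrier R" "\<one> \<ominus> b = (\<one> \<ominus> x \<otimes> y) \<otimes> w"
    unfolding b_def using one_minus_power_dvd[of "x \<otimes> y" N] x y by blast
  have bC: "b \<in> carrier R" using x y by (simp add: b_def)
  have xN: "x [^] N = e \<otimes> x" unfolding N_def nat_pow_Suc e(1) ..
  have "x [^] N \<otimes> (\<one> \<ominus> b) = (e \<otimes> (\<one> \<ominus> x \<otimes> y)) \<otimes> (x \<otimes> w)"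
    unfolding w(2) xN using x y w(1) e(2) by algebra
  then have 1: "x [^] N \<otimes> (\<one> \<ominus> b) \<in> conductor T"
    using C.I_r_closed[OF reg, of "x \<otimes> w"] x w(1) e(1) by simp
  have bN: "b = x [^] N \<otimes> y [^] N" unfolding b_def using x y by (rule nat_pow_distrib)
  obtain yN where yN: "y [^] N = yN" "yN \<in> carrier R" using y by blast
  have "b \<otimes> b \<ominus> b = \<ominus> (b \<otimes> (\<one> \<ominus> b))" using bC by algebra
  also have "b \<otimes> (\<one> \<ominus> b) = (x [^] N \<otimes> (\<one> \<ominus> b)) \<otimes> yN"
    using bN yN bC x by (metis m_assoc m_comm minus_closed nat_pow_closed one_closed)
  finally have 2: "b \<otimes> b \<ominus> b \<in> conductor T"
    using C.I_r_closed[OF 1 yN(2)] C.a_inv_closed by simp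
  obtain c where c: "b = x \<otimes> c" "c \<in> carrier R"
  proof
    show "b = x \<otimes> (e \<otimes> yN)" unfolding bN xN yN(1) using e(2) x yN(2) by algebra
  qed (use e yN in auto)
  show ?thesis using that[OF c(2)] 1 2 unfolding c(1) by blast
qed

lemma ex_maximalideal_superset:
  assumes I: "ideal I R" and "\<one> \<notin> I"
  obtains Q where "maximalideal Q R" "I \<subseteq> Q"
proof -
  let ?A = "{J. ideal J R \<and> I \<subseteq> J \<and> \<one> \<notin> J}"
  have "\<exists>M\<in>?A. \<forall>Y\<in>?A. M \<subseteq> Y \<longrightarrow> Y = M"
  proof (rule subset_Zorn_nonempty)
    show "?A \<noteq> {}" using assms by auto
    fix \<C> assume \<C>: "\<C> \<noteq> {}" "subset.chain ?A \<C>"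
    have ide: "ideal J R" if "J \<in> \<C>" for J using \<C>(2) that by (auto simp: subset.chain_def)
    have lin: "J \<subseteq> K \<or> K \<subseteq> J" if "J \<in> \<C>" "K \<in> \<C>" for J K
      using \<C>(2) that by (auto simp: subset_chain_def)
    have "ideal (\<Union>\<C>) R"
    proof (rule idealI)
      show "subgroup (\<Union>\<C>) (add_monoid R)"
      proof (rule add.subgroupI)
        show "\<Union>\<C> \<subseteq> carrier R" using ideal.Icarr[OF ide] by auto
        show "\<Union>\<C> \<noteq> {}"
          using \<C>(1) additive_subgroup.zero_closed[OF ideal.axioms(1)[OF ide]] by auto
        show "\<ominus> a \<in> \<Union>\<C>" if "a \<in> \<Union>\<C>" for a
          using that additive_subgroup.a_inv_closed[OF ideal.axioms(1)[OF ide]] by auto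
        show "a \<oplus> b \<in> \<Union>\<C>" if ab: "a \<in> \<Union>\<C>" "b \<in> \<Union>\<C>" for a b
        proof -
          obtain J K where "J \<in> \<C>" "K \<in> \<C>" "a \<in> J" "b \<in> K" using ab by auto
          then obtain L where "L \<in> \<C>" "a \<in> L" "b \<in> L" using lin by blast
          then show ?thesis using additive_subgroup.a_closed[OF ideal.axioms(1)[OF ide]] by auto
        qed
      qed
      show "x \<otimes> a \<in> \<Union>\<C>" if "a \<in> \<Union>\<C>" "x \<in> carrier R" for a x
        using that ideal.I_l_closed[OF ide] by auto
      show "a \<otimes> x \<in> \<Union>\<C>" if "a \<in> \<Union>\<C>" "x \<in> carrier R" for a x
        using that ideal.I_r_closed[OF ide] by auto
    qed (rule ring_axioms)
    then show "\<Union>\<C> \<in> ?A" using \<C> by (auto simp: subset.chain_def)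
  qed
  then obtain Q where Q: "ideal Q R" "I \<subseteq> Q" "\<one> \<notin> Q"
    and max: "\<And>Y. ideal Y R \<Longrightarrow> I \<subseteq> Y \<Longrightarrow> \<one> \<notin> Y \<Longrightarrow> Q \<subseteq> Y \<Longrightarrow> Y = Q"
    by auto
  have "maximalideal Q R"
  proof (rule maximalidealI[OF Q(1)])
    show "carrier R \<noteq> Q" using Q(3) by auto
    fix Y assume Y: "ideal Y R" "Q \<subseteq> Y"
    then show "Y = Q \<or> Y = carrier R"
      using max[OF Y(1)] ideal.one_imp_carrier[OF Y(1)] Q(2) by auto
  qed
  then show ?thesis using Q(2) by (rule that)
qed

end

section \<open>Consequences of u-elementary towers\<close>

text \<open>Reduces a claim about towers to a single step. \<open>E\<close> will be the equalizer of
  two morphisms on S; then \<open>closed\<close> says that the images of b agree as soon as those of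
  b^2 - b and b^3 - b^2 do.\<close>

lemma cu_elementary_least:
  assumes S: "cring S" and cu: "cu_elementary S R T" and E: "subring E S" "R \<subseteq> E"
    and closed: "\<And>b. b \<in> carrier S \<Longrightarrow> b \<otimes>\<^bsub>S\<^esub> b \<ominus>\<^bsub>S\<^esub> b \<in> E \<Longrightarrow>
      b \<otimes>\<^bsub>S\<^esub> b \<otimes>\<^bsub>S\<^esub> b \<ominus>\<^bsub>S\<^esub> b \<otimes>\<^bsub>S\<^esub> b \<in> E \<Longrightarrow> b \<in> E"
  shows "T \<subseteq> E"
  using cu[unfolded cu_elementary_def]
proof (induction rule: rtranclp_induct)
  case base
  show ?case by (rule E(2))
next
  case (step A B)
  interpret cring S by (rule S)
  obtain b where b: "subring A S" "subring B S" "b \<in> B" "b [^]\<^bsub>S\<^esub> (2::nat) \<ominus>\<^bsub>S\<^esub> b \<in> A"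
    "b [^]\<^bsub>S\<^esub> (3::nat) \<ominus>\<^bsub>S\<^esub> b [^]\<^bsub>S\<^esub> (2::nat) \<in> A" "B = simple_extension A b"
    using step(2) by (auto simp: u_elementary_def)
  have bC: "b \<in> carrier S" using b(2,3) subringE(1) by auto
  have "b [^]\<^bsub>S\<^esub> (2::nat) = b \<otimes>\<^bsub>S\<^esub> b" "b [^]\<^bsub>S\<^esub> (3::nat) = b \<otimes>\<^bsub>S\<^esub> b \<otimes>\<^bsub>S\<^esub> b"
    using bC by (simp_all add: numeral_2_eq_2 numeral_3_eq_3)
  then have "b \<in> E" using closed[OF bC] b(4,5) step(3) by auto
  show ?case
  proof
    fix u assume "u \<in> B"
    then show "u \<in> E"
      unfolding b(6)
      by (induction rule: simple_extension.induct)
        (use subringE[OF E(1)] \<open>b \<in> E\<close> step(3) in auto)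
  qed
qed

lemma u_integral_iff_cu_elementary:
  assumes S: "cring S" and R: "subring R S" and fcp: "FCP S R"
  shows "u_integral S R \<longleftrightarrow> cu_elementary S R (carrier S)"
proof
  interpret cring S by (rule S)
  assume "cu_elementary S R (carrier S)"
  moreover have "carrier S \<in> subalgebras S R"
    using carrier_is_subring subringE(1)[OF R] by (auto simp: subalgebras_def)
  ultimately show "u_integral S R"
    unfolding u_integral_def by (intro exI[of _ "{carrier S}"]) auto
next
  assume "u_integral S R"
  then obtain F where F: "F \<subseteq> subalgebras S R" "F \<noteq> {}" "\<forall>T \<in> F. cu_elementary S R T"
      "carrier S = \<Union>F" and dir: "\<forall>T \<in> F. \<forall>U \<in> F. \<exists>V \<in> F. T \<subseteq> V \<and> U \<subseteq> V"
    unfolding u_integral_def by auto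
  obtain M where M: "M \<in> F" "\<forall>V \<in> F. M \<subseteq> V \<longrightarrow> V = M"
    using FCP_ex_maximal[OF fcp F(1,2)] by auto
  \<comment> \<open>In a directed family a maximal member is the greatest one.\<close>
  have "T \<subseteq> M" if "T \<in> F" for T
    using dir M that by metis
  then have "carrier S = M" using F(4) M(1) by auto
  then show "cu_elementary S R (carrier S)" using F(3) M(1) by simp
qed

context cring
begin

text \<open>The identities behind both properties of u-elementary extensions: \<open>x\<close> and \<open>y\<close> are the
  images of one element \<open>b\<close> under two morphisms that agree on \<open>b\<^sup>2 - b\<close> and \<open>b\<^sup>3 - b\<^sup>2\<close>.\<close>

lemma u_elementary_identities:
  assumes x: "x \<in> carrier R" and y: "y \<in> carrier R"
    and 2: "x \<otimes> x \<ominus> x = y \<otimes> y \<ominus> y"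
    and 3: "x \<otimes> x \<otimes> x \<ominus> x \<otimes> x = y \<otimes> y \<otimes> y \<ominus> y \<otimes> y"
  shows "(x \<ominus> y) \<otimes> (x \<oplus> y) = x \<ominus> y" "(x \<ominus> y) \<otimes> (x \<otimes> y) = \<zero>"
proof -
  have xy: "(x \<otimes> x \<ominus> x) \<ominus> (y \<otimes> y \<ominus> y) = \<zero>"
    unfolding 2 using y by (simp add: a_minus_def r_neg)
  have "(x \<ominus> y) \<otimes> (x \<oplus> y) = ((x \<otimes> x \<ominus> x) \<ominus> (y \<otimes> y \<ominus> y)) \<oplus> (x \<ominus> y)"
    using x y by algebra
  then show 1: "(x \<ominus> y) \<otimes> (x \<oplus> y) = x \<ominus> y" using xy x y by simp
  have "(x \<otimes> x \<otimes> x \<ominus> x \<otimes> x) \<ominus> (y \<otimes> y \<otimes> y \<ominus> y \<otimes> y) = \<zero>"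
    unfolding 3 using y by (simp add: a_minus_def r_neg)
  \<comment> \<open>This rearranges x^3 - y^3 = (x - y) ((x + y)^2 - x y). By the first identity the
    two leading terms cancel.\<close>
  moreover have "(x \<ominus> y) \<otimes> (x \<otimes> y) =
      (x \<oplus> y) \<otimes> ((x \<ominus> y) \<otimes> (x \<oplus> y)) \<ominus> (x \<ominus> y) \<otimes> (x \<oplus> y) \<ominus>
      ((x \<otimes> x \<otimes> x \<ominus> x \<otimes> x) \<ominus> (y \<otimes> y \<otimes> y \<ominus> y \<otimes> y))"
    using x y by algebra
  moreover have "(x \<oplus> y) \<otimes> (x \<ominus> y) = x \<ominus> y" using 1 x y by (simp add: m_comm)
  ultimately show "(x \<ominus> y) \<otimes> (x \<otimes> y) = \<zero>"
    unfolding 1 using x y by (simp add: a_minus_def r_neg)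
qed

text \<open>For d = x - y one has d (x + y) = d and d x y = 0, while d^2 = (x + y)^2 - 4 x
  y.\<close>

lemma u_elementary_cube:
  assumes x: "x \<in> carrier R" and y: "y \<in> carrier R"
    and 2: "x \<otimes> x \<ominus> x = y \<otimes> y \<ominus> y"
    and 3: "x \<otimes> x \<otimes> x \<ominus> x \<otimes> x = y \<otimes> y \<otimes> y \<ominus> y \<otimes> y"
  shows "(x \<ominus> y) \<otimes> ((x \<ominus> y) \<otimes> (x \<ominus> y)) = x \<ominus> y"
proof -
  define d where "d = x \<ominus> y"
  have d: "d \<in> carrier R" using x y by (simp add: d_def)
  note id = u_elementary_identities[OF assms, folded d_def]
  have dd: "d \<otimes> d = (x \<oplus> y) \<otimes> (x \<oplus> y) \<ominus> (x \<otimes> y \<oplus> x \<otimes> y \<oplus> x \<otimes> y \<oplus> x \<otimes> y)"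
    unfolding d_def using x y by algebra
  have "d \<otimes> (d \<otimes> d) = d \<otimes> (x \<oplus> y) \<otimes> (x \<oplus> y) \<ominus>
      (d \<otimes> (x \<otimes> y) \<oplus> d \<otimes> (x \<otimes> y) \<oplus> d \<otimes> (x \<otimes> y) \<oplus> d \<otimes> (x \<otimes> y))"
    unfolding dd using x y d by algebra
  then show ?thesis unfolding id d_def[symmetric] using d by (simp add: a_minus_def)
qed

text \<open>With d = x - y both d x y and d (1 - x) (1 - y) = d - d (x + y) + d x y vanish, and
  \<open>unit\<close> makes one of the two cofactors of d invertible.\<close>

lemma u_elementary_eq:
  assumes x: "x \<in> carrier R" and y: "y \<in> carrier R"
    and 2: "x \<otimes> x \<ominus> x = y \<otimes> y \<ominus> y"
    and 3: "x \<otimes> x \<otimes> x \<ominus> x \<otimes> x = y \<otimes> y \<otimes> y \<ominus> y \<otimes> y"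
    and unit: "x \<in> Units R \<and> y \<in> Units R \<or> \<one> \<ominus> x \<in> Units R \<and> \<one> \<ominus> y \<in> Units R"
  shows "x = y"
proof -
  note id = u_elementary_identities[OF x y 2 3]
  have cancel: "u = \<zero>" if "u \<in> carrier R" "w \<in> Units R" "u \<otimes> w = \<zero>" for u w
    by (metis that Units_closed Units_l_cancel m_comm r_null zero_closed)
  from unit have "x \<ominus> y = \<zero>"
  proof
    assume "x \<in> Units R \<and> y \<in> Units R"
    then show ?thesis using cancel[of "x \<ominus> y" "x \<otimes> y"] id x y by simp
  next
    assume u: "\<one> \<ominus> x \<in> Units R \<and> \<one> \<ominus> y \<in> Units R"
    have "(x \<ominus> y) \<otimes> ((\<one> \<ominus> x) \<otimes> (\<one> \<ominus> y)) =
        (x \<ominus> y) \<ominus> (x \<ominus> y) \<otimes> (x \<oplus> y) \<oplus> (x \<ominus> y) \<otimes> (x \<otimes> y)"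
      using x y by algebra
    also have "\<dots> = \<zero>" unfolding id using x y by (simp add: a_minus_def r_neg)
    finally show ?thesis using cancel[of "x \<ominus> y" "(\<one> \<ominus> x) \<otimes> (\<one> \<ominus> y)"] u x y by simp
  qed
  then show ?thesis using x y by simp
qed

end

section \<open>Units of a localization and morphisms out of it\<close>

lemma localization_unit:
  assumes A: "cring A" and P: "primeideal P A" and s: "s \<in> carrier A - P"
  shows "fraction A P s \<one>\<^bsub>A\<^esub> \<in> Units (localization A P)"
proof -
  interpret A: cring A by (rule A)
  interpret L: cring "localization A P" by (rule localization_cring[OF A P])
  have 1: "\<one>\<^bsub>A\<^esub> \<in> carrier A - P" by (rule denominator_one[OF A P])
  have "fraction A P s \<one>\<^bsub>A\<^esub> \<otimes>\<^bsub>localization A P\<^esub> fraction A P \<one>\<^bsub>A\<^esub> s =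
      fraction A P (s \<otimes>\<^bsub>A\<^esub> \<one>\<^bsub>A\<^esub>) (\<one>\<^bsub>A\<^esub> \<otimes>\<^bsub>A\<^esub> s)"
    using s 1 by (subst localization_mult[OF A P]) auto
  also have "\<dots> = \<one>\<^bsub>localization A P\<^esub>"
    unfolding localization_one[OF A P] using s 1 by (intro fraction_eqI[OF A P]) auto
  finally have eq: "fraction A P s \<one>\<^bsub>A\<^esub> \<otimes>\<^bsub>localization A P\<^esub> fraction A P \<one>\<^bsub>A\<^esub> s = \<one>\<^bsub>localization A P\<^esub>" .
  have cl: "fraction A P s \<one>\<^bsub>A\<^esub> \<in> carrier (localization A P)"
    "fraction A P \<one>\<^bsub>A\<^esub> s \<in> carrier (localization A P)"
    using s 1 by (auto intro!: localization_carrierI[OF A P])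
  then show ?thesis
    using eq L.m_comm[OF cl] unfolding Units_def by auto
qed

lemma localization_hom:
  assumes A: "cring A" and P: "primeideal P A"
  shows "(\<lambda>a. fraction A P a \<one>\<^bsub>A\<^esub>) \<in> ring_hom A (localization A P)"
proof -
  interpret A: cring A by (rule A)
  have 1: "\<one>\<^bsub>A\<^esub> \<in> carrier A - P" by (rule denominator_one[OF A P])
  show ?thesis
    by (rule ring_hom_memI)
      (use 1 in \<open>simp_all add: localization_carrierI[OF A P] localization_mult[OF A P]
        localization_add[OF A P] localization_one[OF A P] del: Diff_iff\<close>)
qed

lemma fraction_mult_denominator:
  assumes A: "cring A" and P: "primeideal P A" and c: "a \<in> carrier A" "s \<in> carrier A - P"
  shows "fraction A P a s \<otimes>\<^bsub>localization A P\<^esub> fraction A P s \<one>\<^bsub>A\<^esub> = fraction A P a \<one>\<^bsub>A\<^esub>"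
proof -
  interpret A: cring A by (rule A)
  have 1: "\<one>\<^bsub>A\<^esub> \<in> carrier A - P" by (rule denominator_one[OF A P])
  have sA: "s \<in> carrier A" using c by simp
  have "fraction A P a s \<otimes>\<^bsub>localization A P\<^esub> fraction A P s \<one>\<^bsub>A\<^esub> = fraction A P (a \<otimes>\<^bsub>A\<^esub> s) (s \<otimes>\<^bsub>A\<^esub> \<one>\<^bsub>A\<^esub>)"
    using c 1 sA by (subst localization_mult[OF A P]) auto
  also have "\<dots> = fraction A P a \<one>\<^bsub>A\<^esub>"
    using c 1 sA by (intro fraction_eqI[OF A P]) auto
  finally show ?thesis .
qed

lemma ring_hom_units:
  assumes "cring A" "cring B" "h \<in> ring_hom A B" "u \<in> Units A"
  shows "h u \<in> Units B"
proof -
  interpret h: ring_hom_cring A B h using assms by (intro UnivPoly.ring_hom_cringI)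
  obtain v where v: "v \<in> carrier A" "u \<otimes>\<^bsub>A\<^esub> v = \<one>\<^bsub>A\<^esub>" "v \<otimes>\<^bsub>A\<^esub> u = \<one>\<^bsub>A\<^esub>" "u \<in> carrier A"
    using assms(4) by (auto simp: Units_def)
  have "h u \<otimes>\<^bsub>B\<^esub> h v = \<one>\<^bsub>B\<^esub>" "h v \<otimes>\<^bsub>B\<^esub> h u = \<one>\<^bsub>B\<^esub>"
    using v by (metis h.hom_mult h.hom_one)+
  then show ?thesis using v by (auto simp: Units_def intro!: bexI[of _ "h v"])
qed

text \<open>Multiplication by s clears the denominator of a/s, and the common image of s is a unit
  that cancels.\<close>

lemma localization_hom_eqI:
  assumes A: "cring A" and P: "primeideal P A" and C: "cring C"
    and g: "g \<in> ring_hom (localization A P) C" and h: "h \<in> ring_hom (localization A P) C"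
    and eq: "\<And>a. a \<in> carrier A \<Longrightarrow> g (fraction A P a \<one>\<^bsub>A\<^esub>) = h (fraction A P a \<one>\<^bsub>A\<^esub>)"
    and x: "x \<in> carrier (localization A P)"
  shows "g x = h x"
proof -
  interpret C: cring C by (rule C)
  interpret A: cring A by (rule A)
  have L: "cring (localization A P)" by (rule localization_cring[OF A P])
  obtain a s where xa: "x = fraction A P a s" "a \<in> carrier A" "s \<in> carrier A - P"
    using localization_carrierE[OF A P x] by metis
  let ?s = "fraction A P s \<one>\<^bsub>A\<^esub>"
  have sC: "?s \<in> carrier (localization A P)"
    using xa denominator_one[OF A P] by (intro localization_carrierI[OF A P]) auto
  have m: "x \<otimes>\<^bsub>localization A P\<^esub> ?s = fraction A P a \<one>\<^bsub>A\<^esub>"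
    unfolding xa(1) by (rule fraction_mult_denominator[OF A P xa(2,3)])
  have u: "g ?s \<in> Units C" by (rule ring_hom_units[OF L C g localization_unit[OF A P xa(3)]])
  have "g x \<otimes>\<^bsub>C\<^esub> g ?s = h x \<otimes>\<^bsub>C\<^esub> h ?s"
    using eq[OF xa(2)] ring_hom_mult[OF g x sC] ring_hom_mult[OF h x sC] m by simp
  also have "h ?s = g ?s" using eq[of s] xa by simp
  finally show ?thesis
    using u ring_hom_closed[OF g x] ring_hom_closed[OF h x] ring_hom_closed[OF g sC]
    by (metis C.Units_l_cancel C.m_comm)
qed

lemma equalizer_subring:
  assumes S: "cring S" and C: "cring C" and g: "g \<in> ring_hom S C" and h: "h \<in> ring_hom S C"
  shows "subring {s \<in> carrier S. g s = h s} S"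
proof -
  interpret S: cring S by (rule S)
  interpret g: ring_hom_cring S C g using assms by (intro UnivPoly.ring_hom_cringI)
  interpret h: ring_hom_cring S C h using assms by (intro UnivPoly.ring_hom_cringI)
  show ?thesis by (rule S.subringI) auto
qed

lemma subring_cring: "cring S \<Longrightarrow> subring R S \<Longrightarrow> cring (S\<lparr>carrier := R\<rparr>)"
  by (metis cring.subcringI' cring.axioms(1) ring.subcring_iff subringE(1))

lemma subring_id_hom: "subring R S \<Longrightarrow> id \<in> ring_hom (S\<lparr>carrier := R\<rparr>) S"
  using subringE(1)[of R S] by (auto simp: ring_hom_def)

lemma cu_elementary_imp_locally_epi:
  assumes S: "cring S" and R: "subring R S" and cu: "cu_elementary S R (carrier S)"
  shows "locally_epi (S\<lparr>carrier := R\<rparr>) S id"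
  unfolding locally_epi_def
proof (intro conjI allI impI)
  show idhom: "id \<in> ring_hom (S\<lparr>carrier := R\<rparr>) S" by (rule subring_id_hom[OF R])
  fix Q assume Q: "primeideal Q S"
  interpret S: cring S by (rule S)
  interpret Q: primeideal Q S by (rule Q)
  let ?A = "S\<lparr>carrier := R\<rparr>"
  define P where "P = {a \<in> carrier ?A. id a \<in> Q}"
  have A: "cring ?A" by (rule subring_cring[OF S R])
  have P: "primeideal P ?A"
    unfolding P_def
    using ring_hom_ring.primeideal_vimage[OF ring_hom_ringI2 A Q] A S idhom
    by (simp add: cring.axioms del: id_apply)
  let ?L = "localization S Q"
  have L: "cring ?L" by (rule localization_cring[OF S Q])
  have loc: "localization_map S Q id \<in> ring_hom (localization ?A P) ?L"
    by (rule localization_map_hom[OF A S idhom Q P_def])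
  show "cring_epi (localization ?A {a \<in> carrier ?A. id a \<in> Q}) ?L (localization_map S Q id)"
    unfolding cring_epi_def P_def[symmetric]
  proof (intro conjI allI impI ballI)
    fix C :: "(('a \<times> 'a) set \<times> ('a \<times> 'a) set) list ring" and g h x
    assume C: "cring C" and g: "g \<in> ring_hom ?L C" and h: "h \<in> ring_hom ?L C"
      and eq: "\<forall>a \<in> carrier (localization ?A P). g (localization_map S Q id a) = h (localization_map S Q id a)"
      and x: "x \<in> carrier ?L"
    interpret C: cring C by (rule C)
    \<comment> \<open>The tower lives in \<open>S\<close> and not in its localization, so the
      morphisms are compared after composition with the canonical map;
      \<open>localization_hom_eqI\<close> carries the equality back.\<close>
    define G where "G = g \<circ> (\<lambda>a. fraction S Q a \<one>\<^bsub>S\<^esub>)"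
    define H where "H = h \<circ> (\<lambda>a. fraction S Q a \<one>\<^bsub>S\<^esub>)"
    have G: "G \<in> ring_hom S C" unfolding G_def by (rule ring_hom_trans[OF localization_hom[OF S Q] g])
    have H: "H \<in> ring_hom S C" unfolding H_def by (rule ring_hom_trans[OF localization_hom[OF S Q] h])
    interpret G: ring_hom_cring S C G using S C G by (intro UnivPoly.ring_hom_cringI)
    interpret H: ring_hom_cring S C H using S C H by (intro UnivPoly.ring_hom_cringI)
    have unit: "G s \<in> Units C" "H s \<in> Units C" if "s \<in> carrier S - Q" for s
      unfolding G_def H_def
      using ring_hom_units[OF L C g localization_unit[OF S Q that]]
        ring_hom_units[OF L C h localization_unit[OF S Q that]] by auto
    let ?E = "{s \<in> carrier S. G s = H s}"
    have "carrier S \<subseteq> ?E"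
    proof (rule cu_elementary_least[OF S cu equalizer_subring[OF S C G H]])
      show "R \<subseteq> ?E"
      proof
        fix r assume r: "r \<in> R"
        have one: "\<one>\<^bsub>?A\<^esub> \<in> carrier ?A - P" by (rule denominator_one[OF A P])
        then have "localization_map S Q id (fraction ?A P r \<one>\<^bsub>?A\<^esub>) = fraction S Q r \<one>\<^bsub>S\<^esub>"
          using localization_map_fraction[where f = id, OF A S idhom Q P_def, of r "\<one>\<^bsub>?A\<^esub>"] r by simp
        moreover have "fraction ?A P r \<one>\<^bsub>?A\<^esub> \<in> carrier (localization ?A P)"
          using r one by (intro localization_carrierI[OF A P]) auto
        ultimately have "G r = H r" using eq unfolding G_def H_def by fastforce
        then show "r \<in> ?E" using r subringE(1)[OF R] by auto
      qed
      fix b assume b: "b \<in> carrier S" "b \<otimes>\<^bsub>S\<^esub> b \<ominus>\<^bsub>S\<^esub> b \<in> ?E"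
        "b \<otimes>\<^bsub>S\<^esub> b \<otimes>\<^bsub>S\<^esub> b \<ominus>\<^bsub>S\<^esub> b \<otimes>\<^bsub>S\<^esub> b \<in> ?E"
      have "b \<in> carrier S - Q \<or> \<one>\<^bsub>S\<^esub> \<ominus>\<^bsub>S\<^esub> b \<in> carrier S - Q"
      proof (rule ccontr)
        assume "\<not> ?thesis"
        then have "b \<in> Q" "\<one>\<^bsub>S\<^esub> \<ominus>\<^bsub>S\<^esub> b \<in> Q" using b(1) by auto
        then have "(\<one>\<^bsub>S\<^esub> \<ominus>\<^bsub>S\<^esub> b) \<oplus>\<^bsub>S\<^esub> b \<in> Q" by simp
        moreover have "(\<one>\<^bsub>S\<^esub> \<ominus>\<^bsub>S\<^esub> b) \<oplus>\<^bsub>S\<^esub> b = \<one>\<^bsub>S\<^esub>" using b(1) by algebra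
        ultimately show False using Q.one_imp_carrier Q.I_notcarr by simp
      qed
      then have "G b \<in> Units C \<and> H b \<in> Units C \<or>
          \<one>\<^bsub>C\<^esub> \<ominus>\<^bsub>C\<^esub> G b \<in> Units C \<and> \<one>\<^bsub>C\<^esub> \<ominus>\<^bsub>C\<^esub> H b \<in> Units C"
        using unit[of b] unit[of "\<one>\<^bsub>S\<^esub> \<ominus>\<^bsub>S\<^esub> b"] b(1) by (auto simp: a_minus_def)
      then have "G b = H b"
        by (rule C.u_elementary_eq[rotated 4]) (use b in \<open>auto simp: a_minus_def\<close>)
      then show "b \<in> ?E" using b(1) by simp
    qed
    then have "g (fraction S Q a \<one>\<^bsub>S\<^esub>) = h (fraction S Q a \<one>\<^bsub>S\<^esub>)" if "a \<in> carrier S" for a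
      using that unfolding G_def H_def by auto
    then show "g x = h x" by (rule localization_hom_eqI[OF S Q C g h _ x])
  qed (rule loc)
qed

section \<open>Differentials\<close>

lemma pair_ring_of_closed:
  "x \<in> carrier B \<Longrightarrow> y \<in> carrier B \<Longrightarrow> frag_of (x, y) \<in> carrier (pair_ring B)"
  by (simp add: pair_ring_carrier)

lemma pair_ring_minus:
  assumes "cring B" "p \<in> carrier (pair_ring B)" "q \<in> carrier (pair_ring B)"
  shows "p \<ominus>\<^bsub>pair_ring B\<^esub> q = p - q"
proof -
  interpret cring "pair_ring B" by (rule pair_ring_cring[OF assms(1)])
  have "- q \<in> carrier (pair_ring B)" using assms(3) by (simp add: pair_ring_carrier)
  then have "\<ominus>\<^bsub>pair_ring B\<^esub> q = - q"
    using minus_equality[of "- q" q] assms(3) by (simp add: pair_ring_add pair_ring_zero)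
  then show ?thesis by (simp add: a_minus_def pair_ring_add)
qed

lemma pair_ring_coset_eq_iff:
  assumes B: "cring B" and J: "ideal J (pair_ring B)"
    and "p \<in> carrier (pair_ring B)" "q \<in> carrier (pair_ring B)"
  shows "J +>\<^bsub>pair_ring B\<^esub> p = J +>\<^bsub>pair_ring B\<^esub> q \<longleftrightarrow> p - q \<in> J"
proof -
  interpret cring "pair_ring B" by (rule pair_ring_cring[OF B])
  show ?thesis
    using quotient_eq_iff_same_a_r_cos[OF J assms(3,4)] pair_ring_minus[OF B assms(3,4)] by simp
qed

context
  fixes B :: "('b, 'n) ring_scheme" and J
  assumes B: "cring B" and J: "ideal J (pair_ring B)"
begin

text \<open>Multiplicativity already holds in the pair ring, so \<open>J\<close> only has to force
  additivity. Keeping \<open>J\<close> arbitrary lets the lemma serve both the tensor ideal and the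
  ideal \<open>I\<close> of \<open>ex_homs_separating\<close>.\<close>

lemma pair_ring_left_hom:
  assumes "\<And>x x'. x \<in> carrier B \<Longrightarrow> x' \<in> carrier B \<Longrightarrow>
    frag_of (x \<oplus>\<^bsub>B\<^esub> x', \<one>\<^bsub>B\<^esub>) - frag_of (x, \<one>\<^bsub>B\<^esub>) - frag_of (x', \<one>\<^bsub>B\<^esub>) \<in> J"
  shows "(\<lambda>x. J +>\<^bsub>pair_ring B\<^esub> frag_of (x, \<one>\<^bsub>B\<^esub>)) \<in> ring_hom B (pair_ring B Quot J)"
proof -
  interpret B: cring B by (rule B)
  interpret P: cring "pair_ring B" by (rule pair_ring_cring[OF B])
  note hom = ideal.rcos_ring_hom[OF J]
  show ?thesis
  proof (rule ring_hom_memI)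
    fix x y assume xy: "x \<in> carrier B" "y \<in> carrier B"
    note cl = pair_ring_of_closed[OF xy(1) B.one_closed] pair_ring_of_closed[OF xy(2) B.one_closed]
      pair_ring_of_closed[OF B.a_closed[OF xy] B.one_closed]
    show "J +>\<^bsub>pair_ring B\<^esub> frag_of (x, \<one>\<^bsub>B\<^esub>) \<in> carrier (pair_ring B Quot J)"
      by (rule ring_hom_closed[OF hom cl(1)])
    show "J +>\<^bsub>pair_ring B\<^esub> frag_of (x \<otimes>\<^bsub>B\<^esub> y, \<one>\<^bsub>B\<^esub>) =
        (J +>\<^bsub>pair_ring B\<^esub> frag_of (x, \<one>\<^bsub>B\<^esub>)) \<otimes>\<^bsub>pair_ring B Quot J\<^esub> (J +>\<^bsub>pair_ring B\<^esub> frag_of (y, \<one>\<^bsub>B\<^esub>))"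
      using ring_hom_mult[OF hom cl(1,2)] by (simp add: pair_ring_mult_of)
    have "J +>\<^bsub>pair_ring B\<^esub> frag_of (x \<oplus>\<^bsub>B\<^esub> y, \<one>\<^bsub>B\<^esub>) =
        J +>\<^bsub>pair_ring B\<^esub> (frag_of (x, \<one>\<^bsub>B\<^esub>) + frag_of (y, \<one>\<^bsub>B\<^esub>))"
      using assms[OF xy] cl P.a_closed[OF cl(1,2)]
      by (subst pair_ring_coset_eq_iff[OF B J]) (simp_all add: pair_ring_add diff_diff_eq)
    then show "J +>\<^bsub>pair_ring B\<^esub> frag_of (x \<oplus>\<^bsub>B\<^esub> y, \<one>\<^bsub>B\<^esub>) =
        (J +>\<^bsub>pair_ring B\<^esub> frag_of (x, \<one>\<^bsub>B\<^esub>)) \<oplus>\<^bsub>pair_ring B Quot J\<^esub> (J +>\<^bsub>pair_ring B\<^esub> frag_of (y, \<one>\<^bsub>B\<^esub>))"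
      using ring_hom_add[OF hom cl(1,2)] by (simp add: pair_ring_add)
  qed (use ring_hom_one[OF hom] in \<open>simp add: pair_ring_one\<close>)
qed

lemma pair_ring_right_hom:
  assumes "\<And>x x'. x \<in> carrier B \<Longrightarrow> x' \<in> carrier B \<Longrightarrow>
    frag_of (\<one>\<^bsub>B\<^esub>, x \<oplus>\<^bsub>B\<^esub> x') - frag_of (\<one>\<^bsub>B\<^esub>, x) - frag_of (\<one>\<^bsub>B\<^esub>, x') \<in> J"
  shows "(\<lambda>x. J +>\<^bsub>pair_ring B\<^esub> frag_of (\<one>\<^bsub>B\<^esub>, x)) \<in> ring_hom B (pair_ring B Quot J)"
proof -
  interpret B: cring B by (rule B)
  interpret P: cring "pair_ring B" by (rule pair_ring_cring[OF B])
  note hom = ideal.rcos_ring_hom[OF J]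
  show ?thesis
  proof (rule ring_hom_memI)
    fix x y assume xy: "x \<in> carrier B" "y \<in> carrier B"
    note cl = pair_ring_of_closed[OF B.one_closed xy(1)] pair_ring_of_closed[OF B.one_closed xy(2)]
      pair_ring_of_closed[OF B.one_closed B.a_closed[OF xy]]
    show "J +>\<^bsub>pair_ring B\<^esub> frag_of (\<one>\<^bsub>B\<^esub>, x) \<in> carrier (pair_ring B Quot J)"
      by (rule ring_hom_closed[OF hom cl(1)])
    show "J +>\<^bsub>pair_ring B\<^esub> frag_of (\<one>\<^bsub>B\<^esub>, x \<otimes>\<^bsub>B\<^esub> y) =
        (J +>\<^bsub>pair_ring B\<^esub> frag_of (\<one>\<^bsub>B\<^esub>, x)) \<otimes>\<^bsub>pair_ring B Quot J\<^esub> (J +>\<^bsub>pair_ring B\<^esub> frag_of (\<one>\<^bsub>B\<^esub>, y))"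
      using ring_hom_mult[OF hom cl(1,2)] by (simp add: pair_ring_mult_of)
    have "J +>\<^bsub>pair_ring B\<^esub> frag_of (\<one>\<^bsub>B\<^esub>, x \<oplus>\<^bsub>B\<^esub> y) =
        J +>\<^bsub>pair_ring B\<^esub> (frag_of (\<one>\<^bsub>B\<^esub>, x) + frag_of (\<one>\<^bsub>B\<^esub>, y))"
      using assms[OF xy] cl P.a_closed[OF cl(1,2)]
      by (subst pair_ring_coset_eq_iff[OF B J]) (simp_all add: pair_ring_add diff_diff_eq)
    then show "J +>\<^bsub>pair_ring B\<^esub> frag_of (\<one>\<^bsub>B\<^esub>, x \<oplus>\<^bsub>B\<^esub> y) =
        (J +>\<^bsub>pair_ring B\<^esub> frag_of (\<one>\<^bsub>B\<^esub>, x)) \<oplus>\<^bsub>pair_ring B Quot J\<^esub> (J +>\<^bsub>pair_ring B\<^esub> frag_of (\<one>\<^bsub>B\<^esub>, y))"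
      using ring_hom_add[OF hom cl(1,2)] by (simp add: pair_ring_add)
  qed (use ring_hom_one[OF hom] in \<open>simp add: pair_ring_one\<close>)
qed

end

text \<open>Applied to an equalizer, this reduces the equality of two morphisms on the pair ring to
  the generators.\<close>

lemma subring_pair_ring_eq_carrier:
  assumes B: "cring B" and E: "subring E (pair_ring B)"
    and of: "\<And>x y. x \<in> carrier B \<Longrightarrow> y \<in> carrier B \<Longrightarrow> frag_of (x, y) \<in> E"
  shows "E = carrier (pair_ring B)"
proof
  interpret P: cring "pair_ring B" by (rule pair_ring_cring[OF B])
  show sub: "E \<subseteq> carrier (pair_ring B)" by (rule subringE(1)[OF E])
  show "carrier (pair_ring B) \<subseteq> E"
  proof
    fix p assume "p \<in> carrier (pair_ring B)"
    then have "Poly_Mapping.keys p \<subseteq> carrier B \<times> carrier B" by (simp add: pair_ring_carrier)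
    then show "p \<in> E"
    proof (induction p rule: frag_induction)
      case zero
      show ?case using subringE(2)[OF E] by (simp add: pair_ring_zero)
    next
      case (one z)
      then show ?case using of by (cases z) auto
    next
      case (diff p q)
      then show ?case
        using P.subring_minus_closed[OF E, of p q] pair_ring_minus[OF B, of p q] sub
        by (simp add: subset_iff)
    qed
  qed
qed

lemma tensor_mult_hom:
  assumes A: "cring A" and B: "cring B" and f: "f \<in> ring_hom A B"
  shows "tensor_mult B \<in> ring_hom (tensor_square A B f) B"
proof -
  interpret P: cring "pair_ring B" by (rule pair_ring_cring[OF B])
  interpret J: ideal "tensor_ideal A B f" "pair_ring B" by (rule tensor_ideal_ideal[OF assms])
  note hom = J.rcos_ring_hom
  note tm = tensor_mult_coset[OF assms] and pm = pair_mult_hom[OF B]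
  have ex: "\<exists>p \<in> carrier (pair_ring B). x = tensor_ideal A B f +>\<^bsub>pair_ring B\<^esub> p"
    if "x \<in> carrier (pair_ring B Quot tensor_ideal A B f)" for x
    using that by (auto simp: FactRing_def A_RCOSETS_def')
  show ?thesis
    unfolding tensor_square_def
  proof (rule ring_hom_memI)
    fix x y assume x: "x \<in> carrier (pair_ring B Quot tensor_ideal A B f)"
      and y: "y \<in> carrier (pair_ring B Quot tensor_ideal A B f)"
    from ex[OF x] ex[OF y] obtain p q
      where p: "p \<in> carrier (pair_ring B)" "x = tensor_ideal A B f +>\<^bsub>pair_ring B\<^esub> p"
        and q: "q \<in> carrier (pair_ring B)" "y = tensor_ideal A B f +>\<^bsub>pair_ring B\<^esub> q" by auto
    show "tensor_mult B x \<in> carrier B"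
      unfolding p(2) tm[OF p(1)] by (rule ring_hom_closed[OF pm p(1)])
    show "tensor_mult B (x \<otimes>\<^bsub>pair_ring B Quot tensor_ideal A B f\<^esub> y) = tensor_mult B x \<otimes>\<^bsub>B\<^esub> tensor_mult B y"
      unfolding p(2) q(2) ring_hom_mult[OF hom p(1) q(1), symmetric] tm[OF p(1)] tm[OF q(1)]
        tm[OF P.m_closed[OF p(1) q(1)]] by (rule ring_hom_mult[OF pm p(1) q(1)])
    show "tensor_mult B (x \<oplus>\<^bsub>pair_ring B Quot tensor_ideal A B f\<^esub> y) = tensor_mult B x \<oplus>\<^bsub>B\<^esub> tensor_mult B y"
      unfolding p(2) q(2) ring_hom_add[OF hom p(1) q(1), symmetric] tm[OF p(1)] tm[OF q(1)]
        tm[OF P.a_closed[OF p(1) q(1)]] by (rule ring_hom_add[OF pm p(1) q(1)])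
  next
    show "tensor_mult B \<one>\<^bsub>pair_ring B Quot tensor_ideal A B f\<^esub> = \<one>\<^bsub>B\<^esub>"
      unfolding ring_hom_one[OF hom, symmetric] tm[OF P.one_closed] by (rule ring_hom_one[OF pm])
  qed
qed

lemma FactGroup_self_trivial:
  assumes "group G"
  shows "carrier (G Mod carrier G) = {carrier G}"
proof -
  interpret group G by (rule assms)
  have "carrier G #>\<^bsub>G\<^esub> a = carrier G" if "a \<in> carrier G" for a
    using that by (intro coset_join2 subgroup_self)
  then show ?thesis by (auto simp: FactGroup_def RCOSETS_def)
qed

text \<open>At each step of the tower d = b \<otimes> 1 - 1 \<otimes> b equals d^3 modulo I^2 and so
  vanishes there; thus the two maps from S to (S \<otimes> S)/I^2 coincide. The projection to this
  quotient then factors through multiplication, which forces the kernel I of multiplication into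
  I^2.\<close>

lemma cu_elementary_imp_diagonal_ideal_idempotent:
  fixes S :: "('a, 'm) ring_scheme"
  assumes S: "cring S" and R: "subring R S" and cu: "cu_elementary S R (carrier S)"
  defines "A \<equiv> S\<lparr>carrier := R\<rparr>"
  shows "diagonal_ideal A S id \<cdot>\<^bsub>tensor_square A S id\<^esub> diagonal_ideal A S id = diagonal_ideal A S id"
proof -
  have A: "cring A" unfolding A_def by (rule subring_cring[OF S R])
  have idhom: "id \<in> ring_hom A S" unfolding A_def by (rule subring_id_hom[OF R])
  interpret S: cring S by (rule S)
  interpret P: cring "pair_ring S" by (rule pair_ring_cring[OF S])
  define J where "J = tensor_ideal A S id"
  interpret J: ideal J "pair_ring S" unfolding J_def by (rule tensor_ideal_ideal[OF A S idhom])
  define C where "C = pair_ring S Quot J"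
  have Csq: "tensor_square A S id = C" by (simp add: C_def J_def tensor_square_def)
  interpret C: cring C unfolding Csq[symmetric] by (rule tensor_square_cring[OF A S idhom])
  define \<pi> where "\<pi> = (\<lambda>p. J +>\<^bsub>pair_ring S\<^esub> p)"
  have \<pi>: "\<pi> \<in> ring_hom (pair_ring S) C" unfolding \<pi>_def C_def by (rule J.rcos_ring_hom)
  have rel: "bilinear_relations A S id \<subseteq> J"
  proof -
    have "bilinear_relations A S id \<subseteq> carrier (pair_ring S)"
      using bilinear_relations_kernel[OF S idhom] by (auto simp: a_kernel_def')
    then show ?thesis unfolding J_def tensor_ideal_def by (rule P.genideal_self)
  qed
  define g where "g = (\<lambda>x. \<pi> (frag_of (x, \<one>\<^bsub>S\<^esub>)))"
  define h where "h = (\<lambda>x. \<pi> (frag_of (\<one>\<^bsub>S\<^esub>, x)))"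
  have g: "g \<in> ring_hom S C"
    unfolding g_def \<pi>_def C_def
    by (rule pair_ring_left_hom[OF S J.is_ideal])
      (use rel S.one_closed in \<open>unfold bilinear_relations_def, blast\<close>)
  have h: "h \<in> ring_hom S C"
    unfolding h_def \<pi>_def C_def
    by (rule pair_ring_right_hom[OF S J.is_ideal])
      (use rel S.one_closed in \<open>unfold bilinear_relations_def, blast\<close>)
  interpret g: ring_hom_cring S C g using S C.cring_axioms g by (intro UnivPoly.ring_hom_cringI)
  interpret h: ring_hom_cring S C h using S C.cring_axioms h by (intro UnivPoly.ring_hom_cringI)
  have tm: "tensor_mult S \<in> ring_hom C S"
    unfolding Csq[symmetric] by (rule tensor_mult_hom[OF A S idhom])
  have tm\<pi>: "tensor_mult S (\<pi> p) = pair_mult S p" if "p \<in> carrier (pair_ring S)" for p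
    unfolding \<pi>_def J_def by (rule tensor_mult_coset[OF A S idhom that])
  define I where "I = diagonal_ideal A S id"
  have Idef: "I = a_kernel C S (tensor_mult S)"
    unfolding I_def diagonal_ideal_def Csq ..
  have I: "ideal I C"
    unfolding Idef
    by (rule ring_hom_ring.kernel_is_ideal[OF ring_hom_ringI2[OF C.ring_axioms S.ring_axioms tm]])
  define K where "K = I \<cdot>\<^bsub>C\<^esub> I"
  interpret K: ideal K C unfolding K_def by (rule C.ideal_prod_is_ideal[OF I I])
  define D where "D = C Quot K"
  interpret D: cring D unfolding D_def by (rule K.quotient_is_cring[OF C.cring_axioms])
  define \<kappa> where "\<kappa> = (\<lambda>c. K +>\<^bsub>C\<^esub> c)"
  have \<kappa>: "\<kappa> \<in> ring_hom C D" unfolding \<kappa>_def D_def by (rule K.rcos_ring_hom)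
  interpret \<kappa>: ring_hom_cring C D \<kappa>
    using C.cring_axioms D.cring_axioms \<kappa> by (intro UnivPoly.ring_hom_cringI)
  have \<kappa>0: "\<kappa> c = \<zero>\<^bsub>D\<^esub> \<longleftrightarrow> c \<in> K" if "c \<in> carrier C" for c
    using C.quotient_eq_iff_same_a_r_cos[OF K.is_ideal that C.zero_closed] that \<kappa>.hom_zero
    unfolding \<kappa>_def by (simp add: a_minus_def)
  have diag: "g x \<ominus>\<^bsub>C\<^esub> h x \<in> I" if x: "x \<in> carrier S" for x
  proof -
    interpret tm: ring_hom_cring C S "tensor_mult S"
      using S C.cring_axioms tm by (intro UnivPoly.ring_hom_cringI)
    have "tensor_mult S (g x) = x" "tensor_mult S (h x) = x"
      unfolding g_def h_def using x
      by (simp_all add: tm\<pi> pair_ring_of_closed pair_mult_of[OF S])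
    moreover have "tensor_mult S (g x \<ominus>\<^bsub>C\<^esub> h x) = tensor_mult S (g x) \<ominus>\<^bsub>S\<^esub> tensor_mult S (h x)"
      using x by (simp only: a_minus_def tm.hom_add tm.hom_a_inv g.hom_closed h.hom_closed C.a_inv_closed)
    ultimately have "tensor_mult S (g x \<ominus>\<^bsub>C\<^esub> h x) = \<zero>\<^bsub>S\<^esub>"
      using x by (simp only: S.r_right_minus_eq)
    moreover have "g x \<ominus>\<^bsub>C\<^esub> h x \<in> carrier C"
      using g.hom_closed[OF x] h.hom_closed[OF x] by (rule C.minus_closed)
    ultimately show ?thesis unfolding Idef a_kernel_def' by blast
  qed
  let ?E = "{s \<in> carrier S. (\<kappa> \<circ> g) s = (\<kappa> \<circ> h) s}"
  note \<kappa>g = ring_hom_trans[OF g \<kappa>] and \<kappa>h = ring_hom_trans[OF h \<kappa>]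
  have "carrier S \<subseteq> ?E"
  proof (rule cu_elementary_least[OF S cu equalizer_subring[OF S D.cring_axioms \<kappa>g \<kappa>h]])
    show "R \<subseteq> ?E"
    proof
      fix r assume r: "r \<in> R"
      then have rS: "r \<in> carrier S" using subringE(1)[OF R] by auto
      have "frag_of (id r \<otimes>\<^bsub>S\<^esub> \<one>\<^bsub>S\<^esub>, \<one>\<^bsub>S\<^esub>) - frag_of (\<one>\<^bsub>S\<^esub>, id r \<otimes>\<^bsub>S\<^esub> \<one>\<^bsub>S\<^esub>) \<in> bilinear_relations A S id"
        using r S.one_closed unfolding bilinear_relations_def A_def
        by (intro UnI2 CollectI exI[of _ r] exI[of _ "\<one>\<^bsub>S\<^esub>"] conjI refl) auto
      then have "frag_of (r, \<one>\<^bsub>S\<^esub>) - frag_of (\<one>\<^bsub>S\<^esub>, r) \<in> J" using rel rS by auto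
      then have "g r = h r"
        unfolding g_def h_def \<pi>_def using rS
        by (subst pair_ring_coset_eq_iff[OF S J.is_ideal]) (simp_all add: pair_ring_of_closed)
      then show "r \<in> ?E" using rS by simp
    qed
    fix b assume b: "b \<in> carrier S" "b \<otimes>\<^bsub>S\<^esub> b \<ominus>\<^bsub>S\<^esub> b \<in> ?E"
      "b \<otimes>\<^bsub>S\<^esub> b \<otimes>\<^bsub>S\<^esub> b \<ominus>\<^bsub>S\<^esub> b \<otimes>\<^bsub>S\<^esub> b \<in> ?E"
    define d where "d = g b \<ominus>\<^bsub>C\<^esub> h b"
    have d: "d \<in> carrier C" "d \<in> I" using b(1) diag by (auto simp: d_def)
    have "d \<otimes>\<^bsub>C\<^esub> (d \<otimes>\<^bsub>C\<^esub> d) \<in> K"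
      unfolding K_def using d by (intro ideal_prod.prod ideal.I_l_closed[OF I])
    then have "\<kappa> (d \<otimes>\<^bsub>C\<^esub> (d \<otimes>\<^bsub>C\<^esub> d)) = \<zero>\<^bsub>D\<^esub>"
      using \<kappa>0[of "d \<otimes>\<^bsub>C\<^esub> (d \<otimes>\<^bsub>C\<^esub> d)"] d(1) C.m_closed by blast
    moreover have \<kappa>d: "\<kappa> d = \<kappa> (g b) \<ominus>\<^bsub>D\<^esub> \<kappa> (h b)" using b(1) by (simp add: d_def a_minus_def)
    moreover have "\<kappa> d \<otimes>\<^bsub>D\<^esub> (\<kappa> d \<otimes>\<^bsub>D\<^esub> \<kappa> d) = \<kappa> d"
      unfolding \<kappa>d by (rule D.u_elementary_cube) (use b in \<open>auto simp: a_minus_def\<close>)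
    ultimately have "\<kappa> (g b) \<ominus>\<^bsub>D\<^esub> \<kappa> (h b) = \<zero>\<^bsub>D\<^esub>" using d by simp
    then show "b \<in> ?E" using b(1) by simp
  qed
  then have gh: "\<kappa> (g s) = \<kappa> (h s)" if "s \<in> carrier S" for s using that by auto
  note \<psi> = ring_hom_trans[OF \<pi> \<kappa>]
    and \<theta> = ring_hom_trans[OF pair_mult_hom[OF S] \<kappa>h]
  \<comment> \<open>As the two maps agree, x \<otimes> y and 1 \<otimes> x y have the same image in
    the quotient.\<close>
  have eq: "{p \<in> carrier (pair_ring S). (\<kappa> \<circ> \<pi>) p = (\<kappa> \<circ> h \<circ> pair_mult S) p} = carrier (pair_ring S)"
  proof (rule subring_pair_ring_eq_carrier[OF S equalizer_subring[OF P.cring_axioms D.cring_axioms \<psi> \<theta>]])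
    fix x y assume xy: "x \<in> carrier S" "y \<in> carrier S"
    have "frag_of (x, y) = frag_of (x, \<one>\<^bsub>S\<^esub>) \<otimes>\<^bsub>pair_ring S\<^esub> frag_of (\<one>\<^bsub>S\<^esub>, y)"
      using xy by (simp add: pair_ring_mult_of)
    then have "\<pi> (frag_of (x, y)) = g x \<otimes>\<^bsub>C\<^esub> h y"
      unfolding g_def h_def
      using ring_hom_mult[OF \<pi> pair_ring_of_closed[OF xy(1) S.one_closed]
          pair_ring_of_closed[OF S.one_closed xy(2)]] by simp
    then show "frag_of (x, y) \<in> {p \<in> carrier (pair_ring S). (\<kappa> \<circ> \<pi>) p = (\<kappa> \<circ> h \<circ> pair_mult S) p}"
      using xy gh by (simp add: pair_ring_of_closed pair_mult_of[OF S])
  qed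
  have "c \<in> K" if c: "c \<in> I" for c
  proof -
    have "c \<in> carrier C" "tensor_mult S c = \<zero>\<^bsub>S\<^esub>" using c by (auto simp: Idef a_kernel_def')
    then obtain p where p: "p \<in> carrier (pair_ring S)" "c = \<pi> p"
      by (auto simp: C_def \<pi>_def FactRing_def A_RCOSETS_def')
    have "pair_mult S p = \<zero>\<^bsub>S\<^esub>"
      using tm\<pi>[OF p(1)] p(2) \<open>tensor_mult S c = \<zero>\<^bsub>S\<^esub>\<close> by simp
    moreover have "\<kappa> (\<pi> p) = \<kappa> (h (pair_mult S p))" using eq p(1) by auto
    ultimately have "\<kappa> c = \<zero>\<^bsub>D\<^esub>" using p(2) by simp
    then show ?thesis using \<kappa>0 \<open>c \<in> carrier C\<close> by simp
  qed
  moreover have "K \<subseteq> I" unfolding K_def using C.ideal_prod_inter[OF I I] by simp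
  ultimately show ?thesis unfolding Csq I_def[symmetric] K_def[symmetric] by blast
qed

lemma cu_elementary_imp_unramified:
  assumes S: "cring S" and R: "subring R S" and int: "integral_extension S R" and fcp: "FCP S R"
    and cu: "cu_elementary S R (carrier S)"
  shows "unramified (S\<lparr>carrier := R\<rparr>) S id"
  unfolding unramified_def
proof (intro conjI)
  interpret S: cring S by (rule S)
  let ?A = "S\<lparr>carrier := R\<rparr>"
  have A: "cring ?A" by (rule subring_cring[OF S R])
  show idhom: "id \<in> ring_hom ?A S" by (rule subring_id_hom[OF R])
  show "finite_type ?A S id"
  proof -
    \<comment> \<open>Module generators over \<open>R\<close> are in particular algebra
      generators.\<close>
    obtain gs where gs: "set gs \<subseteq> carrier S" "carrier S = S.Span R gs"
      using S.integral_FCP_module_finite[OF R int fcp, of R] R unfolding subalgebras_def by blast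
    have U: "R \<union> set gs \<subseteq> carrier S" using subringE(1)[OF R] gs by auto
    note G = subringE[OF S.generate_ring_is_subring[OF U]]
    have "S.Span R gs \<subseteq> generate_ring S (R \<union> set gs)"
      by (rule S.Span_least) (auto intro: G generate_ring.incl)
    then have "carrier S = generate_ring S (id ` carrier ?A \<union> set gs)" using G(1) gs(2) by auto
    then show ?thesis unfolding finite_type_def using gs(1) by blast
  qed
  let ?C = "tensor_square ?A S id" and ?I = "diagonal_ideal ?A S id"
  interpret C: cring ?C by (rule tensor_square_cring[OF A S idhom])
  interpret I: ideal ?I ?C
    unfolding diagonal_ideal_def
    by (rule ring_hom_ring.kernel_is_ideal[OF ring_hom_ringI2[OF C.ring_axioms S.ring_axioms
            tensor_mult_hom[OF A S idhom]]])
  have "group ((add_monoid ?C)\<lparr>carrier := ?I\<rparr>)"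
    by (rule subgroup.subgroup_is_group[OF I.a_subgroup C.add.is_group])
  from FactGroup_self_trivial[OF this]
  show "carrier (differentials ?A S id) = {\<one>\<^bsub>differentials ?A S id\<^esub>}"
    unfolding differentials_def cu_elementary_imp_diagonal_ideal_idempotent[OF S R cu]
    by (simp add: FactGroup_def)
qed

section \<open>Localizations and residue fields\<close>

lemma localization_lift:
  assumes A: "cring A" and P: "primeideal P A" and C: "cring C" and g: "g \<in> ring_hom A C"
    and unit: "\<And>s. s \<in> carrier A - P \<Longrightarrow> g s \<in> Units C"
  obtains G where "G \<in> ring_hom (localization A P) C"
    "\<And>a s. a \<in> carrier A \<Longrightarrow> s \<in> carrier A - P \<Longrightarrow>
      G (fraction A P a s) = g a \<otimes>\<^bsub>C\<^esub> inv\<^bsub>C\<^esub> (g s)"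
proof -
  interpret A: cring A by (rule A)
  interpret C: cring C by (rule C)
  interpret g: ring_hom_cring A C g using A C g by (intro UnivPoly.ring_hom_cringI)
  \<comment> \<open>A fraction is an equivalence class of pairs, so some representative is chosen;
    the next claim shows that the value does not depend on it.\<close>
  define G where "G U = (let z = SOME z. z \<in> U in g (fst z) \<otimes>\<^bsub>C\<^esub> inv\<^bsub>C\<^esub> (g (snd z)))" for U
  have G: "G (fraction A P a s) = g a \<otimes>\<^bsub>C\<^esub> inv\<^bsub>C\<^esub> (g s)"
    if a: "a \<in> carrier A" and s: "s \<in> carrier A - P" for a s
  proof -
    define z where "z = (SOME z. z \<in> fraction A P a s)"
    obtain b t where z: "z = (b, t)" by (cases z)
    have "z \<in> fraction A P a s" unfolding z_def using fraction_refl[OF A P a s] by (rule someI)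
    then have bt: "(b, t) \<in> fraction A P a s" by (simp add: z)
    note bt' = mem_fractionD[OF A P bt a s]
    obtain u where u: "u \<in> carrier A - P"
      "u \<otimes>\<^bsub>A\<^esub> (a \<otimes>\<^bsub>A\<^esub> t \<ominus>\<^bsub>A\<^esub> b \<otimes>\<^bsub>A\<^esub> s) = \<zero>\<^bsub>A\<^esub>"
      using bt by (auto simp: fraction_def)
    have cl: "s \<in> carrier A" "t \<in> carrier A" "u \<in> carrier A" using s bt' u by auto
    have "g u \<otimes>\<^bsub>C\<^esub> (g a \<otimes>\<^bsub>C\<^esub> g t \<ominus>\<^bsub>C\<^esub> g b \<otimes>\<^bsub>C\<^esub> g s) =
        g (u \<otimes>\<^bsub>A\<^esub> (a \<otimes>\<^bsub>A\<^esub> t \<ominus>\<^bsub>A\<^esub> b \<otimes>\<^bsub>A\<^esub> s))"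
      using cl a bt'(1) by (simp add: a_minus_def)
    also have "\<dots> = g u \<otimes>\<^bsub>C\<^esub> \<zero>\<^bsub>C\<^esub>" unfolding u(2) using cl by simp
    finally have "g a \<otimes>\<^bsub>C\<^esub> g t \<ominus>\<^bsub>C\<^esub> g b \<otimes>\<^bsub>C\<^esub> g s = \<zero>\<^bsub>C\<^esub>"
      by (rule C.Units_l_cancel[OF unit[OF u(1)], THEN iffD1, rotated 2]) (use cl a bt'(1) in auto)
    then have eq: "g a \<otimes>\<^bsub>C\<^esub> g t = g b \<otimes>\<^bsub>C\<^esub> g s" using cl a bt'(1) by simp
    have us: "g s \<in> Units C" "g t \<in> Units C" using unit s bt'(2) by auto
    define i j where "i = inv\<^bsub>C\<^esub> (g s)" and "j = inv\<^bsub>C\<^esub> (g t)"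
    have ij: "i \<in> carrier C" "j \<in> carrier C" "g s \<otimes>\<^bsub>C\<^esub> i = \<one>\<^bsub>C\<^esub>" "g t \<otimes>\<^bsub>C\<^esub> j = \<one>\<^bsub>C\<^esub>"
      using us by (auto simp: i_def j_def)
    have "g a \<otimes>\<^bsub>C\<^esub> i = (g a \<otimes>\<^bsub>C\<^esub> i) \<otimes>\<^bsub>C\<^esub> (g t \<otimes>\<^bsub>C\<^esub> j)" using ij a by simp
    also have "\<dots> = (g a \<otimes>\<^bsub>C\<^esub> g t) \<otimes>\<^bsub>C\<^esub> (i \<otimes>\<^bsub>C\<^esub> j)" using ij(1,2) cl a by (simp add: C.m_ac)
    also have "\<dots> = (g b \<otimes>\<^bsub>C\<^esub> j) \<otimes>\<^bsub>C\<^esub> (g s \<otimes>\<^bsub>C\<^esub> i)"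
      unfolding eq using ij(1,2) cl bt'(1) by (simp add: C.m_ac)
    finally have "g a \<otimes>\<^bsub>C\<^esub> i = g b \<otimes>\<^bsub>C\<^esub> j" using ij bt'(1) by simp
    then show ?thesis by (simp add: G_def z_def[symmetric] z i_def j_def)
  qed
  have hom: "G \<in> ring_hom (localization A P) C"
  proof (rule ring_hom_memI)
    fix x y assume x: "x \<in> carrier (localization A P)" and y: "y \<in> carrier (localization A P)"
    obtain a s where xa: "x = fraction A P a s" "a \<in> carrier A" "s \<in> carrier A - P"
      by (rule localization_carrierE[OF A P x])
    obtain b t where yb: "y = fraction A P b t" "b \<in> carrier A" "t \<in> carrier A - P"
      by (rule localization_carrierE[OF A P y])
    have st: "s \<in> carrier A" "t \<in> carrier A" "s \<otimes>\<^bsub>A\<^esub> t \<in> carrier A - P"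
      using xa yb denominator_mult[OF A P, of s t] by auto
    have us: "g s \<in> Units C" "g t \<in> Units C" using unit xa yb by auto
    define i j where "i = inv\<^bsub>C\<^esub> (g s)" and "j = inv\<^bsub>C\<^esub> (g t)"
    have ij: "i \<in> carrier C" "j \<in> carrier C" "g s \<otimes>\<^bsub>C\<^esub> i = \<one>\<^bsub>C\<^esub>" "g t \<otimes>\<^bsub>C\<^esub> j = \<one>\<^bsub>C\<^esub>"
      using us by (auto simp: i_def j_def)
    have "(g s \<otimes>\<^bsub>C\<^esub> g t) \<otimes>\<^bsub>C\<^esub> (i \<otimes>\<^bsub>C\<^esub> j) = (g s \<otimes>\<^bsub>C\<^esub> i) \<otimes>\<^bsub>C\<^esub> (g t \<otimes>\<^bsub>C\<^esub> j)"
      using st(1,2) ij(1,2) by (simp add: C.m_ac)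
    then have inv: "inv\<^bsub>C\<^esub> (g s \<otimes>\<^bsub>C\<^esub> g t) = i \<otimes>\<^bsub>C\<^esub> j"
      using st(1,2) ij by (intro C.comm_inv_char) simp_all
    show "G x \<in> carrier C" unfolding xa(1) G[OF xa(2,3)] using us xa by simp
    have "G (x \<otimes>\<^bsub>localization A P\<^esub> y) = g (a \<otimes>\<^bsub>A\<^esub> b) \<otimes>\<^bsub>C\<^esub> inv\<^bsub>C\<^esub> (g (s \<otimes>\<^bsub>A\<^esub> t))"
      unfolding xa(1) yb(1) localization_mult[OF A P xa(2,3) yb(2,3)]
      by (rule G[OF _ st(3)]) (use xa yb in simp)
    also have "\<dots> = (g a \<otimes>\<^bsub>C\<^esub> i) \<otimes>\<^bsub>C\<^esub> (g b \<otimes>\<^bsub>C\<^esub> j)"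
      using xa(2) yb(2) st(1,2) inv ij(1,2) by (simp add: C.m_ac)
    finally show "G (x \<otimes>\<^bsub>localization A P\<^esub> y) = G x \<otimes>\<^bsub>C\<^esub> G y"
      unfolding xa(1) yb(1) G[OF xa(2,3)] G[OF yb(2,3)] i_def j_def .
    have "G (x \<oplus>\<^bsub>localization A P\<^esub> y) =
        g (a \<otimes>\<^bsub>A\<^esub> t \<oplus>\<^bsub>A\<^esub> b \<otimes>\<^bsub>A\<^esub> s) \<otimes>\<^bsub>C\<^esub> inv\<^bsub>C\<^esub> (g (s \<otimes>\<^bsub>A\<^esub> t))"
      unfolding xa(1) yb(1) localization_add[OF A P xa(2,3) yb(2,3)]
      by (rule G[OF _ st(3)]) (use xa yb in simp)
    also have "\<dots> = (g a \<otimes>\<^bsub>C\<^esub> i) \<otimes>\<^bsub>C\<^esub> (g t \<otimes>\<^bsub>C\<^esub> j) \<oplus>\<^bsub>C\<^esub> (g b \<otimes>\<^bsub>C\<^esub> j) \<otimes>\<^bsub>C\<^esub> (g s \<otimes>\<^bsub>C\<^esub> i)"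
      using xa(2) yb(2) st(1,2) inv ij(1,2) by (simp add: C.r_distr C.m_ac)
    also have "\<dots> = g a \<otimes>\<^bsub>C\<^esub> i \<oplus>\<^bsub>C\<^esub> g b \<otimes>\<^bsub>C\<^esub> j" using ij xa(2) yb(2) by simp
    finally show "G (x \<oplus>\<^bsub>localization A P\<^esub> y) = G x \<oplus>\<^bsub>C\<^esub> G y"
      unfolding xa(1) yb(1) G[OF xa(2,3)] G[OF yb(2,3)] i_def j_def .
  next
    show "G \<one>\<^bsub>localization A P\<^esub> = \<one>\<^bsub>C\<^esub>"
      unfolding localization_one[OF A P] G[OF A.one_closed denominator_one[OF A P]] by simp
  qed
  show ?thesis by (rule that[OF hom G])
qed

section \<open>Linear functionals over a residue field\<close>

context cring
begin

text \<open>By \<open>field\<close> the image of \<open>T\<close> in R/N is a field, and x lies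
  outside it. Modulo \<open>N\<close>, H is a hyperplane of this vector space that contains 1 and
  misses x; it arises as a maximal submodule of this kind.\<close>

lemma ex_hyperplane:
  assumes T: "subring T R" and N: "ideal N R"
    and field: "\<forall>t \<in> T. t \<notin> N \<longrightarrow> (\<exists>v \<in> T. \<one> \<ominus> t \<otimes> v \<in> N)"
    and x: "x \<in> carrier R" "\<forall>t \<in> T. x \<ominus> t \<notin> N"
  shows "\<exists>H. subgroup H (add_monoid R) \<and> (\<forall>t \<in> T. \<forall>h \<in> H. t \<otimes> h \<in> H) \<and>
    T \<subseteq> H \<and> N \<subseteq> H \<and> x \<notin> H \<and> (\<forall>s \<in> carrier R. \<exists>a \<in> T. s \<ominus> a \<otimes> x \<in> H)"
proof -
  note TD = subringE[OF T]
  interpret N: ideal N R by (rule N)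
  have TC: "t \<in> carrier R" if "t \<in> T" for t using that TD(1) by auto
  let ?P = "\<lambda>H. subgroup H (add_monoid R) \<and> (\<forall>t \<in> T. \<forall>h \<in> H. t \<otimes> h \<in> H)
    \<and> T \<subseteq> H \<and> N \<subseteq> H \<and> x \<notin> H"
  have "\<exists>M \<in> {H. ?P H}. \<forall>Y \<in> {H. ?P H}. M \<subseteq> Y \<longrightarrow> Y = M"
  proof (rule subset_Zorn_nonempty)
    \<comment> \<open>The least candidate is T + N, which avoids x by assumption.\<close>
    define H0 where "H0 = {u. \<exists>t \<in> T. \<exists>n \<in> N. u = t \<oplus> n}"
    have H0I: "t \<oplus> n \<in> H0" if "t \<in> T" "n \<in> N" for t n using that by (auto simp: H0_def)
    have "?P H0"
    proof (intro conjI ballI)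
      show TH: "T \<subseteq> H0" using H0I[OF _ N.zero_closed] TC by (metis r_zero subsetI)
      show "N \<subseteq> H0" using H0I[OF TD(2)] N.Icarr by (metis l_zero subsetI)
      show "x \<notin> H0"
      proof
        assume "x \<in> H0"
        then obtain t n where tn: "t \<in> T" "n \<in> N" "x = t \<oplus> n" by (auto simp: H0_def)
        then have "x \<ominus> t = n" using TC[OF tn(1)] N.Icarr[OF tn(2)] by (simp add: a_minus_def a_ac r_neg1 r_neg)
        then show False using x(2) tn(1,2) by auto
      qed
      show "t \<otimes> h \<in> H0" if t: "t \<in> T" and "h \<in> H0" for t h
      proof -
        obtain s n where h: "h = s \<oplus> n" "s \<in> T" "n \<in> N" using \<open>h \<in> H0\<close> by (auto simp: H0_def)
        have "t \<otimes> h = t \<otimes> s \<oplus> t \<otimes> n" unfolding h using t h TC N.Icarr by (simp add: r_distr)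
        then show ?thesis using H0I[OF TD(6)[OF t h(2)] N.I_l_closed[OF h(3) TC[OF t]]] by simp
      qed
      show "subgroup H0 (add_monoid R)"
      proof (rule add.subgroupI)
        show "H0 \<subseteq> carrier R" using TC N.Icarr by (auto simp: H0_def)
        show "H0 \<noteq> {}" using TH TD(2) by auto
        fix h assume "h \<in> H0"
        then obtain s n where h: "h = s \<oplus> n" "s \<in> T" "n \<in> N" by (auto simp: H0_def)
        have "\<ominus> h = \<ominus> s \<oplus> \<ominus> n" unfolding h using TC[OF h(2)] N.Icarr[OF h(3)] by (rule minus_add)
        then show "\<ominus> h \<in> H0" using H0I[OF TD(5)[OF h(2)] N.a_inv_closed[OF h(3)]] by simp
        fix k assume "k \<in> H0"
        then obtain t m where k: "k = t \<oplus> m" "t \<in> T" "m \<in> N" by (auto simp: H0_def)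
        have "h \<oplus> k = (s \<oplus> t) \<oplus> (n \<oplus> m)"
          unfolding h k using TC[OF h(2)] N.Icarr[OF h(3)] TC[OF k(2)] N.Icarr[OF k(3)] by (simp add: a_ac)
        then show "h \<oplus> k \<in> H0" using H0I[OF TD(7)[OF h(2) k(2)] N.a_closed[OF h(3) k(3)]] by simp
      qed
    qed
    then show "{H. ?P H} \<noteq> {}" by auto
    fix \<C> assume \<C>: "\<C> \<noteq> {}" "subset.chain {H. ?P H} \<C>"
    have PC: "?P H" if "H \<in> \<C>" for H using \<C>(2) that by (auto simp: subset.chain_def)
    have lin: "H \<subseteq> K \<or> K \<subseteq> H" if "H \<in> \<C>" "K \<in> \<C>" for H K
      using \<C>(2) that by (auto simp: subset_chain_def)
    have "subgroup (\<Union>\<C>) (add_monoid R)"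
    proof (rule add.subgroupI)
      show "\<Union>\<C> \<subseteq> carrier R" using PC add_subgroup_props(1) by blast
      show "\<Union>\<C> \<noteq> {}" using PC \<C>(1) TD(2) by blast
      show "\<ominus> a \<in> \<Union>\<C>" if "a \<in> \<Union>\<C>" for a
        using that PC add_subgroup_closed(3) by blast
      show "a \<oplus> b \<in> \<Union>\<C>" if ab: "a \<in> \<Union>\<C>" "b \<in> \<Union>\<C>" for a b
      proof -
        obtain J K where "J \<in> \<C>" "K \<in> \<C>" "a \<in> J" "b \<in> K" using ab by auto
        then obtain L where "L \<in> \<C>" "a \<in> L" "b \<in> L" using lin by blast
        then show ?thesis using PC add_subgroup_closed(1) by blast
      qed
    qed
    moreover have "\<forall>t \<in> T. \<forall>h \<in> \<Union>\<C>. t \<otimes> h \<in> \<Union>\<C>" "x \<notin> \<Union>\<C>" using PC by blast+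
    moreover have "T \<subseteq> \<Union>\<C>" "N \<subseteq> \<Union>\<C>" using PC \<C>(1) by blast+
    ultimately show "\<Union>\<C> \<in> {H. ?P H}" by blast
  qed
  then obtain H where "H \<in> {H. ?P H}" and max: "\<forall>Y \<in> {H. ?P H}. H \<subseteq> Y \<longrightarrow> Y = H" ..
  then have H: "?P H" by simp
  have HG: "subgroup H (add_monoid R)" using H by blast
  have HC: "h \<in> carrier R" if "h \<in> H" for h using add_subgroup_props(1)[OF HG] that by auto
  have HT: "t \<otimes> h \<in> H" if "t \<in> T" "h \<in> H" for t h using H that by blast
  note Hadd = add_subgroup_closed[OF HG]
  have "\<exists>a \<in> T. s \<ominus> a \<otimes> x \<in> H" if s: "s \<in> carrier R" for s
  proof (cases "s \<in> H")
    case True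
    have "s \<ominus> \<zero> \<otimes> x = s" using s x by (simp add: a_minus_def)
    then show ?thesis using True TD(2) by (intro bexI[of _ \<zero>]) auto
  next
    case False
    define Y where "Y = {u. \<exists>h \<in> H. \<exists>a \<in> T. u = h \<oplus> a \<otimes> s}"
    have YI: "h \<oplus> a \<otimes> s \<in> Y" if "h \<in> H" "a \<in> T" for h a using that by (auto simp: Y_def)
    have HY: "H \<subseteq> Y"
    proof
      fix h assume h: "h \<in> H"
      then show "h \<in> Y" using YI[OF h TD(2)] s HC[OF h] by simp
    qed
    have z: "\<zero> \<in> H" using H TD(2) by blast
    have sY: "s \<in> Y" using YI[OF z TD(3)] s by simp
    have "subgroup Y (add_monoid R)"
    proof (rule add.subgroupI)
      show "Y \<subseteq> carrier R" using HC TC s by (auto simp: Y_def)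
      show "Y \<noteq> {}" using sY by auto
      fix u assume "u \<in> Y"
      then obtain h a where u: "h \<in> H" "a \<in> T" "u = h \<oplus> a \<otimes> s" by (auto simp: Y_def)
      have "\<ominus> u = \<ominus> h \<oplus> (\<ominus> a) \<otimes> s" unfolding u using HC[OF u(1)] TC[OF u(2)] s by algebra
      then show "\<ominus> u \<in> Y" using YI[OF Hadd(3)[OF u(1,1)] TD(5)[OF u(2)]] by simp
      fix w assume "w \<in> Y"
      then obtain k b where w: "k \<in> H" "b \<in> T" "w = k \<oplus> b \<otimes> s" by (auto simp: Y_def)
      have "u \<oplus> w = (h \<oplus> k) \<oplus> (a \<oplus> b) \<otimes> s"
        unfolding u w using HC[OF u(1)] TC[OF u(2)] HC[OF w(1)] TC[OF w(2)] s by algebra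
      then show "u \<oplus> w \<in> Y" using YI[OF Hadd(1)[OF u(1) w(1)] TD(7)[OF u(2) w(2)]] by simp
    qed
    moreover have "\<forall>t \<in> T. \<forall>u \<in> Y. t \<otimes> u \<in> Y"
    proof (intro ballI)
      fix t u assume t: "t \<in> T" and "u \<in> Y"
      then obtain h a where u: "h \<in> H" "a \<in> T" "u = h \<oplus> a \<otimes> s" by (auto simp: Y_def)
      have "t \<otimes> u = t \<otimes> h \<oplus> (t \<otimes> a) \<otimes> s"
        unfolding u using HC[OF u(1)] TC[OF u(2)] TC[OF t] s by algebra
      then show "t \<otimes> u \<in> Y" using YI[OF HT[OF t u(1)] TD(6)[OF t u(2)]] by simp
    qed
    moreover have "T \<subseteq> Y" "N \<subseteq> Y" using H HY by auto
    \<comment> \<open>Y = H + T s is strictly larger than H, so maximality puts x into it. Inverting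
      the coefficient of s modulo \<open>N\<close> then expresses s as a multiple of x modulo
      H.\<close>
    ultimately have "x \<notin> Y \<Longrightarrow> Y = H" using max HY by simp
    then have "x \<in> Y" using sY False by auto
    then obtain h a where xh: "h \<in> H" "a \<in> T" "x = h \<oplus> a \<otimes> s" by (auto simp: Y_def)
    have "a \<notin> N"
    proof
      assume "a \<in> N"
      then have "a \<otimes> s \<in> H" using N.I_r_closed[OF _ s] H by blast
      then show False using Hadd(1)[OF xh(1)] xh(3) H by metis
    qed
    then obtain v where v: "v \<in> T" "\<one> \<ominus> a \<otimes> v \<in> N" using field xh(2) by blast
    have cl: "v \<in> carrier R" "a \<in> carrier R" "h \<in> carrier R" using v(1) xh TC HC by auto
    have "s \<ominus> v \<otimes> x = (\<one> \<ominus> a \<otimes> v) \<otimes> s \<ominus> v \<otimes> h" unfolding xh(3) using cl s by algebra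
    moreover have "(\<one> \<ominus> a \<otimes> v) \<otimes> s \<in> H" using N.I_r_closed[OF v(2) s] H by blast
    ultimately have "s \<ominus> v \<otimes> x \<in> H" using Hadd(2)[OF _ HT[OF v(1) xh(1)]] by simp
    then show ?thesis using v(1) by blast
  qed
  with H show ?thesis by (intro exI[of _ H]) simp
qed

text \<open>A linear functional on \<open>R / N\<close> over the residue field of \<open>T\<close> which vanishes at \<open>1\<close> and takes
  the value \<open>1\<close> at \<open>x\<close>, given by representatives.\<close>

lemma ex_linear_functional:
  assumes T: "subring T R" and N: "ideal N R"
    and field: "\<forall>t \<in> T. t \<notin> N \<longrightarrow> (\<exists>v \<in> T. \<one> \<ominus> t \<otimes> v \<in> N)"
    and x: "x \<in> carrier R" "\<forall>t \<in> T. x \<ominus> t \<notin> N"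
  obtains \<phi> where "\<And>s. s \<in> carrier R \<Longrightarrow> \<phi> s \<in> T"
    "\<And>s r. s \<in> carrier R \<Longrightarrow> r \<in> carrier R \<Longrightarrow> \<phi> (s \<oplus> r) \<ominus> (\<phi> s \<oplus> \<phi> r) \<in> N"
    "\<And>t s. t \<in> T \<Longrightarrow> s \<in> carrier R \<Longrightarrow> \<phi> (t \<otimes> s) \<ominus> t \<otimes> \<phi> s \<in> N"
    "\<And>n. n \<in> N \<Longrightarrow> \<phi> n \<in> N" "\<phi> \<one> \<in> N" "\<phi> x \<ominus> \<one> \<in> N"
proof -
  note TD = subringE[OF T]
  interpret N: ideal N R by (rule N)
  have TC: "t \<in> carrier R" if "t \<in> T" for t using that TD(1) by auto
  obtain H where H: "subgroup H (add_monoid R)" "\<And>t h. t \<in> T \<Longrightarrow> h \<in> H \<Longrightarrow> t \<otimes> h \<in> H"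
    "T \<subseteq> H" "N \<subseteq> H" "x \<notin> H" and ex: "\<And>s. s \<in> carrier R \<Longrightarrow> \<exists>a \<in> T. s \<ominus> a \<otimes> x \<in> H"
    using ex_hyperplane[OF T N field x] by (elim exE conjE) blast
  have HC: "h \<in> carrier R" if "h \<in> H" for h using add_subgroup_props(1)[OF H(1)] that by auto
  note Hadd = add_subgroup_closed[OF H(1)]
  \<comment> \<open>The value is the coordinate of s along x modulo \<open>H\<close>. It is
    determined only modulo \<open>N\<close>, hence the laws below are congruences.\<close>
  define \<phi> where "\<phi> s = (SOME a. a \<in> T \<and> s \<ominus> a \<otimes> x \<in> H)" for s
  have \<phi>: "\<phi> s \<in> T" "s \<ominus> \<phi> s \<otimes> x \<in> H" if "s \<in> carrier R" for s
  proof -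
    have "\<exists>a. a \<in> T \<and> s \<ominus> a \<otimes> x \<in> H" using ex[OF that] by (simp add: Bex_def)
    then have "\<phi> s \<in> T \<and> s \<ominus> \<phi> s \<otimes> x \<in> H" unfolding \<phi>_def by (rule someI_ex)
    then show "\<phi> s \<in> T" "s \<ominus> \<phi> s \<otimes> x \<in> H" by auto
  qed
  \<comment> \<open>If two coordinates differed by some d outside \<open>N\<close>, then d x would
    be in \<open>H\<close>, and inverting d modulo \<open>N\<close> would put x itself into
    \<open>H\<close>.\<close>
  have uniq: "\<phi> s \<ominus> a \<in> N" if s: "s \<in> carrier R" and a: "a \<in> T" "s \<ominus> a \<otimes> x \<in> H" for s a
  proof (rule ccontr)
    assume n: "\<phi> s \<ominus> a \<notin> N"
    define d where "d = \<phi> s \<ominus> a"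
    have dT: "d \<in> T" unfolding d_def using subring_minus_closed[OF T \<phi>(1)[OF s] a(1)] .
    obtain v where v: "v \<in> T" "\<one> \<ominus> d \<otimes> v \<in> N" using field dT n unfolding d_def by blast
    have cl: "d \<in> carrier R" "v \<in> carrier R" "a \<in> carrier R" "\<phi> s \<in> carrier R"
      using dT v(1) a(1) \<phi>(1)[OF s] TC by auto
    have "d \<otimes> x = (s \<ominus> a \<otimes> x) \<ominus> (s \<ominus> \<phi> s \<otimes> x)"
      unfolding d_def using cl(3,4) s x(1) by algebra
    then have "d \<otimes> x \<in> H" using Hadd(2)[OF a(2) \<phi>(2)[OF s]] by simp
    then have "v \<otimes> (d \<otimes> x) \<in> H" using H(2) v(1) by blast
    moreover have "(\<one> \<ominus> d \<otimes> v) \<otimes> x \<in> H" using N.I_r_closed[OF v(2) x(1)] H(4) by blast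
    moreover have "x = (\<one> \<ominus> d \<otimes> v) \<otimes> x \<oplus> v \<otimes> (d \<otimes> x)" using cl x(1) by algebra
    ultimately show False using Hadd(1) H(5) by metis
  qed
  show ?thesis
  proof
    show "\<And>s. s \<in> carrier R \<Longrightarrow> \<phi> s \<in> T" by (rule \<phi>(1))
    show "\<phi> (s \<oplus> r) \<ominus> (\<phi> s \<oplus> \<phi> r) \<in> N" if sr: "s \<in> carrier R" "r \<in> carrier R" for s r
    proof (rule uniq)
      have cl: "\<phi> s \<in> carrier R" "\<phi> r \<in> carrier R" using \<phi>(1) sr TC by auto
      have "(s \<oplus> r) \<ominus> (\<phi> s \<oplus> \<phi> r) \<otimes> x = (s \<ominus> \<phi> s \<otimes> x) \<oplus> (r \<ominus> \<phi> r \<otimes> x)"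
        using cl sr x(1) by algebra
      then show "(s \<oplus> r) \<ominus> (\<phi> s \<oplus> \<phi> r) \<otimes> x \<in> H"
        using Hadd(1)[OF \<phi>(2)[OF sr(1)] \<phi>(2)[OF sr(2)]] by simp
    qed (use sr \<phi>(1) TD(7) in auto)
    show "\<phi> (t \<otimes> s) \<ominus> t \<otimes> \<phi> s \<in> N" if ts: "t \<in> T" "s \<in> carrier R" for t s
    proof (rule uniq)
      have cl: "\<phi> s \<in> carrier R" "t \<in> carrier R" using \<phi>(1) ts TC by auto
      have "(t \<otimes> s) \<ominus> (t \<otimes> \<phi> s) \<otimes> x = t \<otimes> (s \<ominus> \<phi> s \<otimes> x)"
        using cl ts(2) x(1) by algebra
      then show "(t \<otimes> s) \<ominus> (t \<otimes> \<phi> s) \<otimes> x \<in> H"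
        using H(2)[OF ts(1) \<phi>(2)[OF ts(2)]] by simp
    qed (use ts \<phi>(1) TD(6) TC in auto)
    have zero: "\<phi> h \<in> N" if h: "h \<in> H" for h
    proof -
      have hC: "h \<in> carrier R" by (rule HC[OF h])
      have "h \<ominus> \<zero> \<otimes> x = h" using hC x by (simp add: a_minus_def)
      then have "\<phi> h \<ominus> \<zero> \<in> N" using uniq[OF hC TD(2)] h by simp
      then show ?thesis using TC[OF \<phi>(1)[OF hC]] by (simp add: a_minus_def)
    qed
    show "\<And>n. n \<in> N \<Longrightarrow> \<phi> n \<in> N" using zero H(4) by blast
    show "\<phi> \<one> \<in> N" using zero H(3) TD(3) by blast
    have "x \<ominus> \<one> \<otimes> x = \<zero>" using x by (simp add: a_minus_def r_neg)
    then show "\<phi> x \<ominus> \<one> \<in> N"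
      using uniq[OF x(1) TD(3)] add_subgroup_props(2)[OF H(1)] by simp
  qed
qed

end

text \<open>The two canonical morphisms to \<open>(S/N) \<otimes> (S/N)\<close> over the residue field of \<open>T\<close>.  Instead of the
  tensor product we take the ring of pairs modulo the largest ideal on which the additive map
  \<open>a \<otimes> b \<mapsto> \<phi>(a) b\<close> vanishes, where \<open>\<phi>\<close> is a functional with \<open>\<phi>(1) = 0\<close> and \<open>\<phi>(x) = 1\<close>.\<close>

lemma ex_homs_separating:
  fixes S :: "('a, 'm) ring_scheme"
  assumes S: "cring S" and T: "subring T S" and N: "ideal N S"
    and field: "\<forall>t \<in> T. t \<notin> N \<longrightarrow> (\<exists>v \<in> T. \<one>\<^bsub>S\<^esub> \<ominus>\<^bsub>S\<^esub> t \<otimes>\<^bsub>S\<^esub> v \<in> N)"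
    and x: "x \<in> carrier S" "\<forall>t \<in> T. x \<ominus>\<^bsub>S\<^esub> t \<notin> N"
  shows "\<exists>(C :: ('a \<times> 'a \<Rightarrow>\<^sub>0 int) set ring) g h. cring C \<and> g \<in> ring_hom S C \<and> h \<in> ring_hom S C \<and>
    (\<forall>t \<in> T. g t = h t) \<and>
    (\<forall>a \<in> carrier S. a \<ominus>\<^bsub>S\<^esub> \<one>\<^bsub>S\<^esub> \<in> N \<longrightarrow> g a = \<one>\<^bsub>C\<^esub> \<and> h a = \<one>\<^bsub>C\<^esub>) \<and> g x \<noteq> h x"
proof -
  interpret S: cring S by (rule S)
  interpret N: ideal N S by (rule N)
  let ?P = "pair_ring S"
  interpret P: cring ?P by (rule pair_ring_cring[OF S])
  note TD = subringE[OF T]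
  obtain \<phi> where \<phi>T: "\<And>s. s \<in> carrier S \<Longrightarrow> \<phi> s \<in> T"
    and \<phi>add: "\<And>s r. s \<in> carrier S \<Longrightarrow> r \<in> carrier S \<Longrightarrow> \<phi> (s \<oplus>\<^bsub>S\<^esub> r) \<ominus>\<^bsub>S\<^esub> (\<phi> s \<oplus>\<^bsub>S\<^esub> \<phi> r) \<in> N"
    and \<phi>mult: "\<And>t s. t \<in> T \<Longrightarrow> s \<in> carrier S \<Longrightarrow> \<phi> (t \<otimes>\<^bsub>S\<^esub> s) \<ominus>\<^bsub>S\<^esub> t \<otimes>\<^bsub>S\<^esub> \<phi> s \<in> N"
    and \<phi>N: "\<And>n. n \<in> N \<Longrightarrow> \<phi> n \<in> N" and \<phi>1: "\<phi> \<one>\<^bsub>S\<^esub> \<in> N" and \<phi>x: "\<phi> x \<ominus>\<^bsub>S\<^esub> \<one>\<^bsub>S\<^esub> \<in> N"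
    using S.ex_linear_functional[OF T N field x] by blast
  have \<phi>C: "\<phi> s \<in> carrier S" if "s \<in> carrier S" for s using \<phi>T[OF that] TD(1) by auto
  \<comment> \<open>The functional respects sums only modulo \<open>N\<close>. On the free group it
    can still be applied to first components, since nothing has to be respected there.\<close>
  define E where "E = frag_extend (\<lambda>(a, b). frag_of (\<phi> a, b :: 'a))"
  have E_of: "E (frag_of (a, b)) = frag_of (\<phi> a, b)" for a b by (simp add: E_def)
  have E_diff: "E (p - q) = E p - E q" for p q by (simp add: E_def frag_extend_diff)
  have E_add: "E (p + q) = E p + E q" for p q by (simp add: E_def frag_extend_add)
  have E_cl: "E p \<in> carrier ?P" if "p \<in> carrier ?P" for p
  proof -
    have "Poly_Mapping.keys (E p) \<subseteq> (\<Union>z \<in> Poly_Mapping.keys p. {(\<phi> (fst z), snd z)})"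
      unfolding E_def by (rule order_trans[OF keys_frag_extend]) (auto simp: split_beta)
    also have "\<dots> \<subseteq> carrier S \<times> carrier S" using that \<phi>C by (auto simp: pair_ring_carrier)
    finally show ?thesis by (simp add: pair_ring_carrier)
  qed
  define \<Lambda> where "\<Lambda> p = pair_mult S (E p)" for p
  have \<Lambda>_of: "\<Lambda> (frag_of (a, b)) = \<phi> a \<otimes>\<^bsub>S\<^esub> b" if "a \<in> carrier S" "b \<in> carrier S" for a b
    unfolding \<Lambda>_def E_of using that \<phi>C by (intro pair_mult_of[OF S])
  have \<Lambda>_diff: "\<Lambda> (p - q) = \<Lambda> p \<ominus>\<^bsub>S\<^esub> \<Lambda> q" if "p \<in> carrier ?P" "q \<in> carrier ?P" for p q
    unfolding \<Lambda>_def E_diff using that E_cl by (intro pair_mult_diff[OF S])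
  have \<Lambda>_add: "\<Lambda> (p \<oplus>\<^bsub>?P\<^esub> q) = \<Lambda> p \<oplus>\<^bsub>S\<^esub> \<Lambda> q" if "p \<in> carrier ?P" "q \<in> carrier ?P" for p q
    unfolding pair_ring_add \<Lambda>_def E_add using that E_cl by (intro pair_mult_add(2)[OF S])
  have Nminus: "a \<ominus>\<^bsub>S\<^esub> b \<in> N" if "a \<in> N" "b \<in> N" for a b
    using that by (simp add: a_minus_def)
  \<comment> \<open>\<open>\<Lambda>\<close> is merely additive, so the elements with value in
    \<open>N\<close> need not form an ideal. Imposing the condition on all multiples gives one, and
    the multiple by 1 recovers the value itself.\<close>
  define I where "I = {p \<in> carrier ?P. \<forall>q \<in> carrier ?P. \<Lambda> (q \<otimes>\<^bsub>?P\<^esub> p) \<in> N}"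
  have I: "ideal I ?P"
  proof (rule idealI[OF P.ring_axioms])
    show "subgroup I (add_monoid ?P)"
    proof (rule P.add.subgroupI)
      show "I \<subseteq> carrier ?P" by (auto simp: I_def)
      have "\<Lambda> \<zero>\<^bsub>?P\<^esub> = \<zero>\<^bsub>S\<^esub>" unfolding pair_ring_zero \<Lambda>_def E_def by (simp add: pair_mult_def)
      then have "\<zero>\<^bsub>?P\<^esub> \<in> I" by (simp add: I_def)
      then show "I \<noteq> {}" by blast
      fix p assume p: "p \<in> I"
      then have pC: "p \<in> carrier ?P" by (simp add: I_def)
      have "\<Lambda> (q \<otimes>\<^bsub>?P\<^esub> (\<ominus>\<^bsub>?P\<^esub> p)) \<in> N" if q: "q \<in> carrier ?P" for q
      proof -
        have "q \<otimes>\<^bsub>?P\<^esub> (\<ominus>\<^bsub>?P\<^esub> p) = (\<ominus>\<^bsub>?P\<^esub> q) \<otimes>\<^bsub>?P\<^esub> p"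
          using q pC by (simp add: P.l_minus P.r_minus)
        then show ?thesis using p q by (simp add: I_def)
      qed
      then show "\<ominus>\<^bsub>?P\<^esub> p \<in> I" using pC by (simp add: I_def)
      fix r assume r: "r \<in> I"
      then have rC: "r \<in> carrier ?P" by (simp add: I_def)
      have "\<Lambda> (q \<otimes>\<^bsub>?P\<^esub> (p \<oplus>\<^bsub>?P\<^esub> r)) \<in> N" if q: "q \<in> carrier ?P" for q
      proof -
        have "\<Lambda> (q \<otimes>\<^bsub>?P\<^esub> (p \<oplus>\<^bsub>?P\<^esub> r)) = \<Lambda> (q \<otimes>\<^bsub>?P\<^esub> p) \<oplus>\<^bsub>S\<^esub> \<Lambda> (q \<otimes>\<^bsub>?P\<^esub> r)"
          unfolding P.r_distr[OF pC rC q]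
          using P.m_closed[OF q pC] P.m_closed[OF q rC] by (rule \<Lambda>_add)
        then show ?thesis using p r q by (simp add: I_def)
      qed
      then show "p \<oplus>\<^bsub>?P\<^esub> r \<in> I" using pC rC by (simp add: I_def)
    qed
    fix p r assume p: "p \<in> I" and r: "r \<in> carrier ?P"
    then have pC: "p \<in> carrier ?P" by (simp add: I_def)
    have "\<Lambda> (q \<otimes>\<^bsub>?P\<^esub> (r \<otimes>\<^bsub>?P\<^esub> p)) \<in> N" if q: "q \<in> carrier ?P" for q
      unfolding P.m_assoc[OF q r pC, symmetric] using p P.m_closed[OF q r] by (simp add: I_def)
    then show 1: "r \<otimes>\<^bsub>?P\<^esub> p \<in> I" using pC r by (simp add: I_def)
    show "p \<otimes>\<^bsub>?P\<^esub> r \<in> I" unfolding P.m_comm[OF pC r] by (rule 1)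
  qed
  interpret I: ideal I ?P by (rule I)
  have I_I: "p \<in> I" if p: "p \<in> carrier ?P"
    and of: "\<And>a b. a \<in> carrier S \<Longrightarrow> b \<in> carrier S \<Longrightarrow> \<Lambda> (frag_of (a, b) \<otimes>\<^bsub>?P\<^esub> p) \<in> N" for p
  proof -
    have "\<Lambda> (q \<otimes>\<^bsub>?P\<^esub> p) \<in> N" if "q \<in> carrier ?P" for q
    proof -
      from that have "Poly_Mapping.keys q \<subseteq> carrier S \<times> carrier S" by (simp add: pair_ring_carrier)
      then have "q \<in> carrier ?P \<and> \<Lambda> (q \<otimes>\<^bsub>?P\<^esub> p) \<in> N"
      proof (induction q rule: frag_induction)
        case zero
        have "\<Lambda> 0 = \<zero>\<^bsub>S\<^esub>" unfolding \<Lambda>_def E_def by (simp add: pair_mult_def)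
        then show ?case by (simp add: pair_ring_mult_0 pair_ring_carrier)
      next
        case (one z)
        then show ?case using of by (cases z) (auto simp: pair_ring_of_closed)
      next
        case (diff q r)
        then have cl: "q \<in> carrier ?P" "r \<in> carrier ?P"
          and IH: "\<Lambda> (q \<otimes>\<^bsub>?P\<^esub> p) \<in> N" "\<Lambda> (r \<otimes>\<^bsub>?P\<^esub> p) \<in> N" by blast+
        have "\<Lambda> ((q - r) \<otimes>\<^bsub>?P\<^esub> p) = \<Lambda> (q \<otimes>\<^bsub>?P\<^esub> p) \<ominus>\<^bsub>S\<^esub> \<Lambda> (r \<otimes>\<^bsub>?P\<^esub> p)"
          unfolding pair_ring_mult_diff
          using P.m_closed[OF cl(1) p] P.m_closed[OF cl(2) p] by (rule \<Lambda>_diff)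
        moreover have "q - r \<in> carrier ?P"
          using P.minus_closed[OF cl] pair_ring_minus[OF S cl] by simp
        ultimately show ?case using Nminus[OF IH] by simp
      qed
      then show ?thesis by simp
    qed
    then show ?thesis unfolding I_def using p by blast
  qed
  have of_cl: "frag_of (a, b) \<in> carrier ?P" if "a \<in> carrier S" "b \<in> carrier S" for a b
    using that by (rule pair_ring_of_closed)
  have sub_cl: "p - q \<in> carrier ?P" if "p \<in> carrier ?P" "q \<in> carrier ?P" for p q
    using P.minus_closed[OF that] pair_ring_minus[OF S that] by simp
  have left_add: "frag_of (s \<oplus>\<^bsub>S\<^esub> r, \<one>\<^bsub>S\<^esub>) - frag_of (s, \<one>\<^bsub>S\<^esub>) - frag_of (r, \<one>\<^bsub>S\<^esub>) \<in> I"
    if sr: "s \<in> carrier S" "r \<in> carrier S" for s r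
  proof (rule I_I)
    fix a b assume ab: "a \<in> carrier S" "b \<in> carrier S"
    have cl: "\<phi> (a \<otimes>\<^bsub>S\<^esub> s) \<in> carrier S" "\<phi> (a \<otimes>\<^bsub>S\<^esub> r) \<in> carrier S"
      "\<phi> (a \<otimes>\<^bsub>S\<^esub> s \<oplus>\<^bsub>S\<^esub> a \<otimes>\<^bsub>S\<^esub> r) \<in> carrier S" using ab sr \<phi>C by auto
    have "\<Lambda> (frag_of (a, b) \<otimes>\<^bsub>?P\<^esub> (frag_of (s \<oplus>\<^bsub>S\<^esub> r, \<one>\<^bsub>S\<^esub>) - frag_of (s, \<one>\<^bsub>S\<^esub>) - frag_of (r, \<one>\<^bsub>S\<^esub>))) =
        \<phi> (a \<otimes>\<^bsub>S\<^esub> s \<oplus>\<^bsub>S\<^esub> a \<otimes>\<^bsub>S\<^esub> r) \<otimes>\<^bsub>S\<^esub> b \<ominus>\<^bsub>S\<^esub> \<phi> (a \<otimes>\<^bsub>S\<^esub> s) \<otimes>\<^bsub>S\<^esub> b \<ominus>\<^bsub>S\<^esub> \<phi> (a \<otimes>\<^bsub>S\<^esub> r) \<otimes>\<^bsub>S\<^esub> b"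
      using ab sr by (simp add: pair_ring_mult_diff pair_ring_mult_of \<Lambda>_diff \<Lambda>_of of_cl sub_cl S.r_distr)
    also have "\<dots> = (\<phi> (a \<otimes>\<^bsub>S\<^esub> s \<oplus>\<^bsub>S\<^esub> a \<otimes>\<^bsub>S\<^esub> r) \<ominus>\<^bsub>S\<^esub> (\<phi> (a \<otimes>\<^bsub>S\<^esub> s) \<oplus>\<^bsub>S\<^esub> \<phi> (a \<otimes>\<^bsub>S\<^esub> r))) \<otimes>\<^bsub>S\<^esub> b"
      using cl ab(2) by algebra
    also have "\<dots> \<in> N"
      using ab sr by (intro N.I_r_closed \<phi>add) auto
    finally show "\<Lambda> (frag_of (a, b) \<otimes>\<^bsub>?P\<^esub>
      (frag_of (s \<oplus>\<^bsub>S\<^esub> r, \<one>\<^bsub>S\<^esub>) - frag_of (s, \<one>\<^bsub>S\<^esub>) - frag_of (r, \<one>\<^bsub>S\<^esub>))) \<in> N" .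
  qed (use sr in \<open>simp add: of_cl sub_cl\<close>)
  have right_add: "frag_of (\<one>\<^bsub>S\<^esub>, s \<oplus>\<^bsub>S\<^esub> r) - frag_of (\<one>\<^bsub>S\<^esub>, s) - frag_of (\<one>\<^bsub>S\<^esub>, r) \<in> I"
    if sr: "s \<in> carrier S" "r \<in> carrier S" for s r
  proof (rule I_I)
    fix a b assume ab: "a \<in> carrier S" "b \<in> carrier S"
    have cl: "\<phi> a \<in> carrier S" using ab \<phi>C by auto
    have "\<Lambda> (frag_of (a, b) \<otimes>\<^bsub>?P\<^esub> (frag_of (\<one>\<^bsub>S\<^esub>, s \<oplus>\<^bsub>S\<^esub> r) - frag_of (\<one>\<^bsub>S\<^esub>, s) - frag_of (\<one>\<^bsub>S\<^esub>, r))) =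
        \<phi> a \<otimes>\<^bsub>S\<^esub> (b \<otimes>\<^bsub>S\<^esub> (s \<oplus>\<^bsub>S\<^esub> r)) \<ominus>\<^bsub>S\<^esub> \<phi> a \<otimes>\<^bsub>S\<^esub> (b \<otimes>\<^bsub>S\<^esub> s) \<ominus>\<^bsub>S\<^esub> \<phi> a \<otimes>\<^bsub>S\<^esub> (b \<otimes>\<^bsub>S\<^esub> r)"
      using ab sr by (simp add: pair_ring_mult_diff pair_ring_mult_of \<Lambda>_diff \<Lambda>_of of_cl sub_cl)
    also have "\<dots> = \<zero>\<^bsub>S\<^esub>"
      using cl ab(2) sr by algebra
    finally show "\<Lambda> (frag_of (a, b) \<otimes>\<^bsub>?P\<^esub>
      (frag_of (\<one>\<^bsub>S\<^esub>, s \<oplus>\<^bsub>S\<^esub> r) - frag_of (\<one>\<^bsub>S\<^esub>, s) - frag_of (\<one>\<^bsub>S\<^esub>, r))) \<in> N" by simp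
  qed (use sr in \<open>simp add: of_cl sub_cl\<close>)
  have base: "frag_of (t, \<one>\<^bsub>S\<^esub>) - frag_of (\<one>\<^bsub>S\<^esub>, t) \<in> I" if t: "t \<in> T" for t
  proof (rule I_I)
    have tC: "t \<in> carrier S" using t TD(1) by auto
    show "frag_of (t, \<one>\<^bsub>S\<^esub>) - frag_of (\<one>\<^bsub>S\<^esub>, t) \<in> carrier ?P" using tC by (simp add: of_cl sub_cl)
    fix a b assume ab: "a \<in> carrier S" "b \<in> carrier S"
    have cl: "\<phi> a \<in> carrier S" "\<phi> (t \<otimes>\<^bsub>S\<^esub> a) \<in> carrier S" using ab tC \<phi>C by auto
    have "\<Lambda> (frag_of (a, b) \<otimes>\<^bsub>?P\<^esub> (frag_of (t, \<one>\<^bsub>S\<^esub>) - frag_of (\<one>\<^bsub>S\<^esub>, t))) =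
        \<phi> (t \<otimes>\<^bsub>S\<^esub> a) \<otimes>\<^bsub>S\<^esub> b \<ominus>\<^bsub>S\<^esub> \<phi> a \<otimes>\<^bsub>S\<^esub> (b \<otimes>\<^bsub>S\<^esub> t)"
      using ab tC by (simp add: pair_ring_mult_diff pair_ring_mult_of \<Lambda>_diff \<Lambda>_of of_cl sub_cl S.m_comm)
    also have "\<dots> = (\<phi> (t \<otimes>\<^bsub>S\<^esub> a) \<ominus>\<^bsub>S\<^esub> t \<otimes>\<^bsub>S\<^esub> \<phi> a) \<otimes>\<^bsub>S\<^esub> b"
      using cl ab(2) tC by algebra
    also have "\<dots> \<in> N" using ab t by (intro N.I_r_closed \<phi>mult) auto
    finally show "\<Lambda> (frag_of (a, b) \<otimes>\<^bsub>?P\<^esub> (frag_of (t, \<one>\<^bsub>S\<^esub>) - frag_of (\<one>\<^bsub>S\<^esub>, t))) \<in> N" .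
  qed
  \<comment> \<open>This and \<open>right_one\<close> make both morphisms send elements congruent to
    1 modulo \<open>N\<close> to 1, so that invertibility modulo \<open>N\<close> passes to the
    target ring.\<close>
  have left_one: "frag_of (s, \<one>\<^bsub>S\<^esub>) - frag_of (\<one>\<^bsub>S\<^esub>, \<one>\<^bsub>S\<^esub>) \<in> I"
    if s: "s \<in> carrier S" "s \<ominus>\<^bsub>S\<^esub> \<one>\<^bsub>S\<^esub> \<in> N" for s
  proof (rule I_I)
    fix a b assume ab: "a \<in> carrier S" "b \<in> carrier S"
    define n where "n = a \<otimes>\<^bsub>S\<^esub> (s \<ominus>\<^bsub>S\<^esub> \<one>\<^bsub>S\<^esub>)"
    have n: "n \<in> N" unfolding n_def using s(2) ab(1) by (rule N.I_l_closed)
    have nC: "n \<in> carrier S" using n by (rule N.Icarr)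
    have as: "a \<otimes>\<^bsub>S\<^esub> s = a \<oplus>\<^bsub>S\<^esub> n" unfolding n_def using ab s(1) by algebra
    have cl: "\<phi> a \<in> carrier S" "\<phi> n \<in> carrier S" "\<phi> (a \<oplus>\<^bsub>S\<^esub> n) \<in> carrier S" using ab nC \<phi>C by auto
    have "\<Lambda> (frag_of (a, b) \<otimes>\<^bsub>?P\<^esub> (frag_of (s, \<one>\<^bsub>S\<^esub>) - frag_of (\<one>\<^bsub>S\<^esub>, \<one>\<^bsub>S\<^esub>))) =
        \<phi> (a \<oplus>\<^bsub>S\<^esub> n) \<otimes>\<^bsub>S\<^esub> b \<ominus>\<^bsub>S\<^esub> \<phi> a \<otimes>\<^bsub>S\<^esub> b"
      using ab s(1) nC by (simp add: pair_ring_mult_diff pair_ring_mult_of \<Lambda>_diff \<Lambda>_of of_cl sub_cl as)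
    also have "\<dots> = ((\<phi> (a \<oplus>\<^bsub>S\<^esub> n) \<ominus>\<^bsub>S\<^esub> (\<phi> a \<oplus>\<^bsub>S\<^esub> \<phi> n)) \<oplus>\<^bsub>S\<^esub> \<phi> n) \<otimes>\<^bsub>S\<^esub> b"
      using cl ab(2) by algebra
    also have "\<dots> \<in> N" using ab nC n by (intro N.I_r_closed N.a_closed \<phi>add \<phi>N) auto
    finally show "\<Lambda> (frag_of (a, b) \<otimes>\<^bsub>?P\<^esub> (frag_of (s, \<one>\<^bsub>S\<^esub>) - frag_of (\<one>\<^bsub>S\<^esub>, \<one>\<^bsub>S\<^esub>))) \<in> N" .
  qed (use s in \<open>simp add: of_cl sub_cl\<close>)
  have right_one: "frag_of (\<one>\<^bsub>S\<^esub>, s) - frag_of (\<one>\<^bsub>S\<^esub>, \<one>\<^bsub>S\<^esub>) \<in> I"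
    if s: "s \<in> carrier S" "s \<ominus>\<^bsub>S\<^esub> \<one>\<^bsub>S\<^esub> \<in> N" for s
  proof (rule I_I)
    fix a b assume ab: "a \<in> carrier S" "b \<in> carrier S"
    have cl: "\<phi> a \<in> carrier S" using ab \<phi>C by auto
    have "\<Lambda> (frag_of (a, b) \<otimes>\<^bsub>?P\<^esub> (frag_of (\<one>\<^bsub>S\<^esub>, s) - frag_of (\<one>\<^bsub>S\<^esub>, \<one>\<^bsub>S\<^esub>))) =
        \<phi> a \<otimes>\<^bsub>S\<^esub> (b \<otimes>\<^bsub>S\<^esub> s) \<ominus>\<^bsub>S\<^esub> \<phi> a \<otimes>\<^bsub>S\<^esub> b"
      using ab s(1) by (simp add: pair_ring_mult_diff pair_ring_mult_of \<Lambda>_diff \<Lambda>_of of_cl sub_cl)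
    also have "\<dots> = (\<phi> a \<otimes>\<^bsub>S\<^esub> b) \<otimes>\<^bsub>S\<^esub> (s \<ominus>\<^bsub>S\<^esub> \<one>\<^bsub>S\<^esub>)"
      using cl ab(2) s(1) by algebra
    also have "\<dots> \<in> N" using ab cl s(2) by (intro N.I_l_closed) auto
    finally show "\<Lambda> (frag_of (a, b) \<otimes>\<^bsub>?P\<^esub> (frag_of (\<one>\<^bsub>S\<^esub>, s) - frag_of (\<one>\<^bsub>S\<^esub>, \<one>\<^bsub>S\<^esub>))) \<in> N" .
  qed (use s in \<open>simp add: of_cl sub_cl\<close>)
  \<comment> \<open>The value of x \<otimes> 1 - 1 \<otimes> x is \<phi>(x) - \<phi>(1) x, which is
    congruent to 1 modulo \<open>N\<close>. So 1 would be in \<open>N\<close>, although x - t is not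
    for t = 0.\<close>
  have sep: "frag_of (x, \<one>\<^bsub>S\<^esub>) - frag_of (\<one>\<^bsub>S\<^esub>, x) \<notin> I"
  proof
    let ?d = "frag_of (x, \<one>\<^bsub>S\<^esub>) - frag_of (\<one>\<^bsub>S\<^esub>, x)"
    assume d: "?d \<in> I"
    then have "\<Lambda> (\<one>\<^bsub>?P\<^esub> \<otimes>\<^bsub>?P\<^esub> ?d) \<in> N" unfolding I_def using P.one_closed by blast
    moreover have "\<one>\<^bsub>?P\<^esub> \<otimes>\<^bsub>?P\<^esub> ?d = ?d" using I.Icarr[OF d] by simp
    moreover have "\<Lambda> ?d = \<phi> x \<ominus>\<^bsub>S\<^esub> \<phi> \<one>\<^bsub>S\<^esub> \<otimes>\<^bsub>S\<^esub> x"
      using x(1) \<phi>C by (simp add: \<Lambda>_diff \<Lambda>_of of_cl)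
    ultimately have 1: "\<phi> x \<ominus>\<^bsub>S\<^esub> \<phi> \<one>\<^bsub>S\<^esub> \<otimes>\<^bsub>S\<^esub> x \<in> N" by simp
    have cl: "\<phi> x \<in> carrier S" "\<phi> \<one>\<^bsub>S\<^esub> \<in> carrier S" using x(1) \<phi>C by auto
    have "\<one>\<^bsub>S\<^esub> = (\<phi> x \<ominus>\<^bsub>S\<^esub> \<phi> \<one>\<^bsub>S\<^esub> \<otimes>\<^bsub>S\<^esub> x) \<oplus>\<^bsub>S\<^esub> \<phi> \<one>\<^bsub>S\<^esub> \<otimes>\<^bsub>S\<^esub> x \<ominus>\<^bsub>S\<^esub> (\<phi> x \<ominus>\<^bsub>S\<^esub> \<one>\<^bsub>S\<^esub>)"
      using cl x(1) by algebra
    also have "\<dots> \<in> N" by (rule Nminus[OF N.a_closed[OF 1 N.I_r_closed[OF \<phi>1 x(1)]] \<phi>x])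
    finally have "N = carrier S" by (rule N.one_imp_carrier)
    then show False using x TD(1,2) by (meson S.minus_closed subsetD)
  qed
  define g where "g = (\<lambda>s. I +>\<^bsub>?P\<^esub> frag_of (s, \<one>\<^bsub>S\<^esub>))"
  define h where "h = (\<lambda>s. I +>\<^bsub>?P\<^esub> frag_of (\<one>\<^bsub>S\<^esub>, s))"
  have one: "\<one>\<^bsub>?P Quot I\<^esub> = I +>\<^bsub>?P\<^esub> frag_of (\<one>\<^bsub>S\<^esub>, \<one>\<^bsub>S\<^esub>)"
    using ring_hom_one[OF I.rcos_ring_hom] by (simp add: pair_ring_one)
  have "cring (?P Quot I)" by (rule I.quotient_is_cring[OF P.cring_axioms])
  moreover have "g \<in> ring_hom S (?P Quot I)"
    unfolding g_def by (rule pair_ring_left_hom[OF S I left_add])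
  moreover have "h \<in> ring_hom S (?P Quot I)"
    unfolding h_def by (rule pair_ring_right_hom[OF S I right_add])
  moreover have "g t = h t" if "t \<in> T" for t
  proof -
    have "t \<in> carrier S" using that TD(1) by auto
    then show ?thesis
      unfolding g_def h_def using base[OF that]
      by (subst pair_ring_coset_eq_iff[OF S I]) (auto simp: of_cl)
  qed
  moreover have "g a = \<one>\<^bsub>?P Quot I\<^esub>" "h a = \<one>\<^bsub>?P Quot I\<^esub>"
    if "a \<in> carrier S" "a \<ominus>\<^bsub>S\<^esub> \<one>\<^bsub>S\<^esub> \<in> N" for a
    unfolding one g_def h_def using left_one[OF that] right_one[OF that] that(1)
    by (auto simp: pair_ring_coset_eq_iff[OF S I] of_cl)
  moreover have "g x \<noteq> h x"
    unfolding g_def h_def using sep x(1)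
    by (subst pair_ring_coset_eq_iff[OF S I]) (auto simp: of_cl)
  ultimately show ?thesis by (intro exI[of _ "?P Quot I"] exI[of _ g] exI[of _ h]) simp
qed

section \<open>From local epimorphisms to u-elementary towers\<close>

text \<open>Otherwise everything outside \<open>Q\<close> is invertible modulo \<open>N\<close>, so
  the two morphisms of \<open>ex_homs_separating\<close> send it to units and extend to the
  localization of S at \<open>Q\<close>. They agree on the image of the localization of R because R
  \<subseteq> T, but differ at x.\<close>

lemma locally_epi_ex_nonunit:
  fixes S :: "('a, 'm) ring_scheme"
  assumes S: "cring S" and R: "subring R S" and epi: "locally_epi (S\<lparr>carrier := R\<rparr>) S id"
    and T: "subring T S" "R \<subseteq> T" and N: "ideal N S"
    and field: "\<forall>t \<in> T. t \<notin> N \<longrightarrow> (\<exists>v \<in> T. \<one>\<^bsub>S\<^esub> \<ominus>\<^bsub>S\<^esub> t \<otimes>\<^bsub>S\<^esub> v \<in> N)"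
    and x: "x \<in> carrier S" "\<forall>t \<in> T. x \<ominus>\<^bsub>S\<^esub> t \<notin> N" and Q: "primeideal Q S"
  shows "\<exists>s \<in> carrier S - Q. \<forall>r \<in> carrier S. s \<otimes>\<^bsub>S\<^esub> r \<ominus>\<^bsub>S\<^esub> \<one>\<^bsub>S\<^esub> \<notin> N"
proof (rule ccontr)
  assume "\<not> ?thesis"
  then have inv: "\<exists>r \<in> carrier S. s \<otimes>\<^bsub>S\<^esub> r \<ominus>\<^bsub>S\<^esub> \<one>\<^bsub>S\<^esub> \<in> N" if "s \<in> carrier S - Q" for s
    using that by blast
  interpret S: cring S by (rule S)
  obtain C :: "('a \<times> 'a \<Rightarrow>\<^sub>0 int) set ring" and g h
    where C: "cring C" and g: "g \<in> ring_hom S C" and h: "h \<in> ring_hom S C"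
      and eqT: "\<forall>t \<in> T. g t = h t"
      and one: "\<forall>a \<in> carrier S. a \<ominus>\<^bsub>S\<^esub> \<one>\<^bsub>S\<^esub> \<in> N \<longrightarrow> g a = \<one>\<^bsub>C\<^esub> \<and> h a = \<one>\<^bsub>C\<^esub>" and neq: "g x \<noteq> h x"
    using ex_homs_separating[OF S T(1) N field x] by (elim exE conjE)
  interpret C: cring C by (rule C)
  interpret g: ring_hom_cring S C g using S C g by (intro UnivPoly.ring_hom_cringI)
  interpret h: ring_hom_cring S C h using S C h by (intro UnivPoly.ring_hom_cringI)
  have units: "g s \<in> Units C" "h s \<in> Units C" if s: "s \<in> carrier S - Q" for s
  proof -
    have sC: "s \<in> carrier S" using s by simp
    obtain r where r: "r \<in> carrier S" "s \<otimes>\<^bsub>S\<^esub> r \<ominus>\<^bsub>S\<^esub> \<one>\<^bsub>S\<^esub> \<in> N" using inv[OF s] by blast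
    then have 1: "g (s \<otimes>\<^bsub>S\<^esub> r) = \<one>\<^bsub>C\<^esub>" "h (s \<otimes>\<^bsub>S\<^esub> r) = \<one>\<^bsub>C\<^esub>"
      using one sC by auto
    have "g s \<otimes>\<^bsub>C\<^esub> g r = \<one>\<^bsub>C\<^esub>" "h s \<otimes>\<^bsub>C\<^esub> h r = \<one>\<^bsub>C\<^esub>"
      using 1 sC r(1) by simp_all
    then show "g s \<in> Units C" "h s \<in> Units C"
      using sC r(1) C.m_comm[of "g s" "g r"] C.m_comm[of "h s" "h r"]
      unfolding Units_def by (auto intro: bexI[of _ "g r"] bexI[of _ "h r"])
  qed
  obtain G where G: "G \<in> ring_hom (localization S Q) C"
    and Gf: "\<And>a s. a \<in> carrier S \<Longrightarrow> s \<in> carrier S - Q \<Longrightarrow>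
      G (fraction S Q a s) = g a \<otimes>\<^bsub>C\<^esub> inv\<^bsub>C\<^esub> (g s)"
    using localization_lift[OF S Q C g units(1)] by blast
  obtain H where H: "H \<in> ring_hom (localization S Q) C"
    and Hf: "\<And>a s. a \<in> carrier S \<Longrightarrow> s \<in> carrier S - Q \<Longrightarrow>
      H (fraction S Q a s) = h a \<otimes>\<^bsub>C\<^esub> inv\<^bsub>C\<^esub> (h s)"
    using localization_lift[OF S Q C h units(2)] by blast
  let ?A = "S\<lparr>carrier := R\<rparr>"
  define P where "P = {a \<in> carrier ?A. id a \<in> Q}"
  have A: "cring ?A" by (rule subring_cring[OF S R])
  have idhom: "id \<in> ring_hom ?A S" by (rule subring_id_hom[OF R])
  have P: "primeideal P ?A"
    unfolding P_def
    using ring_hom_ring.primeideal_vimage[OF ring_hom_ringI2 A Q] A S idhom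
    by (simp add: cring.axioms del: id_apply)
  have loc: "cring_epi (localization ?A P) (localization S Q) (localization_map S Q id)"
    using epi Q unfolding locally_epi_def P_def by blast
  note one_den = denominator_one[OF S Q]
  have "G (fraction S Q x \<one>\<^bsub>S\<^esub>) = H (fraction S Q x \<one>\<^bsub>S\<^esub>)"
  \<comment> \<open>\<open>C\<close> lives over another type than the test rings of
    \<open>cring_epi\<close>.\<close>
  proof (rule cring_epi_cancel[OF loc localization_cring[OF S Q] C G H])
    show "fraction S Q x \<one>\<^bsub>S\<^esub> \<in> carrier (localization S Q)"
      by (rule localization_carrierI[OF S Q x(1) one_den])
    fix c assume "c \<in> carrier (localization ?A P)"
    then obtain a s where c: "c = fraction ?A P a s" "a \<in> carrier ?A" "s \<in> carrier ?A - P"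
      by (rule localization_carrierE[OF A P])
    have map: "localization_map S Q id c = fraction S Q a s"
      using localization_map_fraction[where f = id, OF A S idhom Q P_def c(2,3)] c(1) by simp
    have as: "a \<in> carrier S" "s \<in> carrier S - Q" "a \<in> T" "s \<in> T"
      using c(2,3) subringE(1)[OF R] T(2) by (auto simp: P_def)
    show "G (localization_map S Q id c) = H (localization_map S Q id c)"
      unfolding map Gf[OF as(1,2)] Hf[OF as(1,2)] using eqT as(3,4) by simp
  qed
  then have "g x \<otimes>\<^bsub>C\<^esub> inv\<^bsub>C\<^esub> \<one>\<^bsub>C\<^esub> = h x \<otimes>\<^bsub>C\<^esub> inv\<^bsub>C\<^esub> \<one>\<^bsub>C\<^esub>"
    unfolding Gf[OF x(1) one_den] Hf[OF x(1) one_den] by simp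
  then show False using neq x(1) by simp
qed

lemma (in primeideal) power_mult_in_primeD:
  assumes "s \<in> carrier R" "a \<in> carrier R" "s \<notin> I" "s [^] (n::nat) \<otimes> a \<in> I"
  shows "a \<in> I"
  using assms(4)
proof (induction n)
  case 0
  then show ?case using assms(2) by simp
next
  case (Suc n)
  have "s [^] n \<otimes> a \<in> carrier R" using assms(1,2) by simp
  moreover have "s \<otimes> (s [^] n \<otimes> a) \<in> I"
    using Suc.prems assms(1,2) by (simp add: m_ac)
  ultimately show ?case using I_prime[OF assms(1)] assms(3) Suc.IH by blast
qed

lemma locally_epi_ex_u_elementary_element:
  fixes S :: "('a, 'm) ring_scheme"
  assumes S: "cring S" and R: "subring R S" and int: "integral_extension S R" and fcp: "FCP S R"
    and epi: "locally_epi (S\<lparr>carrier := R\<rparr>) S id"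
    and T: "T \<in> subalgebras S R" and neq: "T \<noteq> carrier S"
  shows "\<exists>b \<in> carrier S - T. b \<otimes>\<^bsub>S\<^esub> b \<ominus>\<^bsub>S\<^esub> b \<in> T \<and>
    b \<otimes>\<^bsub>S\<^esub> b \<otimes>\<^bsub>S\<^esub> b \<ominus>\<^bsub>S\<^esub> b \<otimes>\<^bsub>S\<^esub> b \<in> T"
proof -
  interpret cring S by (rule S)
  have Ts: "subring T S" "R \<subseteq> T" using T by (auto simp: subalgebras_def)
  note TD = subringE[OF Ts(1)] and TG = subring_add_subgroup[OF Ts(1)]
  have TC: "t \<in> carrier S" if "t \<in> T" for t using that TD(1) by auto
  interpret C: ideal "conductor T" S by (rule ideal_conductor[OF Ts(1)])
  have "\<one>\<^bsub>S\<^esub> \<notin> conductor T"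
  proof
    assume "\<one>\<^bsub>S\<^esub> \<in> conductor T"
    then have "carrier S \<subseteq> T" using C.one_imp_carrier conductor_subset[OF Ts(1)] by simp
    then show False using neq TD(1) by simp
  qed
  then obtain Q where Q: "maximalideal Q S" "conductor T \<subseteq> Q"
    by (rule ex_maximalideal_superset[OF C.is_ideal])
  have Qp: "primeideal Q S" by (rule maximalideal_prime[OF Q(1)])
  interpret Q: primeideal Q S by (rule Qp)
  have Q0: "\<zero>\<^bsub>S\<^esub> \<in> Q" and Qadd: "\<And>a b. a \<in> Q \<Longrightarrow> b \<in> Q \<Longrightarrow> a \<oplus>\<^bsub>S\<^esub> b \<in> Q"
    and Qneg: "\<And>a. a \<in> Q \<Longrightarrow> \<ominus>\<^bsub>S\<^esub> a \<in> Q"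
    using additive_subgroup.zero_closed additive_subgroup.a_closed additive_subgroup.a_inv_closed
      Q.additive_subgroup_axioms by blast+
  have Q1: "\<one>\<^bsub>S\<^esub> \<notin> Q" using Q.one_imp_carrier Q.I_notcarr by auto
  obtain gs where gs: "set gs \<subseteq> carrier S" "carrier S = Span T gs"
    using integral_FCP_module_finite[OF R int fcp T] by blast
  define M where "M = Q \<inter> T"
  have MG: "subgroup M (add_monoid S)"
  proof (rule add.subgroupI)
    show "M \<subseteq> carrier S" using TD(1) by (auto simp: M_def)
    show "M \<noteq> {}" unfolding M_def using TD(2) Q0 by blast
    show "\<ominus>\<^bsub>S\<^esub> a \<in> M" if "a \<in> M" for a using that TD(5) Qneg by (auto simp: M_def)
    show "a \<oplus>\<^bsub>S\<^esub> b \<in> M" if "a \<in> M" "b \<in> M" for a b using that TD(7) Qadd by (auto simp: M_def)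
  qed
  have MT: "M \<subseteq> T" by (auto simp: M_def)
  have MM: "t \<otimes>\<^bsub>S\<^esub> m \<in> M" if "t \<in> T" "m \<in> M" for t m
    using that TD(6) Q.I_l_closed TC by (auto simp: M_def)
  \<comment> \<open>This is the ideal M S, written as a span of \<open>gs\<close> to match the
    hypothesis of \<open>nakayama_modulo_subring\<close>.\<close>
  define N where "N = Span M gs"
  have MN: "m \<otimes>\<^bsub>S\<^esub> s \<in> N" if m: "m \<in> M" and s: "s \<in> carrier S" for m s
    unfolding N_def
  proof (rule Span_smult[OF MG gs(1) _ TD(1)])
    show "m \<in> carrier S" using m MT TC by blast
    show "m \<otimes>\<^bsub>S\<^esub> t \<in> M" if "t \<in> T" for t
      using MM[OF that m] m_comm[of m t] TC that m MT by auto
    show "s \<in> Span T gs" using s gs(2) by simp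
  qed
  have MsubN: "M \<subseteq> N"
  proof
    fix m assume m: "m \<in> M"
    then have "m \<otimes>\<^bsub>S\<^esub> \<one>\<^bsub>S\<^esub> \<in> N" using MN by blast
    then show "m \<in> N" using m MT TC by auto
  qed
  note Nadd = Span_add_closed[OF MG gs(1), folded N_def]
  have Nzero: "\<zero>\<^bsub>S\<^esub> \<in> N" unfolding N_def by (rule zero_in_Span[OF MG gs(1)])
  have NC: "N \<subseteq> carrier S" unfolding N_def by (rule Span_subset_carrier[OF MG gs(1)])
  have NS: "s \<otimes>\<^bsub>S\<^esub> u \<in> N" if s: "s \<in> carrier S" and u: "u \<in> N" for s u
  proof -
    have "Span M gs \<subseteq> {u \<in> carrier S. s \<otimes>\<^bsub>S\<^esub> u \<in> N}"
    proof (rule Span_least)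
      fix m k assume mk: "m \<in> M" "k \<in> set gs"
      then have cl: "m \<in> carrier S" "k \<in> carrier S" using MT TC gs(1) by auto
      have "s \<otimes>\<^bsub>S\<^esub> (m \<otimes>\<^bsub>S\<^esub> k) = m \<otimes>\<^bsub>S\<^esub> (s \<otimes>\<^bsub>S\<^esub> k)" by (rule m_lcomm[OF s cl])
      then show "m \<otimes>\<^bsub>S\<^esub> k \<in> {u \<in> carrier S. s \<otimes>\<^bsub>S\<^esub> u \<in> N}"
        using MN[OF mk(1) m_closed[OF s cl(2)]] cl by simp
    qed (use s Nzero Nadd in \<open>auto simp: r_distr\<close>)
    then show ?thesis using u unfolding N_def by blast
  qed
  have N: "ideal N S"
  proof (rule idealI[OF ring_axioms])
    show "subgroup N (add_monoid S)"
    proof (rule add.subgroupI[OF NC])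
      show "N \<noteq> {}" using Nzero by auto
      show "\<ominus>\<^bsub>S\<^esub> u \<in> N" if u: "u \<in> N" for u
      proof -
        have "(\<ominus>\<^bsub>S\<^esub> \<one>\<^bsub>S\<^esub>) \<otimes>\<^bsub>S\<^esub> u \<in> N" using u by (intro NS) auto
        then show ?thesis using u NC by (auto simp: l_minus)
      qed
    qed (rule Nadd)
    show "s \<otimes>\<^bsub>S\<^esub> u \<in> N" if "u \<in> N" "s \<in> carrier S" for s u using NS that by blast
    then show "u \<otimes>\<^bsub>S\<^esub> s \<in> N" if "u \<in> N" "s \<in> carrier S" for s u
      using that NC m_comm[of u s] by auto
  qed
  interpret N: ideal N S by (rule N)
  have NQ: "N \<subseteq> Q"
    unfolding N_def
    by (rule Span_least) (use gs(1) Q0 Qadd Q.I_r_closed in \<open>auto simp: M_def\<close>)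
  \<comment> \<open>For t in \<open>T\<close> outside \<open>M\<close>, t^m (1 - t v) lies in the
    conductor and hence in \<open>Q\<close>. As t is not in \<open>Q\<close>, the factor 1 - t v
    lies in \<open>Q\<close> and in \<open>T\<close>, that is in \<open>M\<close>. So T/M is a
    field.\<close>
  have field: "\<forall>t \<in> T. t \<notin> N \<longrightarrow> (\<exists>v \<in> T. \<one>\<^bsub>S\<^esub> \<ominus>\<^bsub>S\<^esub> t \<otimes>\<^bsub>S\<^esub> v \<in> N)"
  proof (intro ballI impI)
    fix t assume t: "t \<in> T" "t \<notin> N"
    then have tQ: "t \<notin> Q" using MsubN by (auto simp: M_def)
    obtain v m where v: "v \<in> T" "t [^]\<^bsub>S\<^esub> (m::nat) \<otimes>\<^bsub>S\<^esub> (\<one>\<^bsub>S\<^esub> \<ominus>\<^bsub>S\<^esub> t \<otimes>\<^bsub>S\<^esub> v) \<in> conductor T"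
      by (rule power_regular_modulo_conductor_base[OF R int fcp T t(1)])
    have "\<one>\<^bsub>S\<^esub> \<ominus>\<^bsub>S\<^esub> t \<otimes>\<^bsub>S\<^esub> v \<in> T"
      using TD(3) TD(6)[OF t(1) v(1)] by (rule subring_minus_closed[OF Ts(1)])
    moreover from this have "\<one>\<^bsub>S\<^esub> \<ominus>\<^bsub>S\<^esub> t \<otimes>\<^bsub>S\<^esub> v \<in> Q"
      using Q.power_mult_in_primeD[OF TC[OF t(1)] TC tQ] v(2) Q(2) by blast
    ultimately have "\<one>\<^bsub>S\<^esub> \<ominus>\<^bsub>S\<^esub> t \<otimes>\<^bsub>S\<^esub> v \<in> N" using MsubN by (auto simp: M_def)
    then show "\<exists>v \<in> T. \<one>\<^bsub>S\<^esub> \<ominus>\<^bsub>S\<^esub> t \<otimes>\<^bsub>S\<^esub> v \<in> N" using v(1) by blast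
  qed
  have "\<exists>x \<in> carrier S. \<forall>t \<in> T. x \<ominus>\<^bsub>S\<^esub> t \<notin> N"
  proof (rule ccontr)
    assume none: "\<not> ?thesis"
    \<comment> \<open>If S = T + M S, Nakayama gives d congruent to 1 modulo \<open>M\<close> with d
      S \<subseteq> T. Then d is in the conductor and so in \<open>Q\<close>, while d - 1 is in
      \<open>M\<close> and so in \<open>Q\<close>; this would put 1 into \<open>Q\<close>.\<close>
    have "\<exists>d \<in> T. d \<ominus>\<^bsub>S\<^esub> \<one>\<^bsub>S\<^esub> \<in> M \<and> (\<forall>k \<in> set gs. d \<otimes>\<^bsub>S\<^esub> k \<in> T)"
    proof (rule nakayama_modulo_subring[OF Ts(1) MG MT MM gs(1) TD(3)])
      have "\<one>\<^bsub>S\<^esub> \<ominus>\<^bsub>S\<^esub> \<one>\<^bsub>S\<^esub> = \<zero>\<^bsub>S\<^esub>" by (simp add: a_minus_def r_neg)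
      then show "\<one>\<^bsub>S\<^esub> \<ominus>\<^bsub>S\<^esub> \<one>\<^bsub>S\<^esub> \<in> M" unfolding M_def using TD(2) Q0 by (metis IntI)
      fix k assume "k \<in> set gs"
      then have k: "k \<in> carrier S" using gs(1) by blast
      then obtain t where t: "t \<in> T" "k \<ominus>\<^bsub>S\<^esub> t \<in> N" using none by blast
      have "\<one>\<^bsub>S\<^esub> \<otimes>\<^bsub>S\<^esub> k = t \<oplus>\<^bsub>S\<^esub> (k \<ominus>\<^bsub>S\<^esub> t)" using k TC[OF t(1)] by algebra
      then show "\<exists>a \<in> T. \<exists>e \<in> Span M gs. \<one>\<^bsub>S\<^esub> \<otimes>\<^bsub>S\<^esub> k = a \<oplus>\<^bsub>S\<^esub> e"
        using t unfolding N_def by blast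
    qed
    then obtain d where d: "d \<in> T" "d \<ominus>\<^bsub>S\<^esub> \<one>\<^bsub>S\<^esub> \<in> M" "\<And>k. k \<in> set gs \<Longrightarrow> d \<otimes>\<^bsub>S\<^esub> k \<in> T" by blast
    have dC: "d \<in> carrier S" by (rule TC[OF d(1)])
    have "Span T gs \<subseteq> {u \<in> carrier S. d \<otimes>\<^bsub>S\<^esub> u \<in> T}"
    proof (rule Span_least)
      fix t k assume tk: "t \<in> T" "k \<in> set gs"
      then have cl: "t \<in> carrier S" "k \<in> carrier S" using TC gs(1) by auto
      have "d \<otimes>\<^bsub>S\<^esub> (t \<otimes>\<^bsub>S\<^esub> k) = t \<otimes>\<^bsub>S\<^esub> (d \<otimes>\<^bsub>S\<^esub> k)" using dC cl by (rule m_lcomm)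
      then show "t \<otimes>\<^bsub>S\<^esub> k \<in> {u \<in> carrier S. d \<otimes>\<^bsub>S\<^esub> u \<in> T}"
        using TD(6)[OF tk(1) d(3)[OF tk(2)]] cl by simp
    qed (use TD(2,7) dC in \<open>auto simp: r_distr\<close>)
    then have "d \<in> conductor T" unfolding gs(2)[symmetric] conductor_def using dC by blast
    then have "d \<in> Q" "d \<ominus>\<^bsub>S\<^esub> \<one>\<^bsub>S\<^esub> \<in> Q" using Q(2) d(2) by (auto simp: M_def)
    then have "d \<ominus>\<^bsub>S\<^esub> (d \<ominus>\<^bsub>S\<^esub> \<one>\<^bsub>S\<^esub>) \<in> Q"
      unfolding a_minus_def[of S d "d \<ominus>\<^bsub>S\<^esub> \<one>\<^bsub>S\<^esub>"] using Qadd Qneg by blast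
    moreover have "d \<ominus>\<^bsub>S\<^esub> (d \<ominus>\<^bsub>S\<^esub> \<one>\<^bsub>S\<^esub>) = \<one>\<^bsub>S\<^esub>" using dC by algebra
    ultimately show False using Q1 by simp
  qed
  then obtain x where x: "x \<in> carrier S" "\<forall>t \<in> T. x \<ominus>\<^bsub>S\<^esub> t \<notin> N" by blast
  obtain s where s: "s \<in> carrier S" "s \<notin> Q" and nonunit: "\<forall>r \<in> carrier S. s \<otimes>\<^bsub>S\<^esub> r \<ominus>\<^bsub>S\<^esub> \<one>\<^bsub>S\<^esub> \<notin> N"
    using locally_epi_ex_nonunit[OF S R epi Ts N field x Qp] by blast
  \<comment> \<open>Since s is not invertible modulo \<open>N\<close>, the ideal generated by s and
    \<open>N\<close> is proper. A maximal ideal above it is the second prime over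
    \<open>M\<close>.\<close>
  have I: "ideal (PIdl\<^bsub>S\<^esub> s <+>\<^bsub>S\<^esub> N) S"
    by (rule add_ideals[OF cgenideal_ideal[OF s(1)] N])
  have "\<one>\<^bsub>S\<^esub> \<notin> PIdl\<^bsub>S\<^esub> s <+>\<^bsub>S\<^esub> N"
  proof
    assume "\<one>\<^bsub>S\<^esub> \<in> PIdl\<^bsub>S\<^esub> s <+>\<^bsub>S\<^esub> N"
    then obtain r n where rn: "r \<in> carrier S" "n \<in> N" "\<one>\<^bsub>S\<^esub> = r \<otimes>\<^bsub>S\<^esub> s \<oplus>\<^bsub>S\<^esub> n"
      by (auto simp: set_add_def' cgenideal_def)
    have nC: "n \<in> carrier S" by (rule N.Icarr[OF rn(2)])
    have "s \<otimes>\<^bsub>S\<^esub> r \<ominus>\<^bsub>S\<^esub> (r \<otimes>\<^bsub>S\<^esub> s \<oplus>\<^bsub>S\<^esub> n) = \<ominus>\<^bsub>S\<^esub> n" using nC rn(1) s(1) by algebra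
    then have "s \<otimes>\<^bsub>S\<^esub> r \<ominus>\<^bsub>S\<^esub> \<one>\<^bsub>S\<^esub> \<in> N" using rn(2,3) by simp
    then show False using nonunit rn(1) by blast
  qed
  then obtain Q' where Q': "maximalideal Q' S" "PIdl\<^bsub>S\<^esub> s <+>\<^bsub>S\<^esub> N \<subseteq> Q'"
    by (rule ex_maximalideal_superset[OF I])
  interpret Q': primeideal Q' S by (rule maximalideal_prime[OF Q'(1)])
  have Q'1: "\<one>\<^bsub>S\<^esub> \<notin> Q'" using Q'.one_imp_carrier Q'.I_notcarr by auto
  have "s \<oplus>\<^bsub>S\<^esub> \<zero>\<^bsub>S\<^esub> \<in> PIdl\<^bsub>S\<^esub> s <+>\<^bsub>S\<^esub> N"
    unfolding set_add_def' using cgenideal_self[OF s(1)] Nzero by blast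
  then have sQ': "s \<in> Q'" using s(1) Q'(2) by auto
  have NQ': "N \<subseteq> Q'"
  proof
    fix n assume n: "n \<in> N"
    have "\<zero>\<^bsub>S\<^esub> \<in> PIdl\<^bsub>S\<^esub> s"
      using additive_subgroup.zero_closed[OF ideal.axioms(1)[OF cgenideal_ideal[OF s(1)]]] .
    then have "\<zero>\<^bsub>S\<^esub> \<oplus>\<^bsub>S\<^esub> n \<in> PIdl\<^bsub>S\<^esub> s <+>\<^bsub>S\<^esub> N" unfolding set_add_def' using n by blast
    then show "n \<in> Q'" using n NC Q'(2) by auto
  qed
  obtain y n where y: "y \<in> carrier S"
    and reg: "s [^]\<^bsub>S\<^esub> (n::nat) \<otimes>\<^bsub>S\<^esub> (\<one>\<^bsub>S\<^esub> \<ominus>\<^bsub>S\<^esub> s \<otimes>\<^bsub>S\<^esub> y) \<in> conductor T"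
    and idem: "(s \<otimes>\<^bsub>S\<^esub> y) \<otimes>\<^bsub>S\<^esub> (s \<otimes>\<^bsub>S\<^esub> y) \<ominus>\<^bsub>S\<^esub> s \<otimes>\<^bsub>S\<^esub> y \<in> conductor T"
    by (rule ex_idempotent_modulo_conductor[OF R int fcp T s(1)])
  define b where "b = s \<otimes>\<^bsub>S\<^esub> y"
  have b: "b \<in> carrier S" unfolding b_def using s(1) y by simp
  have bQ': "b \<in> Q'" unfolding b_def using sQ' y by (rule Q'.I_r_closed)
  \<comment> \<open>No power of s is in \<open>Q\<close>, so \<open>reg\<close> puts the other
    factor there.\<close>
  have "\<one>\<^bsub>S\<^esub> \<ominus>\<^bsub>S\<^esub> b \<in> Q"
    using Q.power_mult_in_primeD[OF s(1) _ s(2)] reg Q(2) b unfolding b_def[symmetric] by blast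
  have bQ: "b \<notin> Q"
  proof
    assume "b \<in> Q"
    with \<open>\<one>\<^bsub>S\<^esub> \<ominus>\<^bsub>S\<^esub> b \<in> Q\<close> have "(\<one>\<^bsub>S\<^esub> \<ominus>\<^bsub>S\<^esub> b) \<oplus>\<^bsub>S\<^esub> b \<in> Q" by (rule Qadd)
    moreover have "(\<one>\<^bsub>S\<^esub> \<ominus>\<^bsub>S\<^esub> b) \<oplus>\<^bsub>S\<^esub> b = \<one>\<^bsub>S\<^esub>" using b by algebra
    ultimately show False using Q1 by simp
  qed
  \<comment> \<open>An element of \<open>T\<close> outside \<open>Q\<close> is invertible modulo
    \<open>N\<close>, hence outside every proper ideal that contains \<open>N\<close>; but
    \<open>b\<close> is in \<open>Q'\<close>.\<close>
  have "b \<notin> T"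
  proof
    assume bT: "b \<in> T"
    then obtain v where v: "v \<in> T" "\<one>\<^bsub>S\<^esub> \<ominus>\<^bsub>S\<^esub> b \<otimes>\<^bsub>S\<^esub> v \<in> N" using field bQ NQ by blast
    have "(\<one>\<^bsub>S\<^esub> \<ominus>\<^bsub>S\<^esub> b \<otimes>\<^bsub>S\<^esub> v) \<oplus>\<^bsub>S\<^esub> b \<otimes>\<^bsub>S\<^esub> v \<in> Q'"
      using v(2) NQ' Q'.I_r_closed[OF bQ' TC[OF v(1)]] 
      by (intro additive_subgroup.a_closed[OF Q'.additive_subgroup_axioms]) auto
    moreover have "(\<one>\<^bsub>S\<^esub> \<ominus>\<^bsub>S\<^esub> b \<otimes>\<^bsub>S\<^esub> v) \<oplus>\<^bsub>S\<^esub> b \<otimes>\<^bsub>S\<^esub> v = \<one>\<^bsub>S\<^esub>" using b TC[OF v(1)] by algebra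
    ultimately show False using Q'1 by simp
  qed
  moreover have idem': "b \<otimes>\<^bsub>S\<^esub> b \<ominus>\<^bsub>S\<^esub> b \<in> conductor T" using idem by (simp add: b_def)
  moreover have "b \<otimes>\<^bsub>S\<^esub> b \<otimes>\<^bsub>S\<^esub> b \<ominus>\<^bsub>S\<^esub> b \<otimes>\<^bsub>S\<^esub> b \<in> conductor T"
  proof -
    have "b \<otimes>\<^bsub>S\<^esub> b \<otimes>\<^bsub>S\<^esub> b \<ominus>\<^bsub>S\<^esub> b \<otimes>\<^bsub>S\<^esub> b = (b \<otimes>\<^bsub>S\<^esub> b \<ominus>\<^bsub>S\<^esub> b) \<otimes>\<^bsub>S\<^esub> b" using b by algebra
    then show ?thesis using C.I_r_closed[OF idem' b] by simp
  qed
  ultimately show ?thesis using b conductor_subset[OF Ts(1)] by blast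
qed

lemma locally_epi_imp_cu_elementary:
  assumes S: "cring S" and R: "subring R S" and int: "integral_extension S R" and fcp: "FCP S R"
    and epi: "locally_epi (S\<lparr>carrier := R\<rparr>) S id"
  shows "cu_elementary S R (carrier S)"
proof -
  interpret cring S by (rule S)
  let ?A = "{T \<in> subalgebras S R. cu_elementary S R T}"
  have "R \<in> ?A" using R by (simp add: subalgebras_def cu_elementary_def)
  then have "?A \<subseteq> subalgebras S R" "?A \<noteq> {}" by auto
  from FCP_ex_maximal[OF fcp this]
  obtain T where T: "T \<in> ?A" and max: "\<forall>V \<in> ?A. T \<subseteq> V \<longrightarrow> V = T" ..
  have Ts: "T \<in> subalgebras S R" "subring T S" "R \<subseteq> T" and cu: "cu_elementary S R T"
    using T by (auto simp: subalgebras_def)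
  have "T = carrier S"
  proof (rule ccontr)
    assume "T \<noteq> carrier S"
    then obtain b where b: "b \<in> carrier S" "b \<notin> T" "b \<otimes>\<^bsub>S\<^esub> b \<ominus>\<^bsub>S\<^esub> b \<in> T"
      "b \<otimes>\<^bsub>S\<^esub> b \<otimes>\<^bsub>S\<^esub> b \<ominus>\<^bsub>S\<^esub> b \<otimes>\<^bsub>S\<^esub> b \<in> T"
      using locally_epi_ex_u_elementary_element[OF S R int fcp epi Ts(1)] by blast
    let ?V = "simple_extension T b"
    have V: "subring ?V S" "T \<subseteq> ?V" "b \<in> ?V"
      using simple_extension_subring[OF Ts(2) b(1)] simple_extension_mem[OF Ts(2) b(1)]
        simple_extension_incl[OF subringE(1)[OF Ts(2)] b(1)] by auto
    have "b [^]\<^bsub>S\<^esub> (2::nat) = b \<otimes>\<^bsub>S\<^esub> b" "b [^]\<^bsub>S\<^esub> (3::nat) = b \<otimes>\<^bsub>S\<^esub> b \<otimes>\<^bsub>S\<^esub> b"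
      using b(1) by (simp_all add: numeral_2_eq_2 numeral_3_eq_3)
    then have "u_elementary S T ?V"
      unfolding u_elementary_def using Ts(2) V b(3,4) by (intro conjI bexI[of _ b]) auto
    then have "cu_elementary S R ?V"
      using cu unfolding cu_elementary_def by (rule rtranclp.rtrancl_into_rtrancl[rotated])
    then have "?V = T" using max V Ts(3) by (auto simp: subalgebras_def)
    then show False using V(3) b(2) by simp
  qed
  then show ?thesis using cu by simp
qed

theorem theorem5p7:
  fixes S :: "('a, 'm) ring_scheme" and R :: "'a set"
  assumes "cring S"
    and "subring R S"
    and "R \<subset> carrier S"
    and "integral_extension S R"
    and "FCP S R"
  shows "(u_integral S R \<longleftrightarrow> locally_epi (S\<lparr>carrier := R\<rparr>) S id) \<and>
    (u_integral S R \<longrightarrow> unramified (S\<lparr>carrier := R\<rparr>) S id)"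
  using u_integral_iff_cu_elementary[OF assms(1,2,5)] cu_elementary_imp_locally_epi[OF assms(1,2)]
    locally_epi_imp_cu_elementary[OF assms(1,2,4,5)] cu_elementary_imp_unramified[OF assms(1,2,4,5)]
  by blast

end
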